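(* Assume that there exists a constant $0<\varepsilon_0<1$ such that $0<\varepsilon_0\le\varepsilon\le 1$, and that $$\frac{\sigma_s}{\beta+\sigma_s}<\varepsilon_0.$$ Then the iterative scheme $$\begin{cases} q^n-K_1q^n=K_2G^n+f_1,\\ G^{n+1}=K_3G^n+K_4q^n+f_2,\end{cases}\qquad n=0,1,2,\dots,$$ is convergent; that is, for any initial $G^0\in L^p(V)$ the sequence $(q^n,G^n)$ converges in $L^p(S)\times L^p(V)$.
   Context: Setting: $V\subset\mathbb{R}^3$ is a bounded domain with piecewise smooth boundary $S$. The constants $\sigma_a,\sigma_s\ge 0$ (absorption and scattering coefficients) satisfy $\beta:=\sigma_a+\sigma_s>0$ (extinction coefficient), and $\varepsilon$ (emissivity of the boundary) is a constant. For $\mathbf{x}\in S$ at which $S$ is smooth, $\mathbf{n}_{\mathbf{x}}$ is the outward unit normal. For points $\mathbf{p}\neq\mathbf{r}$ of $\overline V$, put $\cos\phi_p=\frac{(\mathbf{p}-\mathbf{r})\cdot\mathbf{n}_{\mathbf{p}}}{|\mathbf{p}-\mathbf{r}|}$ when $\mathbf{p}\in S$ and $\cos\phi_r=\frac{(\mathbf{r}-\mathbf{p})\cdot\mathbf{n}_{\mathbf{r}}}{|\mathbf{p}-\mathbf{r}|}$ when $\mathbf{r}\in S$. The visibility function is $\chi(\mathbf{p},\mathbf{r})=1$ if $\mathbf{r}$ can be seen by $\mathbf{p}$, i.e. there is no opaque material between them: the open segment between $\mathbf{p}$ and $\mathbf{r}$ lies in $V$ (so does not meet $S$); otherwise $\chi(\mathbf{p},\mathbf{r})=0$.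 Operators ($q$ a function on $S$, $G$ a function on $V$; $K_1q$ and $K_2G$ are functions of $\mathbf{p}\in S$, $K_3G$ and $K_4q$ are functions of $\mathbf{p}\in V$): $$(K_1q)(\mathbf{p})=\frac{1-\varepsilon}{\pi}\int_S e^{-\beta|\mathbf{p}-\mathbf{r}|}\frac{\cos\phi_p\cos\phi_r}{|\mathbf{p}-\mathbf{r}|^2}\chi(\mathbf{p},\mathbf{r})q(\mathbf{r})\,dS(\mathbf{r}),$$ $$(K_2G)(\mathbf{p})=\frac{\varepsilon\sigma_s}{4\pi}\int_V e^{-\beta|\mathbf{p}-\mathbf{r}|}\frac{\cos\phi_p}{|\mathbf{p}-\mathbf{r}|^2}\chi(\mathbf{p},\mathbf{r})G(\mathbf{r})\,dV(\mathbf{r}),$$ $$(K_3G)(\mathbf{p})=\frac{\sigma_s}{4\pi}\int_V e^{-\beta|\mathbf{p}-\mathbf{r}|}\frac{1}{|\mathbf{p}-\mathbf{r}|^2}\chi(\mathbf{p},\mathbf{r})G(\mathbf{r})\,dV(\mathbf{r}),$$ $$(K_4q)(\mathbf{p})=\frac{1-\varepsilon}{\varepsilon\pi}\int_S e^{-\beta|\mathbf{p}-\mathbf{r}|}\frac{\cos\phi_r}{|\mathbf{p}-\mathbf{r}|^2}\chi(\mathbf{p},\mathbf{r})q(\mathbf{r})\,dS(\mathbf{r}).$$ Data: the temperature $T$ on $\overline V$ is known, $E_b=\sigma T^4$ and $I_b=\sigma T^4/\pi$ with $\sigma>0$ the Stefan–Boltzmann constant, and $$f_1(\mathbf{p})=\varepsilon\int_S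 E_b(\mathbf{r})e^{-\beta|\mathbf{p}-\mathbf{r}|}\frac{\cos\phi_p\cos\phi_r}{\pi|\mathbf{p}-\mathbf{r}|^2}\chi(\mathbf{p},\mathbf{r})\,dS(\mathbf{r})-\varepsilon E_b(\mathbf{p})+\varepsilon\sigma_a\int_V I_b(\mathbf{r})e^{-\beta|\mathbf{p}-\mathbf{r}|}\frac{\cos\phi_p}{|\mathbf{p}-\mathbf{r}|^2}\chi(\mathbf{p},\mathbf{r})\,dV(\mathbf{r}),\quad \mathbf{p}\in S,$$ $$f_2(\mathbf{p})=\int_S E_b(\mathbf{r})e^{-\beta|\mathbf{p}-\mathbf{r}|}\frac{\cos\phi_r}{\pi|\mathbf{p}-\mathbf{r}|^2}\chi(\mathbf{p},\mathbf{r})\,dS(\mathbf{r})+\sigma_a\int_V I_b(\mathbf{r})e^{-\beta|\mathbf{p}-\mathbf{r}|}\frac{1}{|\mathbf{p}-\mathbf{r}|^2}\chi(\mathbf{p},\mathbf{r})\,dV(\mathbf{r}),\quad \mathbf{p}\in V.$$ Here $p\in[1,\infty]$ is any fixed exponent (not to be confused with the point $\mathbf{p}$), and $T$ is such that $f_1\in L^p(S)$ and $f_2\in L^p(V)$. *)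

theory Defs
  imports "HOL-Analysis.Analysis" "HOL-Probability.Essential_Supremum"
begin

section \<open>Lebesgue spaces\<close>

text \<open>The exponent ranges over \<open>[1, \<infinity>]\<close>.  Elements are represented by measurable functions;
  equality in the Lebesgue space is almost everywhere equality.\<close>

definition Lp_space :: "ennreal \<Rightarrow> 'a measure \<Rightarrow> ('a \<Rightarrow> real) set" where
  "Lp_space p M = {f \<in> borel_measurable M.
     if p = \<infinity> then esssup M (\<lambda>x. ennreal \<bar>f x\<bar>) < \<infinity>
     else integrable M (\<lambda>x. \<bar>f x\<bar> powr enn2real p)}"

definition Lp_norm :: "ennreal \<Rightarrow> 'a measure \<Rightarrow> ('a \<Rightarrow> real) \<Rightarrow> real" where
  "Lp_norm p M f =
     (if p = \<infinity> then enn2real (esssup M (\<lambda>x. ennreal \<bar>f x\<bar>))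
      else (LINT x|M. \<bar>f x\<bar> powr enn2real p) powr (1 / enn2real p))"

definition Lp_converges :: "ennreal \<Rightarrow> 'a measure \<Rightarrow> (nat \<Rightarrow> 'a \<Rightarrow> real) \<Rightarrow> ('a \<Rightarrow> real) \<Rightarrow> bool" where
  "Lp_converges p M f g \<longleftrightarrow>
     (\<forall>n. f n \<in> Lp_space p M) \<and> g \<in> Lp_space p M \<and>
     (\<lambda>n. Lp_norm p M (\<lambda>x. f n x - g x)) \<longlonglongrightarrow> 0"


section \<open>Smooth boundary points and the outward unit normal\<close>

text \<open>Near a smooth boundary point, \<open>V\<close> lies on one side of its frontier, which is the zero set
  of a \<open>C\<^sup>1\<close> function \<open>g\<close> with nonvanishing gradient \<open>g'\<close>; the gradient points out of \<open>V\<close>.\<close>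

definition local_defining_function ::
  "(real^3) set \<Rightarrow> real^3 \<Rightarrow> (real^3) set \<Rightarrow> (real^3 \<Rightarrow> real) \<Rightarrow> (real^3 \<Rightarrow> real^3) \<Rightarrow> bool" where
  "local_defining_function V x U g g' \<longleftrightarrow>
     open U \<and> x \<in> U \<and>
     (\<forall>y\<in>U. GDERIV g y :> g' y) \<and> continuous_on U g' \<and> (\<forall>y\<in>U. g' y \<noteq> 0) \<and>
     V \<inter> U = {y\<in>U. g y < 0} \<and> frontier V \<inter> U = {y\<in>U. g y = 0}"

definition smooth_boundary_point :: "(real^3) set \<Rightarrow> real^3 \<Rightarrow> bool" where
  "smooth_boundary_point V x \<longleftrightarrow>
     x \<in> frontier V \<and> (\<exists>U g g'. local_defining_function V x U g g')"

text \<open>The value \<open>0\<close> at all other points is a convention; on the boundary these points form a set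
  of surface measure zero.\<close>

definition outward_normal :: "(real^3) set \<Rightarrow> real^3 \<Rightarrow> real^3" where
  "outward_normal V x =
     (if smooth_boundary_point V x
      then (THE n. \<exists>U g g'. local_defining_function V x U g g' \<and> n = g' x /\<^sub>R norm (g' x))
      else 0)"


section \<open>Piecewise smooth boundaries and the surface measure\<close>

definition C1_on :: "('a::euclidean_space \<Rightarrow> 'b::euclidean_space) \<Rightarrow> 'a set \<Rightarrow> bool" where
  "C1_on f U \<longleftrightarrow> (\<exists>f' :: 'a \<Rightarrow> 'a \<Rightarrow>\<^sub>L 'b.
     (\<forall>x\<in>U. (f has_derivative blinfun_apply (f' x)) (at x)) \<and> continuous_on U f')"

definition surface_normal :: "(real^2 \<Rightarrow> real^3) \<Rightarrow> real^2 \<Rightarrow> real^3" where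
  "surface_normal \<phi> u =
     cross3 (frechet_derivative \<phi> (at u) (axis 1 1)) (frechet_derivative \<phi> (at u) (axis 2 1))"

text \<open>A patch \<open>(K, \<phi>)\<close> is the parametrized compact surface piece \<open>\<phi> ` K\<close>.  Injectivity and
  regularity are only required on the interior of \<open>K\<close>, so that for instance spherical coordinates
  and the apex of a cone are allowed.\<close>

type_synonym surface_patches = "((real^2) set \<times> (real^2 \<Rightarrow> real^3)) set"

definition smooth_patch :: "(real^2) set \<times> (real^2 \<Rightarrow> real^3) \<Rightarrow> bool" where
  "smooth_patch = (\<lambda>(K, \<phi>).
     compact K \<and> negligible (frontier K) \<and>
     (\<exists>U. open U \<and> K \<subseteq> U \<and> C1_on \<phi> U) \<and>
     inj_on \<phi> (interior K) \<and> (\<forall>u\<in>interior K. surface_normal \<phi> u \<noteq> 0))"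

definition piecewise_smooth_boundary ::
  "(real^3) set \<Rightarrow> surface_patches \<Rightarrow> bool" where
  "piecewise_smooth_boundary V P \<longleftrightarrow>
     finite P \<and> (\<forall>patch\<in>P. smooth_patch patch) \<and>
     frontier V = (\<Union>(K, \<phi>)\<in>P. \<phi> ` K) \<and>
     disjoint_family_on (\<lambda>(K, \<phi>). \<phi> ` interior K) P \<and>
     (\<forall>(K, \<phi>)\<in>P. \<forall>u\<in>interior K. smooth_boundary_point V (\<phi> u))"

text \<open>The edges \<open>\<phi> ` frontier K\<close> have area zero and are left out.\<close>

definition borel_surface_measure :: "surface_patches \<Rightarrow> (real^3) measure" where
  "borel_surface_measure P = measure_of UNIV (sets borel) (\<lambda>A.
     \<Sum>(K, \<phi>)\<in>P. \<integral>\<^sup>+u. ennreal (norm (surface_normal \<phi> u)) *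
       indicator {u \<in> interior K. \<phi> u \<in> A} u \<partial>lborel)"

text \<open>The space of this measure is the whole of \<open>\<real>\<^sup>3\<close>, with null complement of the surface.
  By completeness, values off the surface affect neither measurability nor integrals.\<close>

definition surface_measure :: "surface_patches \<Rightarrow> (real^3) measure" where
  "surface_measure P = completion (borel_surface_measure P)"

lemma C1_on_surface_normal:
  assumes "open U" "C1_on \<phi> U"
  shows "continuous_on U \<phi>" "continuous_on U (surface_normal \<phi>)"
proof -
  obtain f' :: "real^2 \<Rightarrow> (real^2) \<Rightarrow>\<^sub>L (real^3)" where
    f': "\<And>x. x \<in> U \<Longrightarrow> (\<phi> has_derivative blinfun_apply (f' x)) (at x)" "continuous_on U f'"
    using assms(2) unfolding C1_on_def by blast
  show "continuous_on U \<phi>"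
    using f'(1) by (meson continuous_at_imp_continuous_on has_derivative_continuous)
  have eq: "frechet_derivative \<phi> (at u) = blinfun_apply (f' u)" if "u \<in> U" for u
    using frechet_derivative_at[OF f'(1)[OF that]] by simp
  have "continuous_on U (\<lambda>u. cross3 (f' u (axis 1 1)) (f' u (axis 2 1)))"
    by (intro continuous_on_cross continuous_intros f'(2))
  then show "continuous_on U (surface_normal \<phi>)"
    by (rule continuous_on_eq) (simp add: surface_normal_def eq)
qed

lemma sets_borel_surface_measure [simp, measurable_cong]:
  "sets (borel_surface_measure P) = sets borel"
  unfolding borel_surface_measure_def using sets.sigma_sets_eq[of borel] by simp

lemma space_borel_surface_measure [simp]: "space (borel_surface_measure P) = UNIV"
  unfolding borel_surface_measure_def by simp

lemma emeasure_borel_surface_measure: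
  assumes P: "piecewise_smooth_boundary V P" and A: "A \<in> sets borel"
  shows "emeasure (borel_surface_measure P) A =
    (\<Sum>(K, \<phi>)\<in>P. \<integral>\<^sup>+u. ennreal (norm (surface_normal \<phi> u)) *
       indicator {u \<in> interior K. \<phi> u \<in> A} u \<partial>lborel)"
proof -
  let ?D = "\<lambda>\<phi> u. ennreal (norm (surface_normal \<phi> u))"
  let ?N = "\<lambda>(K, \<phi>). distr (density (restrict_space lborel (interior K)) (?D \<phi>)) borel \<phi>"
  have N: "emeasure (?N (K, \<phi>)) B = (\<integral>\<^sup>+u. ?D \<phi> u * indicator {u \<in> interior K. \<phi> u \<in> B} u \<partial>lborel)"
    if KP: "(K, \<phi>) \<in> P" and B: "B \<in> sets borel" for K \<phi> B
  proof -
    from P KP obtain U where U: "open U" "K \<subseteq> U" "C1_on \<phi> U"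
      unfolding piecewise_smooth_boundary_def smooth_patch_def by fast
    then have sub: "interior K \<subseteq> U" using interior_subset by blast
    have c: "continuous_on (interior K) \<phi>" "continuous_on (interior K) (surface_normal \<phi>)"
      using C1_on_surface_normal[OF U(1,3)] continuous_on_subset sub by blast+
    have m1 [measurable]: "\<phi> \<in> borel_measurable (restrict_space lborel (interior K))"
      and m2 [measurable]: "surface_normal \<phi> \<in> borel_measurable (restrict_space lborel (interior K))"
      using borel_measurable_continuous_on_restrict[OF c(1)]
        borel_measurable_continuous_on_restrict[OF c(2)]
      by (simp_all cong: measurable_cong_sets sets_restrict_space_cong)
    have sp: "space (restrict_space lborel (interior K)) = interior K"
      by (simp add: space_restrict_space)
    have "\<phi> -` B \<inter> space (restrict_space lborel (interior K)) \<in> sets (restrict_space lborel (interior K))"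
      using measurable_sets[OF m1 B] .
    then have S: "\<phi> -` B \<inter> interior K \<in> sets (restrict_space lborel (interior K))"
      by (simp add: sp)
    have "emeasure (?N (K, \<phi>)) B =
        emeasure (density (restrict_space lborel (interior K)) (?D \<phi>)) (\<phi> -` B \<inter> interior K)"
      using B by (simp add: emeasure_distr sp)
    also have "\<dots> = (\<integral>\<^sup>+u. ?D \<phi> u * indicator (\<phi> -` B \<inter> interior K) u \<partial>restrict_space lborel (interior K))"
      using S by (simp add: emeasure_density)
    also have "\<dots> = (\<integral>\<^sup>+u. ?D \<phi> u * indicator (\<phi> -` B \<inter> interior K) u * indicator (interior K) u \<partial>lborel)"
      by (subst nn_integral_restrict_space) auto
    also have "\<dots> = (\<integral>\<^sup>+u. ?D \<phi> u * indicator {u \<in> interior K. \<phi> u \<in> B} u \<partial>lborel)"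
      by (intro nn_integral_cong) (auto simp: indicator_def)
    finally show ?thesis .
  qed
  let ?m = "\<lambda>B. \<Sum>z\<in>P. emeasure (?N z) B"
  have m: "?m B = (\<Sum>(K, \<phi>)\<in>P. \<integral>\<^sup>+u. ?D \<phi> u * indicator {u \<in> interior K. \<phi> u \<in> B} u \<partial>lborel)"
    if "B \<in> sets borel" for B
    by (intro sum.cong refl) (use N that in fastforce)
  have "countably_additive (sets borel) ?m"
  proof (rule countably_additiveI)
    fix B :: "nat \<Rightarrow> (real^3) set"
    assume B: "range B \<subseteq> sets borel" "disjoint_family B"
    have ca: "(\<Sum>i. emeasure (?N z) (B i)) = emeasure (?N z) (\<Union>i. B i)" for z
      using B by (intro suminf_emeasure) (auto split: prod.splits)
    have "(\<Sum>i. ?m (B i)) = (\<Sum>z\<in>P. \<Sum>i. emeasure (?N z) (B i))"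
      by (rule suminf_sum) simp
    then show "(\<Sum>i. ?m (B i)) = ?m (\<Union>i. B i)" by (simp add: ca)
  qed
  then have ca: "countably_additive (sets borel)
      (\<lambda>A. \<Sum>(K, \<phi>)\<in>P. \<integral>\<^sup>+u. ?D \<phi> u * indicator {u \<in> interior K. \<phi> u \<in> A} u \<partial>lborel)"
    (is "countably_additive _ ?\<mu>")
  proof -
    assume c: "countably_additive (sets borel) ?m"
    have "(\<Sum>i. ?\<mu> (B i)) = ?\<mu> (\<Union>i. B i)"
      if B: "range B \<subseteq> sets borel" "disjoint_family B" "(\<Union>i. B i) \<in> sets borel" for B :: "nat \<Rightarrow> _"
    proof -
      have "?m (B i) = ?\<mu> (B i)" for i using B(1) by (intro m) blast
      moreover have "?m (\<Union>i. B i) = ?\<mu> (\<Union>i. B i)" using B(3) by (rule m)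
      moreover have "(\<Sum>i. ?m (B i)) = ?m (\<Union>i. B i)"
        using c B unfolding countably_additive_def by blast
      ultimately show ?thesis by simp
    qed
    then show ?thesis unfolding countably_additive_def by blast
  qed
  show ?thesis
    unfolding borel_surface_measure_def
    using ca A sets.sigma_sets_eq[of "borel :: (real^3) measure"]
    by (intro emeasure_measure_of_sigma)
      (auto simp: positive_def sets.sigma_algebra_axioms
        intro: sets.sigma_algebra_axioms[of borel, simplified])
qed


section \<open>Radiative transfer operators\<close>

text \<open>\<open>incidence_cos V p r\<close> is the cosine at the boundary point \<open>p\<close> and \<open>incidence_cos V r p\<close>
  the one at the boundary point \<open>r\<close>.\<close>

definition incidence_cos :: "(real^3) set \<Rightarrow> real^3 \<Rightarrow> real^3 \<Rightarrow> real" where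
  "incidence_cos V p r = ((p - r) \<bullet> outward_normal V p) / norm (p - r)"

definition visibility :: "(real^3) set \<Rightarrow> real^3 \<Rightarrow> real^3 \<Rightarrow> real" where
  "visibility V p r = (if open_segment p r \<subseteq> V then 1 else 0)"

text \<open>At \<open>p = r\<close> the kernels below take the value \<open>0\<close>, by the convention \<open>x / 0 = 0\<close>.\<close>

definition K1 ::
  "(real^3) set \<Rightarrow> surface_patches \<Rightarrow> real \<Rightarrow> real \<Rightarrow> (real^3 \<Rightarrow> real) \<Rightarrow> real^3 \<Rightarrow> real" where
  "K1 V P \<beta> \<epsilon> q p = (1 - \<epsilon>) / pi * (LINT r|surface_measure P.
     exp (- \<beta> * norm (p - r)) * (incidence_cos V p r * incidence_cos V r p / (norm (p - r))\<^sup>2)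
       * visibility V p r * q r)"

definition K2 ::
  "(real^3) set \<Rightarrow> real \<Rightarrow> real \<Rightarrow> real \<Rightarrow> (real^3 \<Rightarrow> real) \<Rightarrow> real^3 \<Rightarrow> real" where
  "K2 V \<beta> \<epsilon> \<sigma>\<^sub>s G p = \<epsilon> * \<sigma>\<^sub>s / (4 * pi) * (LINT r|lebesgue_on V.
     exp (- \<beta> * norm (p - r)) * (incidence_cos V p r / (norm (p - r))\<^sup>2)
       * visibility V p r * G r)"

definition K3 ::
  "(real^3) set \<Rightarrow> real \<Rightarrow> real \<Rightarrow> (real^3 \<Rightarrow> real) \<Rightarrow> real^3 \<Rightarrow> real" where
  "K3 V \<beta> \<sigma>\<^sub>s G p = \<sigma>\<^sub>s / (4 * pi) * (LINT r|lebesgue_on V.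
     exp (- \<beta> * norm (p - r)) * (1 / (norm (p - r))\<^sup>2) * visibility V p r * G r)"

definition K4 ::
  "(real^3) set \<Rightarrow> surface_patches \<Rightarrow> real \<Rightarrow> real \<Rightarrow> (real^3 \<Rightarrow> real) \<Rightarrow> real^3 \<Rightarrow> real" where
  "K4 V P \<beta> \<epsilon> q p = (1 - \<epsilon>) / (\<epsilon> * pi) * (LINT r|surface_measure P.
     exp (- \<beta> * norm (p - r)) * (incidence_cos V r p / (norm (p - r))\<^sup>2)
       * visibility V p r * q r)"

text \<open>In the data, \<open>\<sigma>\<close> is the Stefan--Boltzmann constant and \<open>T\<close> the temperature.\<close>

definition emissive_power :: "real \<Rightarrow> (real^3 \<Rightarrow> real) \<Rightarrow> real^3 \<Rightarrow> real" where
  "emissive_power \<sigma> T r = \<sigma> * T r ^ 4"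

definition blackbody_intensity :: "real \<Rightarrow> (real^3 \<Rightarrow> real) \<Rightarrow> real^3 \<Rightarrow> real" where
  "blackbody_intensity \<sigma> T r = \<sigma> * T r ^ 4 / pi"

definition f1 ::
  "(real^3) set \<Rightarrow> surface_patches \<Rightarrow> real \<Rightarrow> real \<Rightarrow> real \<Rightarrow> real \<Rightarrow> (real^3 \<Rightarrow> real) \<Rightarrow> real^3 \<Rightarrow> real" where
  "f1 V P \<beta> \<epsilon> \<sigma>\<^sub>a \<sigma> T p =
     \<epsilon> * (LINT r|surface_measure P. emissive_power \<sigma> T r * exp (- \<beta> * norm (p - r))
            * (incidence_cos V p r * incidence_cos V r p / (pi * (norm (p - r))\<^sup>2))
            * visibility V p r)
     - \<epsilon> * emissive_power \<sigma> T p
     + \<epsilon> * \<sigma>\<^sub>a * (LINT r|lebesgue_on V. blackbody_intensity \<sigma> T r * exp (- \<beta> * norm (p - r))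
            * (incidence_cos V p r / (norm (p - r))\<^sup>2) * visibility V p r)"

definition f2 ::
  "(real^3) set \<Rightarrow> surface_patches \<Rightarrow> real \<Rightarrow> real \<Rightarrow> real \<Rightarrow> (real^3 \<Rightarrow> real) \<Rightarrow> real^3 \<Rightarrow> real" where
  "f2 V P \<beta> \<sigma>\<^sub>a \<sigma> T p =
     (LINT r|surface_measure P. emissive_power \<sigma> T r * exp (- \<beta> * norm (p - r))
        * (incidence_cos V r p / (pi * (norm (p - r))\<^sup>2)) * visibility V p r)
     + \<sigma>\<^sub>a * (LINT r|lebesgue_on V. blackbody_intensity \<sigma> T r * exp (- \<beta> * norm (p - r))
        * (1 / (norm (p - r))\<^sup>2) * visibility V p r)"

text \<open>\<open>(q n, G n)\<close> is a run of the scheme in the spaces with exponent \<open>s\<close>, where the equations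
  hold as equations between elements of these spaces.\<close>

definition iterative_scheme ::
  "ennreal \<Rightarrow> (real^3) set \<Rightarrow> surface_patches \<Rightarrow> real \<Rightarrow> real \<Rightarrow> real \<Rightarrow> real \<Rightarrow> real \<Rightarrow> (real^3 \<Rightarrow> real) \<Rightarrow> (nat \<Rightarrow> real^3 \<Rightarrow> real) \<Rightarrow> (nat \<Rightarrow> real^3 \<Rightarrow> real) \<Rightarrow> bool" where
  "iterative_scheme s V P \<beta> \<epsilon> \<sigma>\<^sub>a \<sigma>\<^sub>s \<sigma> T q G \<longleftrightarrow>
     (\<forall>n. q n \<in> Lp_space s (surface_measure P) \<and> G n \<in> Lp_space s (lebesgue_on V) \<and>
        (AE p in surface_measure P.
           q n p - K1 V P \<beta> \<epsilon> (q n) p = K2 V \<beta> \<epsilon> \<sigma>\<^sub>s (G n) p + f1 V P \<beta> \<epsilon> \<sigma>\<^sub>a \<sigma> T p) \<and>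
        (AE p in lebesgue_on V.
           G (Suc n) p = K3 V \<beta> \<sigma>\<^sub>s (G n) p + K4 V P \<beta> \<epsilon> (q n) p + f2 V P \<beta> \<sigma>\<^sub>a \<sigma> T p))"

end

theory Submission
  imports Defs "HOL-Probability.Probability" "HOL-Real_Asymp.Real_Asymp"
begin

text \<open>
  Along every ray from a point \<open>p\<close> the function \<open>\<beta> exp(- \<beta> |x - p|) / |x - p|\<^sup>2\<close>, integrated behind the
  boundary point \<open>r\<close> seen from \<open>p\<close>, gives the attenuation factor of \<open>r\<close>.  Hence the surface integrals
  are integrals over the shadows \<open>{p + t (r - p) | t \<ge> 1}\<close> of visible surface pieces, which are disjoint
  from each other and from the visible part of \<open>V\<close>.  The total integral is \<open>4 \<pi>\<close>, or \<open>\<pi>\<close> when weighted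
  with the positive part of the cosine at \<open>p\<close>, so the suitably scaled kernels of \<open>K\<^sub>1\<close> and \<open>K\<^sub>2\<close>, and those
  of \<open>K\<^sub>3\<close> and \<open>K\<^sub>4\<close>, have total mass at most \<open>1\<close>; that of \<open>K\<^sub>3\<close> alone has mass at most \<open>1 - \<delta>\<close> because
  \<open>V\<close> is bounded.

  Successive differences of a run therefore satisfy two coupled inequalities with substochastic
  kernels.  Jensen's inequality turns them into inequalities for \<open>s\<close>-th powers, and integrating these,
  with the symmetry of the kernels, yields the contraction factor \<open>1 - \<epsilon> \<delta>\<close> for the \<open>s\<close>-th power
  of the norm of the interior unknown.  The case \<open>s = \<infinity>\<close> uses suprema instead.
\<close>

section \<open>Lebesgue spaces\<close>

text \<open>Neither update contracts by itself: the albedo may be 1, and the mass bounds of both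
  block rows are just 1. What forces decay is the interplay. Of the mass at an interior point a
  share of at most \<open>1 - \<delta>\<close> stays in the interior; the rest can come back only by
  way of the boundary, where the fraction \<open>1 - \<epsilon>\<close> is reflected. The worst case
  is (1 - \<epsilon>) \<delta> + (1 - \<delta>) = 1 - \<epsilon> \<delta>.

  The scaling is chosen to expose this. Dividing the boundary unknown by \<epsilon>/4 removes
  \<epsilon> from the coupling terms, so that it survives only as the factor 1 - \<epsilon> on
  whatever leaves the boundary. The resulting block kernel is symmetric once the volume measure is
  weighted by 4 \<beta>, which is \<beta> times the ratio of the totals 4 \<pi> and \<pi>. Symmetry
  lets the row bounds serve as column bounds. Working with powers instead of norms keeps one
  contraction factor for all exponents.\<close>

lemma powr_tangent_le:
  fixes x t s :: real
  assumes "1 \<le> s" "0 \<le> x" "0 \<le> t"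
  shows "s * t powr (s - 1) * x \<le> x powr s + (s - 1) * t powr s"
proof (cases "s = 1 \<or> x = 0 \<or> t = 0")
  case True
  then show ?thesis using assms by auto
next
  case False
  then have pos: "s > 1" "x > 0" "t > 0" using assms by auto
  \<comment> \<open>Young's inequality with weights \<open>1/s\<close> and \<open>(s - 1)/s\<close>
    expresses that the graph of the convex power lies above its tangent at \<open>t\<close>.\<close>
  have "(x powr s) powr (1/s) * (t powr s) powr ((s - 1)/s) \<le> (1/s) * x powr s + ((s - 1)/s) * t powr s"
    using pos by (intro Youngs_inequality_0) (auto simp: field_simps)
  moreover have "(x powr s) powr (1/s) = x" "(t powr s) powr ((s - 1)/s) = t powr (s - 1)"
    using pos by (simp_all add: powr_powr)
  ultimately have "x * t powr (s - 1) \<le> (x powr s + (s - 1) * t powr s) / s"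
    using pos by (simp add: field_simps)
  then show ?thesis using pos by (simp add: field_simps)
qed

text \<open>Convexity: \<open>x + y\<close> is the mean of \<open>x / \<theta>\<close> and
  \<open>y / (1 - \<theta>)\<close> with weights \<open>\<theta>\<close> and
  \<open>1 - \<theta>\<close>, so the tangent at \<open>x + y\<close> is applied to both. A small
  \<open>\<theta>\<close> brings the factor of \<open>y\<close> close to 1 at the price of a large
  factor of \<open>x\<close>.\<close>

lemma powr_add_le_weighted:
  fixes x y s \<theta> :: real
  assumes "1 \<le> s" "0 \<le> x" "0 \<le> y" "0 < \<theta>" "\<theta> < 1"
  shows "(x + y) powr s \<le> \<theta> powr (1 - s) * x powr s + (1 - \<theta>) powr (1 - s) * y powr s"
proof -
  let ?t = "x + y"
  have scale: "c * (z / c) powr s = c powr (1 - s) * z powr s" if "0 < c" "0 \<le> z" for c z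
    using that by (simp add: powr_divide powr_diff)
  have cancel: "c * (s * ?t powr (s - 1) * (z / c)) = s * ?t powr (s - 1) * z" if "0 < c" for c z
    using that by simp
  have "s * ?t powr (s - 1) * (z / c) \<le> (z / c) powr s + (s - 1) * ?t powr s" if "0 < c" "0 \<le> z" for c z
    using assms that by (intro powr_tangent_le) auto
  then have "c * (s * ?t powr (s - 1) * (z / c)) \<le> c * ((z / c) powr s + (s - 1) * ?t powr s)"
    if "0 < c" "0 \<le> z" for c z
    using that by (intro mult_left_mono) auto
  then have *: "s * ?t powr (s - 1) * z \<le> c powr (1 - s) * z powr s + c * ((s - 1) * ?t powr s)"
    if "0 < c" "0 \<le> z" for c z
    using that scale cancel by (metis distrib_left)
  have "s * ?t powr (s - 1) * ?t \<le>
      \<theta> powr (1 - s) * x powr s + (1 - \<theta>) powr (1 - s) * y powr s + (s - 1) * ?t powr s"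
    using *[of \<theta> x] *[of "1 - \<theta>" y] assms by (simp add: algebra_simps)
  moreover have "?t powr (s - 1) * ?t = ?t powr s"
    using assms by (cases "?t = 0") (simp_all add: powr_diff)
  ultimately have "s * (?t powr s) \<le>
      \<theta> powr (1 - s) * x powr s + (1 - \<theta>) powr (1 - s) * y powr s + (s - 1) * ?t powr s"
    by (metis mult.assoc)
  then show ?thesis by (simp add: left_diff_distrib)
qed

text \<open>For finite \<open>s\<close> the modular is the \<open>s\<close>-th power of the norm.\<close>

definition Lp_modular :: "ennreal \<Rightarrow> 'a measure \<Rightarrow> ('a \<Rightarrow> real) \<Rightarrow> ennreal" where
  "Lp_modular s M f =
     (if s = \<infinity> then esssup M (\<lambda>x. ennreal \<bar>f x\<bar>)
      else \<integral>\<^sup>+x. ennreal (\<bar>f x\<bar> powr enn2real s) \<partial>M)"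

text \<open>For finite \<open>s\<close> this is 2 to the power \<open>s - 1\<close>, from convexity
  with weight 1/2. The modular is not a norm, so its triangle inequality carries this factor; it
  enters only finiteness and limit arguments, never a contraction rate.\<close>

definition Lp_triangle_const :: "ennreal \<Rightarrow> real" where
  "Lp_triangle_const s = (if s = \<infinity> then 1 else (1/2) powr (1 - enn2real s))"



section \<open>Elementary properties of the modular\<close>

lemma one_le_enn2real:
  assumes "1 \<le> s" "s \<noteq> \<infinity>" shows "1 \<le> enn2real s"
  using assms by (cases s) auto

lemma Lp_space_iff:
  "f \<in> Lp_space s M \<longleftrightarrow> f \<in> borel_measurable M \<and> Lp_modular s M f < \<infinity>"
  unfolding Lp_space_def Lp_modular_def by (auto simp: integrable_iff_bounded)

lemma Lp_space_measurable: "f \<in> Lp_space s M \<Longrightarrow> f \<in> borel_measurable M"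
  by (simp add: Lp_space_def)

lemma Lp_modular_mono_AE:
  assumes "1 \<le> s" "f \<in> borel_measurable M" "AE x in M. \<bar>f x\<bar> \<le> \<bar>g x\<bar>"
  shows "Lp_modular s M f \<le> Lp_modular s M g"
proof (cases "s = \<infinity>")
  case True
  have "esssup M (\<lambda>x. ennreal \<bar>f x\<bar>) \<le> esssup M (\<lambda>x. ennreal \<bar>g x\<bar>)"
    using assms(2,3) by (intro esssup_AE_mono) (auto elim: eventually_mono intro: ennreal_leI)
  then show ?thesis using True by (simp add: Lp_modular_def)
next
  case False
  then show ?thesis
    using assms one_le_enn2real[OF assms(1) False] unfolding Lp_modular_def
    by (auto intro!: nn_integral_mono_AE ennreal_leI powr_mono2 elim!: eventually_mono)
qed

lemma Lp_modular_add:
  assumes "1 \<le> s" and [measurable]: "f \<in> borel_measurable M" "g \<in> borel_measurable M"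
  shows "Lp_modular s M (\<lambda>x. f x + g x) \<le> Lp_triangle_const s * (Lp_modular s M f + Lp_modular s M g)"
proof (cases "s = \<infinity>")
  case True
  have "AE x in M. ennreal \<bar>f x + g x\<bar> \<le> esssup M (\<lambda>x. ennreal \<bar>f x\<bar>) + esssup M (\<lambda>x. ennreal \<bar>g x\<bar>)"
    using esssup_AE[of "\<lambda>x. ennreal \<bar>f x\<bar>" M] esssup_AE[of "\<lambda>x. ennreal \<bar>g x\<bar>" M]
  proof eventually_elim
    case (elim x)
    have "ennreal \<bar>f x + g x\<bar> \<le> ennreal \<bar>f x\<bar> + ennreal \<bar>g x\<bar>"
      by (simp add: ennreal_leI abs_triangle_ineq del: ennreal_plus flip: ennreal_plus)
    then show ?case using add_mono[OF elim] by order
  qed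
  then show ?thesis
    using True by (auto simp: Lp_modular_def Lp_triangle_const_def intro!: esssup_I)
next
  case False
  let ?s = "enn2real s" and ?c = "(1/2) powr (1 - enn2real s) :: real"
  note s = one_le_enn2real[OF assms(1) False]
  have "\<bar>f x + g x\<bar> powr ?s \<le> ?c * (\<bar>f x\<bar> powr ?s + \<bar>g x\<bar> powr ?s)" for x
  proof -
    have "\<bar>f x + g x\<bar> powr ?s \<le> (\<bar>f x\<bar> + \<bar>g x\<bar>) powr ?s"
      using s by (intro powr_mono2) auto
    also have "\<dots> \<le> ?c * (\<bar>f x\<bar> powr ?s + \<bar>g x\<bar> powr ?s)"
      using powr_add_le_weighted[OF s, of "\<bar>f x\<bar>" "\<bar>g x\<bar>" "1/2"] by (simp add: algebra_simps)
    finally show ?thesis .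
  qed
  then have "(\<integral>\<^sup>+x. ennreal (\<bar>f x + g x\<bar> powr ?s) \<partial>M) \<le>
      (\<integral>\<^sup>+x. ennreal ?c * (ennreal (\<bar>f x\<bar> powr ?s) + ennreal (\<bar>g x\<bar> powr ?s)) \<partial>M)"
    by (intro nn_integral_mono) (simp add: ennreal_leI flip: ennreal_plus ennreal_mult)
  also have "\<dots> = ennreal ?c * ((\<integral>\<^sup>+x. ennreal (\<bar>f x\<bar> powr ?s) \<partial>M) + (\<integral>\<^sup>+x. ennreal (\<bar>g x\<bar> powr ?s) \<partial>M))"
    by (simp add: nn_integral_cmult nn_integral_add)
  finally show ?thesis using False by (simp add: Lp_modular_def Lp_triangle_const_def)
qed

lemma Lp_modular_uminus: "Lp_modular s M (\<lambda>x. - f x) = Lp_modular s M f"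
  by (simp add: Lp_modular_def)

lemma Lp_modular_zero: "1 \<le> s \<Longrightarrow> Lp_modular s M (\<lambda>x. 0) = 0"
proof -
  have "esssup M (\<lambda>x. 0 :: ennreal) = 0"
    using esssup_I[of "\<lambda>x. 0 :: ennreal" M 0] by simp
  then show ?thesis by (simp add: Lp_modular_def)
qed

lemma Lp_modular_cmult:
  assumes "1 \<le> s" and [measurable]: "f \<in> borel_measurable M"
  shows "Lp_modular s M (\<lambda>x. c * f x) \<le>
    ennreal (if s = \<infinity> then \<bar>c\<bar> else \<bar>c\<bar> powr enn2real s) * Lp_modular s M f"
proof (cases "s = \<infinity>")
  case True
  have "AE x in M. ennreal \<bar>c * f x\<bar> \<le> ennreal \<bar>c\<bar> * esssup M (\<lambda>x. ennreal \<bar>f x\<bar>)"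
    using esssup_AE[of "\<lambda>x. ennreal \<bar>f x\<bar>" M]
    by eventually_elim (simp add: abs_mult ennreal_mult mult_left_mono)
  then show ?thesis using True by (auto simp: Lp_modular_def intro!: esssup_I)
next
  case False
  then show ?thesis
    by (simp add: Lp_modular_def abs_mult powr_mult ennreal_mult nn_integral_cmult)
qed

lemma Lp_modular_eq_0D:
  assumes "1 \<le> s" "f \<in> borel_measurable M" "Lp_modular s M f = 0"
  shows "AE x in M. f x = 0"
proof (cases "s = \<infinity>")
  case True
  then have "esssup M (\<lambda>x. ennreal \<bar>f x\<bar>) = 0" using assms by (simp add: Lp_modular_def)
  then have "AE x in M. ennreal \<bar>f x\<bar> \<le> 0" using esssup_AE[of "\<lambda>x. ennreal \<bar>f x\<bar>" M] by simp
  then show ?thesis by eventually_elim simp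
next
  case False
  then have "(\<integral>\<^sup>+x. ennreal (\<bar>f x\<bar> powr enn2real s) \<partial>M) = 0" using assms by (simp add: Lp_modular_def)
  then have "AE x in M. ennreal (\<bar>f x\<bar> powr enn2real s) = 0"
    using assms(2) by (subst (asm) nn_integral_0_iff_AE) auto
  then show ?thesis by eventually_elim simp
qed

lemma Lp_space_add:
  assumes "1 \<le> s" "f \<in> Lp_space s M" "g \<in> Lp_space s M"
  shows "(\<lambda>x. f x + g x) \<in> Lp_space s M"
proof -
  have "Lp_modular s M (\<lambda>x. f x + g x) \<le> Lp_triangle_const s * (Lp_modular s M f + Lp_modular s M g)"
    using assms by (intro Lp_modular_add) (auto simp: Lp_space_iff)
  also have "\<dots> < \<infinity>"
    using assms by (simp add: Lp_space_iff ennreal_mult_less_top)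
  finally show ?thesis using assms by (auto simp: Lp_space_iff)
qed

lemma Lp_space_cmult:
  assumes "1 \<le> s" "f \<in> Lp_space s M"
  shows "(\<lambda>x. c * f x) \<in> Lp_space s M"
proof -
  have "Lp_modular s M (\<lambda>x. c * f x) \<le>
      ennreal (if s = \<infinity> then \<bar>c\<bar> else \<bar>c\<bar> powr enn2real s) * Lp_modular s M f"
    using assms by (intro Lp_modular_cmult) (auto simp: Lp_space_iff)
  also have "\<dots> < \<infinity>"
    using assms by (simp add: Lp_space_iff ennreal_mult_less_top)
  finally show ?thesis using assms by (auto simp: Lp_space_iff)
qed

lemma Lp_space_diff:
  assumes "1 \<le> s" "f \<in> Lp_space s M" "g \<in> Lp_space s M"
  shows "(\<lambda>x. f x - g x) \<in> Lp_space s M"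
  using Lp_space_add[OF assms(1,2) Lp_space_cmult[OF assms(1,3), of "-1"]] by simp

lemma Lp_space_zero: "1 \<le> s \<Longrightarrow> (\<lambda>x. 0) \<in> Lp_space s M"
  by (simp add: Lp_space_iff Lp_modular_zero)



section \<open>Convergence and completeness\<close>

lemma Lp_convergesI:
  assumes s: "1 \<le> s" and f: "\<And>n. f n \<in> Lp_space s M" and g: "g \<in> Lp_space s M"
    and lim: "(\<lambda>n. Lp_modular s M (\<lambda>x. f n x - g x)) \<longlonglongrightarrow> 0"
  shows "Lp_converges s M f g"
proof -
  let ?d = "\<lambda>n x. f n x - g x"
  have "(\<lambda>n. Lp_norm s M (?d n)) \<longlonglongrightarrow> 0"
  proof (cases "s = \<infinity>")
    case True
    have "(\<lambda>n. enn2real (Lp_modular s M (?d n))) \<longlonglongrightarrow> enn2real 0"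
      using lim by (intro tendsto_enn2real) auto
    then show ?thesis using True by (simp add: Lp_norm_def Lp_modular_def)
  next
    case False
    note s' = one_le_enn2real[OF s False]
    have "Lp_norm s M (?d n) = enn2real (Lp_modular s M (?d n)) powr (1 / enn2real s)" for n
    proof -
      have "(LINT x|M. \<bar>?d n x\<bar> powr enn2real s) = enn2real (\<integral>\<^sup>+x. ennreal (\<bar>?d n x\<bar> powr enn2real s) \<partial>M)"
        using f[of n] g by (intro integral_eq_nn_integral) (auto simp: Lp_space_iff)
      then show ?thesis using False by (simp add: Lp_norm_def Lp_modular_def)
    qed
    moreover have "(\<lambda>n. enn2real (Lp_modular s M (?d n)) powr (1 / enn2real s)) \<longlonglongrightarrow> 0 powr (1 / enn2real s)"
    proof (rule tendsto_powr')
      have "(\<lambda>n. enn2real (Lp_modular s M (?d n))) \<longlonglongrightarrow> enn2real 0"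
        using lim by (intro tendsto_enn2real) auto
      then show "(\<lambda>n. enn2real (Lp_modular s M (?d n))) \<longlonglongrightarrow> 0" by simp
    qed (use s' in auto)
    ultimately show ?thesis by simp
  qed
  then show ?thesis using f g by (simp add: Lp_converges_def)
qed

text \<open>Plays the role of Minkowski's inequality. Splitting off the first summand multiplies the
  remaining sum by \<open>(1 - \<theta>) powr (1 - s)\<close>, while the index shift gains a factor
  \<open>\<rho>\<close>; choosing \<open>\<theta>\<close> so small that the product stays below 1
  makes the bound uniform in \<open>m\<close>.\<close>

lemma nn_integral_geometric_sum_le:
  fixes d :: "nat \<Rightarrow> 'a \<Rightarrow> real" and s \<rho> C :: real
  assumes s: "1 \<le> s" and \<rho>: "0 \<le> \<rho>" "\<rho> < 1" and C: "0 \<le> C"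
    and [measurable]: "\<And>n. d n \<in> borel_measurable M"
    and d: "\<And>n. (\<integral>\<^sup>+x. ennreal (\<bar>d n x\<bar> powr s) \<partial>M) \<le> ennreal (C * \<rho> ^ n)"
  obtains K where "0 \<le> K"
    "\<And>m n. (\<integral>\<^sup>+x. ennreal ((\<Sum>k<m. \<bar>d (n + k) x\<bar>) powr s) \<partial>M) \<le> ennreal (K * \<rho> ^ n)"
proof -
  have "((\<lambda>\<theta>. (1 - \<theta>) powr (1 - s) * \<rho>) \<longlongrightarrow> (1 - 0) powr (1 - s) * \<rho>) (at_right 0)"
    by (intro tendsto_intros) auto
  then have "eventually (\<lambda>\<theta>. (1 - \<theta>) powr (1 - s) * \<rho> < 1) (at_right 0)"
    using \<rho> by (intro order_tendstoD(2)) auto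
  moreover have "eventually (\<lambda>\<theta>::real. \<theta> \<in> {0<..<1}) (at_right 0)"
    by (rule eventually_at_right_real) simp
  ultimately have "eventually (\<lambda>\<theta>. (1 - \<theta>) powr (1 - s) * \<rho> < 1 \<and> \<theta> \<in> {0<..<1}) (at_right 0)"
    by eventually_elim blast
  then obtain \<theta> where \<theta>: "0 < \<theta>" "\<theta> < 1" "(1 - \<theta>) powr (1 - s) * \<rho> < 1"
    by (metis (no_types, lifting) eventually_happens' greaterThanLessThan_iff trivial_limit_at_right_real)
  define u v where "u = \<theta> powr (1 - s)" and "v = (1 - \<theta>) powr (1 - s)"
  have uv: "0 \<le> u" "0 \<le> v" "v * \<rho> < 1" using \<theta> by (auto simp: u_def v_def)
  \<comment> \<open>The solution of \<open>K = u * C + v * \<rho> * K\<close>, so that the induction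
    reproduces its own constant.\<close>
  define K where "K = u * C / (1 - v * \<rho>)"
  have K: "0 \<le> K" "u * C + v * \<rho> * K = K"
    using uv C by (simp_all add: K_def divide_simps) (simp add: algebra_simps)
  have "(\<integral>\<^sup>+x. ennreal ((\<Sum>k<m. \<bar>d (n + k) x\<bar>) powr s) \<partial>M) \<le> ennreal (K * \<rho> ^ n)" for m n
  proof (induction m arbitrary: n)
    case 0
    then show ?case using s by simp
  next
    case (Suc m)
    let ?S = "\<lambda>x. \<Sum>k<m. \<bar>d (Suc n + k) x\<bar>"
    have "(\<Sum>k<Suc m. \<bar>d (n + k) x\<bar>) powr s \<le> u * \<bar>d n x\<bar> powr s + v * ?S x powr s" for x
    proof -
      have "(\<Sum>k<Suc m. \<bar>d (n + k) x\<bar>) = \<bar>d n x\<bar> + ?S x"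
        by (subst sum.lessThan_Suc_shift) simp
      then show ?thesis
        using powr_add_le_weighted[OF s, of "\<bar>d n x\<bar>" "?S x" \<theta>] \<theta> by (simp add: u_def v_def sum_nonneg)
    qed
    then have "(\<integral>\<^sup>+x. ennreal ((\<Sum>k<Suc m. \<bar>d (n + k) x\<bar>) powr s) \<partial>M) \<le>
        (\<integral>\<^sup>+x. ennreal u * ennreal (\<bar>d n x\<bar> powr s) + ennreal v * ennreal (?S x powr s) \<partial>M)"
      using uv by (intro nn_integral_mono) (simp add: ennreal_leI flip: ennreal_plus ennreal_mult)
    also have "\<dots> = ennreal u * (\<integral>\<^sup>+x. ennreal (\<bar>d n x\<bar> powr s) \<partial>M) + ennreal v * (\<integral>\<^sup>+x. ennreal (?S x powr s) \<partial>M)"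
      by (simp add: nn_integral_add nn_integral_cmult)
    also have "\<dots> \<le> ennreal u * ennreal (C * \<rho> ^ n) + ennreal v * ennreal (K * \<rho> ^ Suc n)"
      by (intro add_mono mult_left_mono d Suc.IH) auto
    also have "\<dots> = ennreal ((u * C + v * \<rho> * K) * \<rho> ^ n)"
      using uv C K(1) \<rho> by (simp add: algebra_simps flip: ennreal_plus ennreal_mult)
    finally show ?case using K by simp
  qed
  then show ?thesis using K that by blast
qed

text \<open>The Riesz-Fischer argument. For finite \<open>s\<close>, monotone convergence makes the
  telescoping series absolutely convergent almost everywhere, and Fatou's lemma carries the bound on
  the partial sums to the limit. For \<open>s = \<infinity>\<close> the differences are dominated
  almost everywhere by a geometric series.\<close>

lemma Lp_geometric_converges:
  assumes s: "1 \<le> s" and f: "\<And>n. f n \<in> Lp_space s M"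
    and \<rho>: "0 \<le> \<rho>" "\<rho> < 1" and C: "0 \<le> C"
    and d: "\<And>n. Lp_modular s M (\<lambda>x. f (Suc n) x - f n x) \<le> ennreal (C * \<rho> ^ n)"
  obtains g where "g \<in> Lp_space s M" "(\<lambda>n. Lp_modular s M (\<lambda>x. f n x - g x)) \<longlonglongrightarrow> 0"
proof -
  let ?d = "\<lambda>n x. f (Suc n) x - f n x"
  have [measurable]: "f n \<in> borel_measurable M" for n
    using f by (simp add: Lp_space_iff)
  \<comment> \<open>\<open>lim\<close> is total, which makes \<open>g\<close> measurable without a
    case distinction; the sequence fails to converge only on a null set, so its value there does not
    matter.\<close>
  define g where "g = (\<lambda>x. lim (\<lambda>n. f n x))"
  have g[measurable]: "g \<in> borel_measurable M" unfolding g_def by measurable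
  have telescope: "f (n + m) x - f n x = (\<Sum>k<m. ?d (n + k) x)" for n m x
    by (induction m) auto
  have lim: "(\<lambda>n. f n x) \<longlonglongrightarrow> g x" if "summable (\<lambda>n. ?d n x)" for x
  proof -
    have "(\<lambda>m. f 0 x + (\<Sum>k<m. ?d k x)) \<longlonglongrightarrow> f 0 x + suminf (\<lambda>n. ?d n x)"
      by (intro tendsto_intros summable_LIMSEQ that)
    moreover have "f 0 x + (\<Sum>k<m. ?d k x) = f m x" for m using telescope[of 0 m x] by simp
    ultimately have "convergent (\<lambda>m. f m x)" by (auto simp: convergent_def)
    then show ?thesis by (simp add: convergent_LIMSEQ_iff g_def)
  qed
  have "\<exists>K\<ge>0. \<forall>n. Lp_modular s M (\<lambda>x. f n x - g x) \<le> ennreal (K * \<rho> ^ n)"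
  proof (cases "s = \<infinity>")
    case True
    have "AE x in M. \<bar>?d n x\<bar> \<le> C * \<rho> ^ n" for n
    proof -
      have "esssup M (\<lambda>x. ennreal \<bar>?d n x\<bar>) \<le> ennreal (C * \<rho> ^ n)"
        using d[of n] True by (simp add: Lp_modular_def)
      with esssup_AE[of "\<lambda>x. ennreal \<bar>?d n x\<bar>" M]
      have "AE x in M. ennreal \<bar>?d n x\<bar> \<le> ennreal (C * \<rho> ^ n)"
        by (auto elim!: eventually_mono intro: order_trans)
      then show ?thesis
        using C \<rho> by (simp add: ennreal_le_iff)
    qed
    then have "AE x in M. \<forall>n. \<bar>?d n x\<bar> \<le> C * \<rho> ^ n" by (simp add: AE_all_countable)
    then have bd: "AE x in M. \<forall>n. \<bar>f n x - g x\<bar> \<le> C / (1 - \<rho>) * \<rho> ^ n"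
    proof eventually_elim
      case (elim x)
      have sm: "summable (\<lambda>k. C * \<rho> ^ k)" using \<rho> by (intro summable_mult summable_geometric) auto
      have "summable (\<lambda>k. ?d k x)" using elim by (intro summable_comparison_test'[OF sm]) auto
      then have lx: "(\<lambda>n. f n x) \<longlonglongrightarrow> g x" by (rule lim)
      have fin: "\<bar>f (n + m) x - f n x\<bar> \<le> C / (1 - \<rho>) * \<rho> ^ n" for n m
      proof -
        have "\<bar>f (n + m) x - f n x\<bar> \<le> (\<Sum>k<m. \<bar>?d (n + k) x\<bar>)"
          unfolding telescope by (rule sum_abs)
        also have "\<dots> \<le> (\<Sum>k<m. C * \<rho> ^ n * \<rho> ^ k)"
        proof (rule sum_mono)
          fix k show "\<bar>?d (n + k) x\<bar> \<le> C * \<rho> ^ n * \<rho> ^ k"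
            using elim[rule_format, of "n + k"] by (simp add: power_add mult.assoc)
        qed
        also have "\<dots> = C * \<rho> ^ n * (\<Sum>k<m. \<rho> ^ k)" by (simp add: sum_distrib_left)
        also have "\<dots> \<le> C * \<rho> ^ n * (1 / (1 - \<rho>))"
        proof (rule mult_left_mono)
          have "(\<Sum>k<m. \<rho> ^ k) \<le> suminf (\<lambda>k. \<rho> ^ k)"
            using \<rho> by (intro sum_le_suminf summable_geometric) auto
          then show "(\<Sum>k<m. \<rho> ^ k) \<le> 1 / (1 - \<rho>)" using \<rho> by (simp add: suminf_geometric)
        qed (use C \<rho> in auto)
        finally show ?thesis by simp
      qed
      show ?case
      proof
        fix n
        have "(\<lambda>m. \<bar>f n x - f (m + n) x\<bar>) \<longlonglongrightarrow> \<bar>f n x - g x\<bar>"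
          by (intro tendsto_intros LIMSEQ_ignore_initial_segment lx)
        then show "\<bar>f n x - g x\<bar> \<le> C / (1 - \<rho>) * \<rho> ^ n"
          by (rule LIMSEQ_le_const2) (use fin[of n] in \<open>auto simp: add.commute abs_minus_commute\<close>)
      qed
    qed
    have "Lp_modular s M (\<lambda>x. f n x - g x) \<le> ennreal (C / (1 - \<rho>) * \<rho> ^ n)" for n
    proof -
      have "AE x in M. ennreal \<bar>f n x - g x\<bar> \<le> ennreal (C / (1 - \<rho>) * \<rho> ^ n)"
        using bd by eventually_elim (auto intro: ennreal_leI)
      then show ?thesis using True by (auto simp: Lp_modular_def intro!: esssup_I)
    qed
    then show ?thesis using C \<rho> by (intro exI[of _ "C / (1 - \<rho>)"]) auto
  next
    case False
    define r where "r = enn2real s"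
    have r: "1 \<le> r" unfolding r_def by (rule one_le_enn2real[OF s False])
    have mod: "Lp_modular s M h = (\<integral>\<^sup>+x. ennreal (\<bar>h x\<bar> powr r) \<partial>M)" for h :: "_ \<Rightarrow> real"
      using False by (simp add: Lp_modular_def r_def)
    obtain K where K: "0 \<le> K"
      "\<And>m n. (\<integral>\<^sup>+x. ennreal ((\<Sum>k<m. \<bar>?d (n + k) x\<bar>) powr r) \<partial>M) \<le> ennreal (K * \<rho> ^ n)"
      by (rule nn_integral_geometric_sum_le[OF r \<rho> C, of ?d M]) (use d in \<open>auto simp: mod\<close>)
    let ?T = "\<lambda>m x. ennreal ((\<Sum>k<m. \<bar>?d k x\<bar>) powr r)"
    have "incseq ?T"
      using r by (auto simp: incseq_def le_fun_def intro!: ennreal_leI powr_mono2 sum_mono2 sum_nonneg)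
    then have "(\<integral>\<^sup>+x. (SUP m. ?T m x) \<partial>M) = (SUP m. \<integral>\<^sup>+x. ?T m x \<partial>M)"
      by (intro nn_integral_monotone_convergence_SUP) auto
    also have "\<dots> \<le> ennreal K"
      using K(2)[of 0] by (auto intro!: SUP_least)
    finally have "(\<integral>\<^sup>+x. (SUP m. ?T m x) \<partial>M) < \<infinity>"
      by (rule order_le_less_trans) simp
    then have "AE x in M. (SUP m. ?T m x) \<noteq> \<infinity>"
      by (intro nn_integral_PInf_AE) auto
    then have ae: "AE x in M. (\<lambda>n. f n x) \<longlonglongrightarrow> g x"
    proof eventually_elim
      case (elim x)
      then obtain B where B: "0 \<le> B" "(SUP m. ?T m x) = ennreal B" by (cases "SUP m. ?T m x") auto
      have bnd: "(\<Sum>k<m. \<bar>?d k x\<bar>) \<le> B powr (1/r)" for m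
      proof -
        have "?T m x \<le> ennreal B" unfolding B(2)[symmetric] by (rule SUP_upper) simp
        then have "(\<Sum>k<m. \<bar>?d k x\<bar>) powr r \<le> B" using B(1) by (simp add: ennreal_le_iff)
        then have "((\<Sum>k<m. \<bar>?d k x\<bar>) powr r) powr (1/r) \<le> B powr (1/r)"
          using r by (intro powr_mono2) auto
        then show ?thesis using r by (simp add: powr_powr sum_nonneg)
      qed
      have "summable (\<lambda>k. \<bar>?d k x\<bar>)"
      proof (rule bounded_imp_summable)
        show "(\<Sum>k\<le>n. \<bar>?d k x\<bar>) \<le> B powr (1/r)" for n
          using bnd[of "Suc n"] by (simp only: lessThan_Suc_atMost)
      qed simp
      then show ?case by (rule lim[OF summable_rabs_cancel])
    qed
    have "Lp_modular s M (\<lambda>x. f n x - g x) \<le> ennreal (K * \<rho> ^ n)" for n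
    proof -
      let ?h = "\<lambda>m x. ennreal (\<bar>f (n + m) x - f n x\<bar> powr r)"
      have "AE x in M. ennreal (\<bar>f n x - g x\<bar> powr r) = liminf (\<lambda>m. ?h m x)"
        using ae
      proof eventually_elim
        case (elim x)
        have "(\<lambda>m. \<bar>f (m + n) x - f n x\<bar> powr r) \<longlonglongrightarrow> \<bar>g x - f n x\<bar> powr r"
          using r by (intro tendsto_powr' tendsto_intros LIMSEQ_ignore_initial_segment elim) auto
        then have "(\<lambda>m. ?h m x) \<longlonglongrightarrow> ennreal (\<bar>g x - f n x\<bar> powr r)"
          by (intro tendsto_ennrealI) (simp add: add.commute)
        then have "liminf (\<lambda>m. ?h m x) = ennreal (\<bar>g x - f n x\<bar> powr r)"
          by (intro lim_imp_Liminf) auto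
        then show ?case by (simp only: abs_minus_commute)
      qed
      then have "Lp_modular s M (\<lambda>x. f n x - g x) = (\<integral>\<^sup>+x. liminf (\<lambda>m. ?h m x) \<partial>M)"
        unfolding mod by (rule nn_integral_cong_AE)
      also have "\<dots> \<le> liminf (\<lambda>m. \<integral>\<^sup>+x. ?h m x \<partial>M)"
        by (intro nn_integral_liminf) auto
      also have "\<dots> \<le> ennreal (K * \<rho> ^ n)"
      proof -
        have "(\<integral>\<^sup>+x. ?h m x \<partial>M) \<le> ennreal (K * \<rho> ^ n)" for m
        proof -
          have "(\<integral>\<^sup>+x. ?h m x \<partial>M) \<le> (\<integral>\<^sup>+x. ennreal ((\<Sum>k<m. \<bar>?d (n + k) x\<bar>) powr r) \<partial>M)"
            unfolding telescope using r by (intro nn_integral_mono ennreal_leI powr_mono2) auto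
          then show ?thesis using K(2)[of n m] by order
        qed
        then show ?thesis by (intro Liminf_le) auto
      qed
      finally show ?thesis .
    qed
    then show ?thesis using K by auto
  qed
  then obtain K where K: "0 \<le> K" "\<And>n. Lp_modular s M (\<lambda>x. f n x - g x) \<le> ennreal (K * \<rho> ^ n)"
    by blast
  \<comment> \<open>Membership of \<open>g\<close> is read off from
    \<open>g = f 0 - (f 0 - g)\<close>.\<close>
  have "Lp_modular s M (\<lambda>x. f 0 x - g x) < \<infinity>"
    by (rule order_le_less_trans[OF K(2)[of 0]]) simp
  then have "(\<lambda>x. f 0 x - g x) \<in> Lp_space s M" by (simp add: Lp_space_iff)
  from Lp_space_diff[OF s f[of 0] this]
  have "g \<in> Lp_space s M" by simp
  moreover have "(\<lambda>n. Lp_modular s M (\<lambda>x. f n x - g x)) \<longlonglongrightarrow> 0"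
  proof (rule tendsto_sandwich[of "\<lambda>_. 0" _ _ "\<lambda>n. ennreal (K * \<rho> ^ n)"])
    have "(\<lambda>n. ennreal (K * \<rho> ^ n)) \<longlonglongrightarrow> ennreal (K * 0)"
      using \<rho> by (intro tendsto_ennrealI tendsto_mult tendsto_const LIMSEQ_realpow_zero) auto
    then show "(\<lambda>n. ennreal (K * \<rho> ^ n)) \<longlonglongrightarrow> 0" by simp
  qed (use K in auto)
  ultimately show ?thesis by (rule that)
qed

section \<open>Integral operators on Lebesgue spaces\<close>

text \<open>For a factor of modulus at most 1 the power \<open>\<bar>c\<bar> powr s\<close> is at
  most \<open>\<bar>c\<bar>\<close>, so one constant serves all exponents.\<close>

lemma Lp_modular_cmult_le:
  assumes "1 \<le> s" "f \<in> borel_measurable M" "\<bar>c\<bar> \<le> 1"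
  shows "Lp_modular s M (\<lambda>x. c * f x) \<le> ennreal \<bar>c\<bar> * Lp_modular s M f"
proof -
  have "\<bar>c\<bar> powr enn2real s \<le> \<bar>c\<bar>" if "s \<noteq> \<infinity>"
    using powr_mono'[OF one_le_enn2real[OF assms(1) that], of "\<bar>c\<bar>"] assms(3) by simp
  then have "(if s = \<infinity> then \<bar>c\<bar> else \<bar>c\<bar> powr enn2real s) \<le> \<bar>c\<bar>" by simp
  then have "ennreal (if s = \<infinity> then \<bar>c\<bar> else \<bar>c\<bar> powr enn2real s) * Lp_modular s M f \<le>
      ennreal \<bar>c\<bar> * Lp_modular s M f"
    by (intro mult_right_mono ennreal_leI) auto
  with Lp_modular_cmult[OF assms(1,2), of c] show ?thesis by order
qed

text \<open>Banach's fixed point theorem with the modular in place of a norm: the Picard iteration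
  from 0 has geometrically small differences, hence a limit.\<close>

lemma Lp_contraction_fixed_point:
  assumes s: "1 \<le> s" and \<eta>: "0 \<le> \<eta>" "\<eta> < 1"
    and T: "\<And>f. f \<in> Lp_space s M \<Longrightarrow> T f \<in> Lp_space s M"
    and contr: "\<And>f g. f \<in> Lp_space s M \<Longrightarrow> g \<in> Lp_space s M \<Longrightarrow>
      Lp_modular s M (\<lambda>x. T f x - T g x) \<le> ennreal \<eta> * Lp_modular s M (\<lambda>x. f x - g x)"
    and h: "h \<in> Lp_space s M"
  obtains g where "g \<in> Lp_space s M" "AE x in M. g x - T g x = h x"
proof -
  let ?c = "Lp_triangle_const s"
  define f where "f n = ((\<lambda>f x. T f x + h x) ^^ n) (\<lambda>_. 0)" for n
  have f_Suc: "f (Suc n) = (\<lambda>x. T (f n) x + h x)" for n by (simp add: f_def)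
  have f: "f n \<in> Lp_space s M" for n
    by (induction n) (auto simp: f_Suc intro!: Lp_space_add s T h, simp add: f_def Lp_space_zero s)
  have "(\<lambda>x. f 1 x - f 0 x) \<in> Lp_space s M" by (rule Lp_space_diff[OF s f f])
  then obtain C where C: "0 \<le> C" "Lp_modular s M (\<lambda>x. f 1 x - f 0 x) = ennreal C"
    by (cases "Lp_modular s M (\<lambda>x. f 1 x - f 0 x)") (auto simp: Lp_space_iff)
  have "Lp_modular s M (\<lambda>x. f (Suc n) x - f n x) \<le> ennreal (C * \<eta> ^ n)" for n
  proof (induction n)
    case (Suc n)
    have "Lp_modular s M (\<lambda>x. f (Suc (Suc n)) x - f (Suc n) x) \<le>
        ennreal \<eta> * Lp_modular s M (\<lambda>x. f (Suc n) x - f n x)"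
      using contr[OF f[of "Suc n"] f[of n]] by (simp add: f_Suc[of "Suc n"] f_Suc[of n] algebra_simps)
    also have "\<dots> \<le> ennreal \<eta> * ennreal (C * \<eta> ^ n)" by (intro mult_left_mono Suc) auto
    also have "\<dots> = ennreal (C * \<eta> ^ Suc n)" using \<eta> C(1) by (simp add: algebra_simps flip: ennreal_mult)
    finally show ?case .
  qed (use C in simp)
  from Lp_geometric_converges[OF s f \<eta> C(1) this] obtain g where
    g: "g \<in> Lp_space s M" and lim: "(\<lambda>n. Lp_modular s M (\<lambda>x. f n x - g x)) \<longlonglongrightarrow> 0"
    by blast
  let ?e = "\<lambda>n. Lp_modular s M (\<lambda>x. f n x - g x)"
  have e: "(\<lambda>x. g x - T g x - h x) \<in> Lp_space s M" by (intro Lp_space_diff s g T h)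
  have le: "Lp_modular s M (\<lambda>x. g x - T g x - h x) \<le> ?c * (?e (Suc n) + ennreal \<eta> * ?e n)" for n
  proof -
    \<comment> \<open>Since \<open>h = f (Suc n) - T (f n)\<close>, the residual of \<open>g\<close>
      is a sum of two errors that both tend to 0.\<close>
    have "Lp_modular s M (\<lambda>x. (- (f (Suc n) x - g x)) + (T (f n) x - T g x)) \<le>
        ?c * (Lp_modular s M (\<lambda>x. - (f (Suc n) x - g x)) + Lp_modular s M (\<lambda>x. T (f n) x - T g x))"
      by (intro Lp_modular_add s borel_measurable_uminus Lp_space_measurable[of _ s] Lp_space_diff T f g)
    also have "\<dots> \<le> ?c * (?e (Suc n) + ennreal \<eta> * ?e n)"
      unfolding Lp_modular_uminus
      by (intro mult_left_mono add_mono contr f g order_refl) auto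
    also have "(\<lambda>x. (- (f (Suc n) x - g x)) + (T (f n) x - T g x)) = (\<lambda>x. g x - T g x - h x)"
      by (simp add: f_Suc algebra_simps)
    finally show ?thesis .
  qed
  have "(\<lambda>n. ?c * (?e (Suc n) + ennreal \<eta> * ?e n)) \<longlonglongrightarrow> ?c * (0 + ennreal \<eta> * 0)"
    by (intro tendsto_add ennreal_tendsto_cmult LIMSEQ_Suc lim) auto
  then have "Lp_modular s M (\<lambda>x. g x - T g x - h x) \<le> ?c * (0 + ennreal \<eta> * 0)"
    by (rule LIMSEQ_le_const) (use le in blast)
  then have "Lp_modular s M (\<lambda>x. g x - T g x - h x) = 0" by simp
  then have "AE x in M. g x - T g x - h x = 0"
    by (intro Lp_modular_eq_0D[OF s]) (use e in \<open>auto simp: Lp_space_iff\<close>)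
  then have "AE x in M. g x - T g x = h x" by eventually_elim simp
  with g show ?thesis by (rule that)
qed

text \<open>Integrate the tangent line inequality of \<open>powr\<close> at \<open>x\<close>.\<close>

lemma powr_le_nn_integral_powr:
  fixes f :: "'a \<Rightarrow> real" and g :: "'b \<Rightarrow> real" and x s :: real
  assumes s: "1 \<le> s" and x: "0 \<le> x"
    and [measurable]: "k \<in> borel_measurable M" "l \<in> borel_measurable N"
      "f \<in> borel_measurable M" "g \<in> borel_measurable N"
    and fg: "\<And>r. 0 \<le> f r" "\<And>r. 0 \<le> g r"
    and mass: "(\<integral>\<^sup>+r. k r \<partial>M) + (\<integral>\<^sup>+r. l r \<partial>N) \<le> (1::ennreal)"
    and le: "ennreal x \<le> (\<integral>\<^sup>+r. k r * ennreal (f r) \<partial>M) + (\<integral>\<^sup>+r. l r * ennreal (g r) \<partial>N)"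
  shows "ennreal (x powr s) \<le> (\<integral>\<^sup>+r. k r * ennreal (f r powr s) \<partial>M) + (\<integral>\<^sup>+r. l r * ennreal (g r powr s) \<partial>N)"
    (is "_ \<le> ?J")
proof -
  let ?c = "s * x powr (s - 1)" and ?e = "(s - 1) * x powr s"
  have ce: "0 \<le> ?c" "0 \<le> ?e" using s by auto
  have pt: "ennreal ?c * (w * ennreal z) \<le> w * ennreal (z powr s) + ennreal ?e * w" if "0 \<le> z" for z w
  proof -
    have "ennreal (?c * z) \<le> ennreal (z powr s + ?e)"
      using powr_tangent_le[OF s that x] by (rule ennreal_leI)
    then have "w * ennreal (?c * z) \<le> w * ennreal (z powr s + ?e)" by (rule mult_left_mono) simp
    moreover have "w * ennreal (?c * z) = ennreal ?c * (w * ennreal z)"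
      by (subst ennreal_mult) (use ce that in \<open>auto simp: mult_ac\<close>)
    moreover have "w * ennreal (z powr s + ?e) = w * ennreal (z powr s) + ennreal ?e * w"
      by (subst ennreal_plus) (use ce in \<open>auto simp: distrib_left mult.commute\<close>)
    ultimately show ?thesis by simp
  qed
  have "ennreal (x powr s) + ennreal ?e = ennreal ?c * ennreal x"
  proof -
    have "x powr (s - 1) * x = x powr s" using x by (cases "x = 0") (auto simp: powr_diff)
    then have "?c * x = x powr s + ?e" by (simp add: algebra_simps)
    then show ?thesis using ce x by (metis ennreal_mult ennreal_plus powr_ge_zero)
  qed
  also have "\<dots> \<le> ennreal ?c * ((\<integral>\<^sup>+r. k r * ennreal (f r) \<partial>M) + (\<integral>\<^sup>+r. l r * ennreal (g r) \<partial>N))"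
    by (intro mult_left_mono le) auto
  also have "\<dots> = (\<integral>\<^sup>+r. ennreal ?c * (k r * ennreal (f r)) \<partial>M) + (\<integral>\<^sup>+r. ennreal ?c * (l r * ennreal (g r)) \<partial>N)"
    by (simp add: nn_integral_cmult distrib_left)
  also have "\<dots> \<le> (\<integral>\<^sup>+r. k r * ennreal (f r powr s) + ennreal ?e * k r \<partial>M) +
      (\<integral>\<^sup>+r. l r * ennreal (g r powr s) + ennreal ?e * l r \<partial>N)"
    by (intro add_mono nn_integral_mono pt fg)
  also have "\<dots> = ?J + ennreal ?e * ((\<integral>\<^sup>+r. k r \<partial>M) + (\<integral>\<^sup>+r. l r \<partial>N))"
  proof -
    have "(\<integral>\<^sup>+r. k r * ennreal (f r powr s) + ennreal ?e * k r \<partial>M) =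
        (\<integral>\<^sup>+r. k r * ennreal (f r powr s) \<partial>M) + ennreal ?e * (\<integral>\<^sup>+r. k r \<partial>M)"
      by (subst nn_integral_add) (simp_all add: nn_integral_cmult)
    moreover have "(\<integral>\<^sup>+r. l r * ennreal (g r powr s) + ennreal ?e * l r \<partial>N) =
        (\<integral>\<^sup>+r. l r * ennreal (g r powr s) \<partial>N) + ennreal ?e * (\<integral>\<^sup>+r. l r \<partial>N)"
      by (subst nn_integral_add) (simp_all add: nn_integral_cmult)
    ultimately show ?thesis by (simp only: distrib_left add_ac)
  qed
  also have "\<dots> \<le> ?J + ennreal ?e * 1" by (intro add_mono mult_left_mono mass) auto
  finally show ?thesis by (simp add: add.commute[of _ "ennreal ?e"])
qed

section \<open>Operators with substochastic kernels\<close>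

text \<open>The hypotheses of the Schur test: rows control the essential supremum, columns the
  integral. The kernel is measurable on the uncompleted product, where Tonelli's theorem applies,
  while \<open>opr\<close> integrates over the completion, since the unknowns are measurable only
  there.\<close>

locale kernel = M: sigma_finite_measure M + N: sigma_finite_measure N
  for M :: "'a measure" and N :: "'b measure" +
  fixes k :: "'a \<Rightarrow> 'b \<Rightarrow> real" and c :: real
  assumes k_meas [measurable]: "(\<lambda>(p, r). k p r) \<in> borel_measurable (M \<Otimes>\<^sub>M N)"
    and k_nonneg: "\<And>p r. 0 \<le> k p r"
    and k_row: "\<And>p. p \<in> space M \<Longrightarrow> (\<integral>\<^sup>+r. k p r \<partial>N) \<le> 1"
    and k_col: "\<And>r. r \<in> space N \<Longrightarrow> (\<integral>\<^sup>+p. k p r \<partial>M) \<le> ennreal c"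
begin

definition opr :: "('b \<Rightarrow> real) \<Rightarrow> 'a \<Rightarrow> real" where
  "opr q p = (LINT r|completion N. k p r * q r)"

abbreviation nn_opr :: "('b \<Rightarrow> ennreal) \<Rightarrow> 'a \<Rightarrow> ennreal" where
  "nn_opr f p \<equiv> \<integral>\<^sup>+r. ennreal (k p r) * f r \<partial>N"

abbreviation row :: "'a \<Rightarrow> ennreal" where "row p \<equiv> \<integral>\<^sup>+r. ennreal (k p r) \<partial>N"

abbreviation col :: "'b \<Rightarrow> ennreal" where "col r \<equiv> \<integral>\<^sup>+p. ennreal (k p r) \<partial>M"

lemma row_measurable: "p \<in> space M \<Longrightarrow> k p \<in> borel_measurable N"
  by measurable

text \<open>Tonelli's theorem after replacing \<open>f\<close> by an \<open>N\<close>-measurable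
  version; this alters \<open>f\<close> on a null set only and leaves every inner integral
  unchanged.\<close>

lemma nn_integral_kernel:
  fixes f :: "'b \<Rightarrow> ennreal"
  assumes f: "f \<in> borel_measurable (completion N)"
  shows borel_measurable_nn_integral_kernel: "(\<lambda>p. nn_opr f p) \<in> borel_measurable M"
    and nn_integral_kernel_swap:
      "(\<integral>\<^sup>+p. nn_opr f p \<partial>M) = (\<integral>\<^sup>+r. col r * f r \<partial>N)"
proof -
  obtain f0 where [measurable]: "f0 \<in> borel_measurable N" and ae: "AE r in N. f r = f0 r"
    using completion_ex_borel_measurable[OF f] by blast
  have eq: "nn_opr f p = nn_opr f0 p" for p
    using ae by (intro nn_integral_cong_AE) (auto elim: eventually_mono)
  have m: "(\<lambda>(p, r). ennreal (k p r) * f0 r) \<in> borel_measurable (M \<Otimes>\<^sub>M N)" by measurable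
  show "(\<lambda>p. nn_opr f p) \<in> borel_measurable M"
    unfolding eq by measurable
  interpret pair_sigma_finite M N ..
  have "(\<integral>\<^sup>+p. nn_opr f0 p \<partial>M) = (\<integral>\<^sup>+r. (\<integral>\<^sup>+p. k p r * f0 r \<partial>M) \<partial>N)"
    using Fubini[OF m] by simp
  also have "\<dots> = (\<integral>\<^sup>+r. col r * f0 r \<partial>N)"
    by (intro nn_integral_cong nn_integral_multc) measurable
  also have "\<dots> = (\<integral>\<^sup>+r. col r * f r \<partial>N)"
    using ae by (intro nn_integral_cong_AE) (auto elim: eventually_mono)
  finally show "(\<integral>\<^sup>+p. nn_opr f p \<partial>M) = (\<integral>\<^sup>+r. col r * f r \<partial>N)"
    unfolding eq .
qed

lemma opr_measurable:
  assumes q: "q \<in> borel_measurable (completion N)"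
  shows "opr q \<in> borel_measurable (completion M)"
proof -
  obtain q0 where [measurable]: "q0 \<in> borel_measurable N" and ae: "AE r in N. q r = q0 r"
    using completion_ex_borel_measurable_real[OF q] by blast
  have "opr q p = (LINT r|N. k p r * q0 r)" if "p \<in> space M" for p
  proof -
    note [measurable] = row_measurable[OF that] q
    have [measurable]: "k p \<in> borel_measurable (completion N)" "q0 \<in> borel_measurable (completion N)"
      by (intro measurable_completion; measurable)+
    have "opr q p = (LINT r|completion N. k p r * q0 r)"
      unfolding opr_def using AE_completion[OF ae]
      by (intro integral_cong_AE) (auto elim: eventually_mono)
    also have "\<dots> = (LINT r|N. k p r * q0 r)" by (intro integral_completion) measurable
    finally show ?thesis .
  qed
  moreover have "(\<lambda>p. LINT r|N. k p r * q0 r) \<in> borel_measurable M"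
    by (rule N.borel_measurable_lebesgue_integral) measurable
  ultimately have "opr q \<in> borel_measurable M" by (subst measurable_cong) auto
  then show ?thesis by (rule measurable_completion)
qed

text \<open>Holds for every \<open>q\<close>: where the integrand is not integrable, the left side
  is 0 by the default value of the integral.\<close>

lemma opr_bound: "ennreal \<bar>opr q p\<bar> \<le> (\<integral>\<^sup>+r. k p r * ennreal \<bar>q r\<bar> \<partial>N)"
proof (cases "integrable (completion N) (\<lambda>r. k p r * q r)")
  case True
  then have "ennreal \<bar>opr q p\<bar> \<le> (\<integral>\<^sup>+r. ennreal (norm (k p r * q r)) \<partial>completion N)"
    unfolding opr_def using integral_norm_bound_ennreal[OF True] by simp
  then show ?thesis by (simp add: nn_integral_completion abs_mult ennreal_mult k_nonneg)
next
  case False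
  then show ?thesis by (simp add: opr_def not_integrable_integral_eq)
qed

text \<open>The Schur test. Jensen's inequality consumes the row mass, after which Tonelli's theorem
  turns rows into columns; for \<open>s = \<infinity>\<close> the row mass suffices. The factor
  \<open>max 1 c\<close> covers both cases.\<close>

lemma opr_Lp_modular:
  assumes s: "1 \<le> s" and q: "q \<in> borel_measurable (completion N)"
  shows "Lp_modular s (completion M) (opr q) \<le> ennreal (max 1 c) * Lp_modular s (completion N) q"
proof (cases "s = \<infinity>")
  case True
  let ?A = "esssup (completion N) (\<lambda>r. ennreal \<bar>q r\<bar>)"
  have ae: "AE r in N. ennreal \<bar>q r\<bar> \<le> ?A"
    using esssup_AE[of "\<lambda>r. ennreal \<bar>q r\<bar>" "completion N"] by (simp add: AE_completion_iff)
  have "ennreal \<bar>opr q p\<bar> \<le> ennreal (max 1 c) * ?A" if p: "p \<in> space M" for p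
  proof -
    note opr_bound[of q p]
    also have "(\<integral>\<^sup>+r. k p r * ennreal \<bar>q r\<bar> \<partial>N) \<le> (\<integral>\<^sup>+r. ennreal (k p r) * ?A \<partial>N)"
      using ae by (intro nn_integral_mono_AE) (auto elim!: eventually_mono intro: mult_left_mono)
    also have "\<dots> = row p * ?A"
      using row_measurable[OF p] by (intro nn_integral_multc) auto
    also have "\<dots> \<le> 1 * ?A" by (intro mult_right_mono k_row p) auto
    also have "\<dots> \<le> ennreal (max 1 c) * ?A" by (intro mult_right_mono) (auto simp flip: ennreal_1)
    finally show ?thesis .
  qed
  then show ?thesis
    using True opr_measurable[OF q] by (auto simp: Lp_modular_def intro!: esssup_I AE_I2)
next
  case False
  define r where "r = enn2real s"
  have r: "1 \<le> r" unfolding r_def by (rule one_le_enn2real[OF s False])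
  have mod: "Lp_modular s M h = (\<integral>\<^sup>+x. ennreal (\<bar>h x\<bar> powr r) \<partial>M)" for h :: "_ \<Rightarrow> real" and M
    using False by (simp add: Lp_modular_def r_def)
  note [measurable] = q
  have "ennreal (\<bar>opr q p\<bar> powr r) \<le> (\<integral>\<^sup>+t. k p t * ennreal (\<bar>q t\<bar> powr r) \<partial>N)" if p: "p \<in> space M" for p
  proof -
    have [measurable]: "k p \<in> borel_measurable (completion N)"
      by (intro measurable_completion row_measurable p)
    \<comment> \<open>The Jensen inequality is stated for a pair of kernels; here the second one is
      0.\<close>
    have "ennreal (\<bar>opr q p\<bar> powr r) \<le> (\<integral>\<^sup>+t. ennreal (k p t) * ennreal (\<bar>q t\<bar> powr r) \<partial>completion N) +
        (\<integral>\<^sup>+t. 0 * ennreal (\<bar>q t\<bar> powr r) \<partial>completion N)"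
      using k_row[OF p] opr_bound[of q p]
      by (intro powr_le_nn_integral_powr r) (auto simp: nn_integral_completion)
    then show ?thesis by (simp add: nn_integral_completion)
  qed
  then have "(\<integral>\<^sup>+p. ennreal (\<bar>opr q p\<bar> powr r) \<partial>M) \<le> (\<integral>\<^sup>+p. (\<integral>\<^sup>+t. k p t * ennreal (\<bar>q t\<bar> powr r) \<partial>N) \<partial>M)"
    by (rule nn_integral_mono)
  also have "\<dots> = (\<integral>\<^sup>+t. col t * ennreal (\<bar>q t\<bar> powr r) \<partial>N)"
    by (intro nn_integral_kernel_swap) measurable
  also have "\<dots> \<le> (\<integral>\<^sup>+t. ennreal (max 1 c) * ennreal (\<bar>q t\<bar> powr r) \<partial>completion N)"
    unfolding nn_integral_completion
    by (intro nn_integral_mono mult_right_mono order_trans[OF k_col] ennreal_leI) auto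
  also have "\<dots> = ennreal (max 1 c) * (\<integral>\<^sup>+t. ennreal (\<bar>q t\<bar> powr r) \<partial>completion N)"
    by (intro nn_integral_cmult) measurable
  finally show ?thesis by (simp add: mod nn_integral_completion)
qed

lemma opr_Lp:
  assumes s: "1 \<le> s" and q: "q \<in> Lp_space s (completion N)"
  shows "opr q \<in> Lp_space s (completion M)"
proof -
  have "Lp_modular s (completion M) (opr q) \<le> ennreal (max 1 c) * Lp_modular s (completion N) q"
    using q by (intro opr_Lp_modular s) (simp add: Lp_space_iff)
  also have "\<dots> < \<infinity>" using q by (simp add: Lp_space_iff ennreal_mult_less_top)
  finally show ?thesis using q opr_measurable by (simp add: Lp_space_iff)
qed

text \<open>Makes \<open>opr\<close> additive: differences may be formed only where both integrals
  exist. For finite \<open>s\<close> the estimate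
  \<open>\<bar>q t\<bar> \<le> 1 + \<bar>q t\<bar> powr r\<close> reduces the claim to the row mass
  and to the almost everywhere finiteness supplied by Tonelli's theorem.\<close>

lemma AE_integrable:
  assumes s: "1 \<le> s" and q: "q \<in> Lp_space s (completion N)"
  shows "AE p in completion M. integrable (completion N) (\<lambda>r. k p r * q r)"
proof -
  have [measurable]: "q \<in> borel_measurable (completion N)" using q by (simp add: Lp_space_iff)
  have "AE p in M. (\<integral>\<^sup>+r. k p r * ennreal \<bar>q r\<bar> \<partial>N) < \<infinity>"
  proof (cases "s = \<infinity>")
    case True
    obtain A where A: "0 \<le> A" "esssup (completion N) (\<lambda>r. ennreal \<bar>q r\<bar>) = ennreal A"
      using q True by (cases "esssup (completion N) (\<lambda>r. ennreal \<bar>q r\<bar>)") (auto simp: Lp_space_iff Lp_modular_def)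
    then have ae: "AE r in N. ennreal \<bar>q r\<bar> \<le> ennreal A"
      using esssup_AE[of "\<lambda>r. ennreal \<bar>q r\<bar>" "completion N"] by (simp add: AE_completion_iff)
    have "(\<integral>\<^sup>+r. k p r * ennreal \<bar>q r\<bar> \<partial>N) < \<infinity>" if p: "p \<in> space M" for p
    proof -
      have "(\<integral>\<^sup>+r. k p r * ennreal \<bar>q r\<bar> \<partial>N) \<le> (\<integral>\<^sup>+r. ennreal (k p r) * ennreal A \<partial>N)"
        using ae by (intro nn_integral_mono_AE) (auto elim!: eventually_mono intro: mult_left_mono)
      also have "\<dots> = row p * ennreal A"
        using row_measurable[OF p] by (intro nn_integral_multc) auto
      also have "\<dots> \<le> 1 * ennreal A" by (intro mult_right_mono k_row p) auto
      also have "\<dots> < \<infinity>" by simp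
      finally show ?thesis .
    qed
    then show ?thesis by (intro AE_I2)
  next
    case False
    define r where "r = enn2real s"
    have r: "1 \<le> r" unfolding r_def by (rule one_le_enn2real[OF s False])
    have fin: "(\<integral>\<^sup>+t. ennreal (\<bar>q t\<bar> powr r) \<partial>N) < \<infinity>"
      using q False by (simp add: Lp_space_iff Lp_modular_def r_def nn_integral_completion)
    have "(\<integral>\<^sup>+p. (\<integral>\<^sup>+t. k p t * ennreal (\<bar>q t\<bar> powr r) \<partial>N) \<partial>M) =
        (\<integral>\<^sup>+t. col t * ennreal (\<bar>q t\<bar> powr r) \<partial>N)"
      by (intro nn_integral_kernel_swap) measurable
    also have "\<dots> \<le> (\<integral>\<^sup>+t. ennreal c * ennreal (\<bar>q t\<bar> powr r) \<partial>completion N)"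
      unfolding nn_integral_completion by (intro nn_integral_mono mult_right_mono k_col) auto
    also have "\<dots> = ennreal c * (\<integral>\<^sup>+t. ennreal (\<bar>q t\<bar> powr r) \<partial>completion N)"
      by (intro nn_integral_cmult) measurable
    also have "\<dots> < \<infinity>" using fin by (simp add: nn_integral_completion ennreal_mult_less_top)
    finally have "AE p in M. (\<integral>\<^sup>+t. k p t * ennreal (\<bar>q t\<bar> powr r) \<partial>N) \<noteq> \<infinity>"
      by (intro nn_integral_PInf_AE borel_measurable_nn_integral_kernel) (simp_all, measurable)
    with AE_space show ?thesis
    proof eventually_elim
      case (elim p)
      have [measurable]: "k p \<in> borel_measurable (completion N)"
        by (intro measurable_completion row_measurable elim)
      have le: "\<bar>q t\<bar> \<le> 1 + \<bar>q t\<bar> powr r" for t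
      proof (cases "1 \<le> \<bar>q t\<bar>")
        case True
        then show ?thesis using powr_mono[OF r True] by simp
      next
        case False
        then show ?thesis using powr_ge_zero[of "\<bar>q t\<bar>" r] by linarith
      qed
      have "(\<integral>\<^sup>+t. k p t * ennreal \<bar>q t\<bar> \<partial>completion N) \<le>
          (\<integral>\<^sup>+t. k p t * ennreal (1 + \<bar>q t\<bar> powr r) \<partial>completion N)"
        by (intro nn_integral_mono mult_left_mono ennreal_leI le) auto
      also have "\<dots> = (\<integral>\<^sup>+t. ennreal (k p t) + k p t * ennreal (\<bar>q t\<bar> powr r) \<partial>completion N)"
        by (simp add: ennreal_plus distrib_left)
      also have "\<dots> = (\<integral>\<^sup>+t. ennreal (k p t) \<partial>completion N) +
          (\<integral>\<^sup>+t. k p t * ennreal (\<bar>q t\<bar> powr r) \<partial>completion N)"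
        by (intro nn_integral_add) measurable
      also have "\<dots> \<le> 1 + (\<integral>\<^sup>+t. k p t * ennreal (\<bar>q t\<bar> powr r) \<partial>N)"
        unfolding nn_integral_completion by (intro add_mono k_row elim order_refl)
      also have "\<dots> < \<infinity>" using elim by (simp add: less_top)
      finally show ?case by (simp add: nn_integral_completion)
    qed
  qed
  then have "AE p in completion M. (\<integral>\<^sup>+r. k p r * ennreal \<bar>q r\<bar> \<partial>N) < \<infinity>" by (rule AE_completion)
  with AE_space show ?thesis
  proof eventually_elim
    case (elim p)
    have [measurable]: "k p \<in> borel_measurable (completion N)"
      using elim by (intro measurable_completion row_measurable) simp
    show ?case using elim
      by (auto simp: integrable_iff_bounded nn_integral_completion abs_mult ennreal_mult k_nonneg)
  qed
qed

lemma opr_diff: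
  assumes s: "1 \<le> s" and q: "q \<in> Lp_space s (completion N)" "q' \<in> Lp_space s (completion N)"
  shows "AE p in completion M. opr q p - opr q' p = opr (\<lambda>r. q r - q' r) p"
  using AE_integrable[OF s q(1)] AE_integrable[OF s q(2)]
  by eventually_elim (simp add: opr_def right_diff_distrib)

end

section \<open>Coupled kernels\<close>

text \<open>\<open>M\<close> is the boundary and \<open>N\<close> the interior; \<open>a\<close>, \<open>b\<close>, \<open>d\<close> describe transport from boundary to
  boundary, from interior to boundary and from interior to interior, and \<open>b\<close> transposed and divided
  by \<open>\<kappa>\<close> describes transport from boundary to interior.  The two mass conditions say that both
  rows of the resulting block kernel are substochastic; by the symmetry of \<open>a\<close> and \<open>d\<close> they also
  bound the columns.\<close>

locale coupled_kernels = M: sigma_finite_measure M + N: sigma_finite_measure N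
  for M :: "'a measure" and N :: "'b measure" +
  fixes a :: "'a \<Rightarrow> 'a \<Rightarrow> real" and b :: "'a \<Rightarrow> 'b \<Rightarrow> real" and d :: "'b \<Rightarrow> 'b \<Rightarrow> real"
    and \<kappa> \<delta> :: real
  assumes a_meas: "(\<lambda>(p, r). a p r) \<in> borel_measurable (M \<Otimes>\<^sub>M M)"
    and b_meas: "(\<lambda>(p, r). b p r) \<in> borel_measurable (M \<Otimes>\<^sub>M N)"
    and d_meas: "(\<lambda>(p, r). d p r) \<in> borel_measurable (N \<Otimes>\<^sub>M N)"
    and nonneg: "\<And>p r. 0 \<le> a p r" "\<And>p r. 0 \<le> b p r" "\<And>p r. 0 \<le> d p r"
    and sym: "\<And>p r. a p r = a r p" "\<And>p r. d p r = d r p"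
    and mass_M: "\<And>p. p \<in> space M \<Longrightarrow> (\<integral>\<^sup>+r. a p r \<partial>M) + (\<integral>\<^sup>+r. b p r \<partial>N) \<le> 1"
    and mass_N: "\<And>r. r \<in> space N \<Longrightarrow> (\<integral>\<^sup>+p. b p r \<partial>M) + ennreal \<kappa> * (\<integral>\<^sup>+p. d r p \<partial>N) \<le> ennreal \<kappa>"
    and mass_d: "\<And>r. r \<in> space N \<Longrightarrow> (\<integral>\<^sup>+p. d r p \<partial>N) \<le> ennreal (1 - \<delta>)"
    and \<kappa>: "0 < \<kappa>" and \<delta>: "0 < \<delta>" "\<delta> \<le> 1"
begin

abbreviation bt :: "'b \<Rightarrow> 'a \<Rightarrow> real" where "bt r p \<equiv> b p r / \<kappa>"

lemma row_b_le: "p \<in> space M \<Longrightarrow> (\<integral>\<^sup>+r. b p r \<partial>N) \<le> 1"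
  by (rule order_trans[OF _ mass_M[of p]]) auto

lemma row_a_le: "p \<in> space M \<Longrightarrow> (\<integral>\<^sup>+r. a p r \<partial>M) \<le> 1"
  by (rule order_trans[OF _ mass_M[of p]]) auto

lemma col_b_le: "r \<in> space N \<Longrightarrow> (\<integral>\<^sup>+p. b p r \<partial>M) \<le> ennreal \<kappa>"
  by (rule order_trans[OF _ mass_N[of r]]) auto

lemma row_d_le: "r \<in> space N \<Longrightarrow> (\<integral>\<^sup>+p. d r p \<partial>N) \<le> 1"
  using order_trans[OF mass_d, of r "ennreal 1"] \<delta> by (simp add: ennreal_leI)

lemma bt_meas: "(\<lambda>(r, p). bt r p) \<in> borel_measurable (N \<Otimes>\<^sub>M M)"
  using measurable_pair_swap[OF b_meas] by simp

lemma b_row_measurable: "p \<in> space M \<Longrightarrow> b p \<in> borel_measurable N"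
  using measurable_Pair2[OF b_meas, of p] by simp

lemma b_col_measurable: "r \<in> space N \<Longrightarrow> (\<lambda>p. b p r) \<in> borel_measurable M"
  using measurable_Pair1[OF b_meas, of r] by simp

lemma nn_integral_bt:
  assumes "r \<in> space N"
  shows "(\<integral>\<^sup>+p. bt r p \<partial>M) = ennreal (1 / \<kappa>) * (\<integral>\<^sup>+p. b p r \<partial>M)"
proof -
  have "(\<integral>\<^sup>+p. bt r p \<partial>M) = (\<integral>\<^sup>+p. ennreal (1 / \<kappa>) * ennreal (b p r) \<partial>M)"
    using \<kappa> nonneg by (intro nn_integral_cong) (simp add: field_simps flip: ennreal_mult)
  also have "\<dots> = ennreal (1 / \<kappa>) * (\<integral>\<^sup>+p. b p r \<partial>M)"
    using b_col_measurable[OF assms] by (intro nn_integral_cmult) measurable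
  finally show ?thesis .
qed

lemma mass_bt:
  assumes "r \<in> space N"
  shows "(\<integral>\<^sup>+p. bt r p \<partial>M) + (\<integral>\<^sup>+p. d r p \<partial>N) \<le> 1"
proof -
  have "ennreal (1 / \<kappa>) * ((\<integral>\<^sup>+p. b p r \<partial>M) + ennreal \<kappa> * (\<integral>\<^sup>+p. d r p \<partial>N)) \<le> ennreal (1 / \<kappa>) * ennreal \<kappa>"
    by (intro mult_left_mono mass_N assms) auto
  moreover have "ennreal (1 / \<kappa>) * ennreal \<kappa> = 1" using \<kappa> by (simp flip: ennreal_mult)
  ultimately show ?thesis
    using assms by (simp add: nn_integral_bt distrib_left mult.assoc[symmetric])
qed

sublocale A: kernel M M a 1
  by unfold_locales (use a_meas nonneg row_a_le sym in auto)

sublocale B: kernel M N b \<kappa>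
  by unfold_locales (use b_meas nonneg row_b_le col_b_le in auto)

sublocale Bt: kernel N M bt "1 / \<kappa>"
proof
  show "(\<integral>\<^sup>+p. bt r p \<partial>M) \<le> 1" if "r \<in> space N" for r
    by (rule order_trans[OF _ mass_bt[OF that]]) auto
  show "(\<integral>\<^sup>+r. bt r p \<partial>N) \<le> ennreal (1 / \<kappa>)" if "p \<in> space M" for p
  proof -
    have "(\<integral>\<^sup>+r. bt r p \<partial>N) = (\<integral>\<^sup>+r. ennreal (1 / \<kappa>) * ennreal (b p r) \<partial>N)"
      using \<kappa> nonneg by (intro nn_integral_cong) (simp add: field_simps flip: ennreal_mult)
    also have "\<dots> = ennreal (1 / \<kappa>) * (\<integral>\<^sup>+r. b p r \<partial>N)"
      using b_row_measurable[OF that] by (intro nn_integral_cmult) auto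
    also have "\<dots> \<le> ennreal (1 / \<kappa>) * 1" by (intro mult_left_mono row_b_le that) auto
    finally show ?thesis by simp
  qed
qed (use bt_meas nonneg \<kappa> in auto)

sublocale D: kernel N N d 1
  by unfold_locales (use d_meas nonneg row_d_le sym in auto)

text \<open>Raising the two inequalities to the power \<open>s\<close> by Jensen's inequality reduces finite \<open>s\<close> to
  \<open>s = 1\<close>, where the mass conditions are used for the columns.\<close>

lemma contraction:
  assumes s: "1 \<le> s" and x: "x \<in> Lp_space s (completion M)" and y: "y \<in> Lp_space s (completion N)"
    and y': "y' \<in> borel_measurable (completion N)"
    and \<eta>: "0 \<le> \<eta>" "\<eta> < 1"
    and x_le: "AE p in completion M. ennreal \<bar>x p\<bar> \<le>
      (\<integral>\<^sup>+r. a p r * ennreal (\<eta> * \<bar>x r\<bar>) \<partial>M) + (\<integral>\<^sup>+r. b p r * ennreal \<bar>y r\<bar> \<partial>N)"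
    and y'_le: "AE p in completion N. ennreal \<bar>y' p\<bar> \<le>
      (\<integral>\<^sup>+r. bt p r * ennreal (\<eta> * \<bar>x r\<bar>) \<partial>M) + (\<integral>\<^sup>+r. d p r * ennreal \<bar>y r\<bar> \<partial>N)"
  shows "Lp_modular s (completion N) y' \<le> ennreal (1 - (1 - \<eta>) * \<delta>) * Lp_modular s (completion N) y"
    and "Lp_modular s (completion M) x \<le> ennreal (max 1 (\<kappa> / (1 - \<eta>))) * Lp_modular s (completion N) y"
proof -
  let ?M = "completion M" and ?N = "completion N"
  have [measurable]: "x \<in> borel_measurable ?M" "y \<in> borel_measurable ?N"
    using x y by (auto simp: Lp_space_iff)
  note [measurable] = y'
  have row_meas: "(\<lambda>r. ennreal (a p r)) \<in> borel_measurable M" "(\<lambda>r. ennreal (b p r)) \<in> borel_measurable N"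
    if "p \<in> space M" for p
    using A.row_measurable[OF that] B.row_measurable[OF that] by auto
  have row_meas': "(\<lambda>r. ennreal (bt p r)) \<in> borel_measurable M" "(\<lambda>r. ennreal (d p r)) \<in> borel_measurable N"
    if "p \<in> space N" for p
    using Bt.row_measurable[OF that] D.row_measurable[OF that] by auto
  have x_le': "AE p in M. ennreal \<bar>x p\<bar> \<le>
      (\<integral>\<^sup>+r. a p r * ennreal (\<eta> * \<bar>x r\<bar>) \<partial>M) + (\<integral>\<^sup>+r. b p r * ennreal \<bar>y r\<bar> \<partial>N)"
    using x_le by (simp only: AE_completion_iff)
  have y'_le': "AE p in N. ennreal \<bar>y' p\<bar> \<le>
      (\<integral>\<^sup>+r. bt p r * ennreal (\<eta> * \<bar>x r\<bar>) \<partial>M) + (\<integral>\<^sup>+r. d p r * ennreal \<bar>y r\<bar> \<partial>N)"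
    using y'_le by (simp only: AE_completion_iff)
  have "Lp_modular s ?N y' \<le> ennreal (1 - (1 - \<eta>) * \<delta>) * Lp_modular s ?N y \<and>
    Lp_modular s ?M x \<le> ennreal (max 1 (\<kappa> / (1 - \<eta>))) * Lp_modular s ?N y"
  proof (cases "s = \<infinity>")
    case True
    obtain X where X: "0 \<le> X" "esssup ?M (\<lambda>r. ennreal \<bar>x r\<bar>) = ennreal X"
      using x True by (cases "esssup ?M (\<lambda>r. ennreal \<bar>x r\<bar>)") (auto simp: Lp_space_iff Lp_modular_def)
    obtain Y where Y: "0 \<le> Y" "esssup ?N (\<lambda>r. ennreal \<bar>y r\<bar>) = ennreal Y"
      using y True by (cases "esssup ?N (\<lambda>r. ennreal \<bar>y r\<bar>)") (auto simp: Lp_space_iff Lp_modular_def)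
    have aeX: "AE r in M. \<bar>x r\<bar> \<le> X"
      using esssup_AE[of "\<lambda>r. ennreal \<bar>x r\<bar>" ?M] X by (simp add: AE_completion_iff ennreal_le_iff)
    have aeY: "AE r in N. \<bar>y r\<bar> \<le> Y"
      using esssup_AE[of "\<lambda>r. ennreal \<bar>y r\<bar>" ?N] Y by (simp add: AE_completion_iff ennreal_le_iff)
    have bound: "(\<integral>\<^sup>+r. k r * ennreal (\<eta> * \<bar>x r\<bar>) \<partial>M) + (\<integral>\<^sup>+r. l r * ennreal \<bar>y r\<bar> \<partial>N) \<le>
        (\<integral>\<^sup>+r. k r \<partial>M) * ennreal (\<eta> * X) + (\<integral>\<^sup>+r. l r \<partial>N) * ennreal Y"
      if [measurable]: "k \<in> borel_measurable M" "l \<in> borel_measurable N" for k l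
    proof (rule add_mono)
      have "(\<integral>\<^sup>+r. k r * ennreal (\<eta> * \<bar>x r\<bar>) \<partial>M) \<le> (\<integral>\<^sup>+r. k r * ennreal (\<eta> * X) \<partial>M)"
        using aeX \<eta> by (intro nn_integral_mono_AE) (auto elim!: eventually_mono intro!: mult_left_mono ennreal_leI)
      then show "(\<integral>\<^sup>+r. k r * ennreal (\<eta> * \<bar>x r\<bar>) \<partial>M) \<le> (\<integral>\<^sup>+r. k r \<partial>M) * ennreal (\<eta> * X)"
        by (simp add: nn_integral_multc)
      have "(\<integral>\<^sup>+r. l r * ennreal \<bar>y r\<bar> \<partial>N) \<le> (\<integral>\<^sup>+r. l r * ennreal Y \<partial>N)"
        using aeY by (intro nn_integral_mono_AE) (auto elim!: eventually_mono intro!: mult_left_mono ennreal_leI)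
      then show "(\<integral>\<^sup>+r. l r * ennreal \<bar>y r\<bar> \<partial>N) \<le> (\<integral>\<^sup>+r. l r \<partial>N) * ennreal Y"
        by (simp add: nn_integral_multc)
    qed
    have "AE p in M. ennreal \<bar>x p\<bar> \<le> ennreal (max (\<eta> * X) Y)"
      using x_le' AE_space
    proof eventually_elim
      case (elim p)
      let ?K = "ennreal (max (\<eta> * X) Y)"
      note elim(1)
      also note bound[OF row_meas[OF elim(2)]]
      also have "A.row p * ennreal (\<eta> * X) + B.row p * ennreal Y \<le>
          A.row p * ?K + B.row p * ?K"
        by (intro add_mono mult_left_mono ennreal_leI) auto
      also have "\<dots> = (A.row p + B.row p) * ?K" by (simp add: distrib_right)
      also have "\<dots> \<le> 1 * ?K" by (intro mult_right_mono mass_M elim) auto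
      finally show ?case by simp
    qed
    then have "esssup ?M (\<lambda>r. ennreal \<bar>x r\<bar>) \<le> ennreal (max (\<eta> * X) Y)"
      by (intro esssup_I) (auto intro: AE_completion)
    then have "X \<le> max (\<eta> * X) Y" using X Y \<eta> by (simp add: ennreal_le_iff)
    \<comment> \<open>If the maximum is \<open>\<eta> * X\<close>, then \<open>\<eta> < 1\<close>
      and the finiteness of \<open>X\<close> force \<open>X = 0\<close>; so \<open>X \<le> Y\<close>
      in both cases.\<close>
    moreover have "X \<le> 0" if "X \<le> \<eta> * X" using that \<eta> X by (simp add: mult_le_cancel_right1)
    ultimately have XY: "X \<le> Y" using Y by (auto simp: max_def split: if_splits)
    have "AE p in N. ennreal \<bar>y' p\<bar> \<le> ennreal ((1 - (1 - \<eta>) * \<delta>) * Y)"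
      using y'_le' AE_space
    proof eventually_elim
      case (elim p)
      note elim(1)
      also note bound[OF row_meas'[OF elim(2)]]
      finally have le: "ennreal \<bar>y' p\<bar> \<le> Bt.row p * ennreal (\<eta> * X) + D.row p * ennreal Y" .
      obtain u where u: "0 \<le> u" "Bt.row p = ennreal u"
        using Bt.k_row[OF elim(2)] by (cases "\<integral>\<^sup>+r. bt p r \<partial>M") (auto simp: top_unique)
      obtain v where v: "0 \<le> v" "D.row p = ennreal v"
        using D.k_row[OF elim(2)] by (cases "\<integral>\<^sup>+r. d p r \<partial>N") (auto simp: top_unique)
      have uv: "u + v \<le> 1" using mass_bt[OF elim(2)] u v by (simp flip: ennreal_plus)
      have v\<delta>: "v \<le> 1 - \<delta>" using mass_d[OF elim(2)] v \<delta> by (simp add: ennreal_le_iff)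
      have "\<bar>y' p\<bar> \<le> u * (\<eta> * X) + v * Y"
        using le u v X Y \<eta> by (simp flip: ennreal_plus ennreal_mult)
      also have "\<dots> \<le> u * (\<eta> * Y) + v * Y"
        using u \<eta> XY by (intro add_right_mono mult_left_mono) auto
      also have "\<dots> = (\<eta> * u + v) * Y" by (simp add: algebra_simps)
      also have "\<dots> \<le> (1 - (1 - \<eta>) * \<delta>) * Y"
      proof (rule mult_right_mono)
        \<comment> \<open>The mass that does not go straight to the interior is at most
          \<open>1 - v\<close> and is damped by \<open>\<eta>\<close>. The resulting bound grows
          with \<open>v\<close>, so \<open>v = 1 - \<delta>\<close> is the worst case.\<close>
        have "\<eta> * u \<le> \<eta> * (1 - v)" using uv \<eta> by (intro mult_left_mono) auto
        moreover have "(1 - \<eta>) * v \<le> (1 - \<eta>) * (1 - \<delta>)" using v\<delta> \<eta> by (intro mult_left_mono) auto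
        ultimately show "\<eta> * u + v \<le> 1 - (1 - \<eta>) * \<delta>" by (simp add: algebra_simps)
      qed (rule Y)
      finally show ?case by (rule ennreal_leI)
    qed
    then have "esssup ?N (\<lambda>r. ennreal \<bar>y' r\<bar>) \<le> ennreal ((1 - (1 - \<eta>) * \<delta>) * Y)"
      by (intro esssup_I) (auto intro: AE_completion)
    moreover have "(1 - \<eta>) * \<delta> \<le> 1 * 1" using \<eta> \<delta> by (intro mult_mono) auto
    moreover have "ennreal X \<le> ennreal (max 1 (\<kappa> / (1 - \<eta>)) * Y)"
    proof (rule ennreal_leI)
      have "1 * Y \<le> max 1 (\<kappa> / (1 - \<eta>)) * Y" using Y by (intro mult_right_mono) auto
      with XY show "X \<le> max 1 (\<kappa> / (1 - \<eta>)) * Y" by simp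
    qed
    ultimately show ?thesis
      using True X Y by (simp add: Lp_modular_def ennreal_mult)
  next
    case False
    define t where "t = enn2real s"
    have t: "1 \<le> t" unfolding t_def by (rule one_le_enn2real[OF s False])
    have mod: "Lp_modular s L h = (\<integral>\<^sup>+x. ennreal (\<bar>h x\<bar> powr t) \<partial>L)" for h :: "_ \<Rightarrow> real" and L
      using False by (simp add: Lp_modular_def t_def)
    define F where "F r = ennreal (\<bar>x r\<bar> powr t)" for r
    define H where "H r = ennreal (\<bar>y r\<bar> powr t)" for r
    have [measurable]: "F \<in> borel_measurable ?M" "H \<in> borel_measurable ?N"
      unfolding F_def H_def by measurable
    \<comment> \<open>As \<open>\<eta> powr t \<le> \<eta>\<close>, the damping factor is taken out
      linearly, with the same value for all exponents.\<close>
    have \<eta>t: "ennreal ((\<eta> * \<bar>z\<bar>) powr t) \<le> ennreal \<eta> * ennreal (\<bar>z\<bar> powr t)" for z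
    proof -
      have "\<eta> powr t \<le> \<eta>" using powr_mono'[OF t, of \<eta>] \<eta> by simp
      then have "\<eta> powr t * \<bar>z\<bar> powr t \<le> \<eta> * \<bar>z\<bar> powr t" by (rule mult_right_mono) simp
      then show ?thesis using \<eta> by (simp add: powr_mult ennreal_leI flip: ennreal_mult)
    qed
    have jensen: "ennreal (\<bar>z\<bar> powr t) \<le> ennreal \<eta> * (\<integral>\<^sup>+r. k r * F r \<partial>M) + (\<integral>\<^sup>+r. l r * H r \<partial>N)"
      if k: "k \<in> borel_measurable M" and l: "l \<in> borel_measurable N"
        and mass: "(\<integral>\<^sup>+r. k r \<partial>M) + (\<integral>\<^sup>+r. l r \<partial>N) \<le> 1"
        and le: "ennreal \<bar>z\<bar> \<le> (\<integral>\<^sup>+r. k r * ennreal (\<eta> * \<bar>x r\<bar>) \<partial>M) + (\<integral>\<^sup>+r. l r * ennreal \<bar>y r\<bar> \<partial>N)"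
      for k l z
    proof -
      have [measurable]: "k \<in> borel_measurable ?M" "l \<in> borel_measurable ?N"
        using k l by (auto intro: measurable_completion)
      have "ennreal (\<bar>z\<bar> powr t) \<le>
          (\<integral>\<^sup>+r. k r * ennreal ((\<eta> * \<bar>x r\<bar>) powr t) \<partial>?M) + (\<integral>\<^sup>+r. l r * ennreal (\<bar>y r\<bar> powr t) \<partial>?N)"
        using mass le \<eta> by (intro powr_le_nn_integral_powr t) (auto simp: nn_integral_completion)
      also have "\<dots> \<le> (\<integral>\<^sup>+r. ennreal \<eta> * (k r * F r) \<partial>?M) + (\<integral>\<^sup>+r. l r * H r \<partial>?N)"
      proof (intro add_mono nn_integral_mono)
        fix r
        have "k r * ennreal ((\<eta> * \<bar>x r\<bar>) powr t) \<le> k r * (ennreal \<eta> * F r)"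
          unfolding F_def by (intro mult_left_mono \<eta>t) auto
        then show "k r * ennreal ((\<eta> * \<bar>x r\<bar>) powr t) \<le> ennreal \<eta> * (k r * F r)"
          by (simp add: mult_ac)
      qed (simp add: H_def)
      also have "\<dots> = ennreal \<eta> * (\<integral>\<^sup>+r. k r * F r \<partial>?M) + (\<integral>\<^sup>+r. l r * H r \<partial>?N)"
        by (simp add: nn_integral_cmult)
      finally show ?thesis by (simp add: nn_integral_completion)
    qed
    define IX IY where "IX = (\<integral>\<^sup>+r. F r \<partial>M)" and "IY = (\<integral>\<^sup>+r. H r \<partial>N)"
    \<comment> \<open>After Tonelli's theorem: the mass sent from the boundary to the boundary
      (\<open>AX\<close>) and to the interior (\<open>CX\<close>), then from the interior to the
      boundary (\<open>BY\<close>) and to the interior (\<open>DY\<close>).\<close>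
    define AX CX where "AX = (\<integral>\<^sup>+r. A.col r * F r \<partial>M)"
      and "CX = (\<integral>\<^sup>+r. Bt.col r * F r \<partial>M)"
    define BY DY where "BY = (\<integral>\<^sup>+r. B.col r * H r \<partial>N)"
      and "DY = (\<integral>\<^sup>+r. D.col r * H r \<partial>N)"
    have le1: "IX \<le> ennreal \<eta> * AX + BY"
    proof -
      have "AE p in M. F p \<le> ennreal \<eta> * A.nn_opr F p + B.nn_opr H p"
        using x_le' AE_space
        by eventually_elim (unfold F_def[of p for p], rule jensen[OF row_meas mass_M, unfolded F_def])
      then have "IX \<le> (\<integral>\<^sup>+p. ennreal \<eta> * A.nn_opr F p + B.nn_opr H p \<partial>M)"
        unfolding IX_def by (rule nn_integral_mono_AE)
      also have "\<dots> = ennreal \<eta> * (\<integral>\<^sup>+p. A.nn_opr F p \<partial>M) + (\<integral>\<^sup>+p. B.nn_opr H p \<partial>M)"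
        using A.borel_measurable_nn_integral_kernel[of F] B.borel_measurable_nn_integral_kernel[of H]
        by (simp add: nn_integral_add nn_integral_cmult)
      also have "\<dots> = ennreal \<eta> * AX + BY"
        by (simp add: A.nn_integral_kernel_swap B.nn_integral_kernel_swap AX_def BY_def)
      finally show ?thesis .
    qed
    have le2: "(\<integral>\<^sup>+p. ennreal (\<bar>y' p\<bar> powr t) \<partial>N) \<le> ennreal \<eta> * CX + DY"
    proof -
      have "AE p in N. ennreal (\<bar>y' p\<bar> powr t) \<le>
          ennreal \<eta> * Bt.nn_opr F p + D.nn_opr H p"
        using y'_le' AE_space
        by eventually_elim (rule jensen[OF row_meas' mass_bt])
      then have "(\<integral>\<^sup>+p. ennreal (\<bar>y' p\<bar> powr t) \<partial>N) \<le>
          (\<integral>\<^sup>+p. ennreal \<eta> * Bt.nn_opr F p + D.nn_opr H p \<partial>N)"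
        by (rule nn_integral_mono_AE)
      also have "\<dots> = ennreal \<eta> * (\<integral>\<^sup>+p. Bt.nn_opr F p \<partial>N) + (\<integral>\<^sup>+p. D.nn_opr H p \<partial>N)"
        using Bt.borel_measurable_nn_integral_kernel[of F] D.borel_measurable_nn_integral_kernel[of H]
        by (simp add: nn_integral_add nn_integral_cmult)
      also have "\<dots> = ennreal \<eta> * CX + DY"
        by (simp add: Bt.nn_integral_kernel_swap D.nn_integral_kernel_swap CX_def DY_def)
      finally show ?thesis .
    qed
    have col_meas: "(\<lambda>r. \<integral>\<^sup>+p. k p r \<partial>P) \<in> borel_measurable (completion Q)"
      if "(\<lambda>(p, r). k p r) \<in> borel_measurable (P \<Otimes>\<^sub>M Q)" "sigma_finite_measure P"
      for k :: "_ \<Rightarrow> _ \<Rightarrow> real" and P Q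
    proof -
      have "(\<lambda>(r, p). ennreal (k p r)) \<in> borel_measurable (Q \<Otimes>\<^sub>M P)"
        using measurable_pair_swap[OF that(1)] by simp
      then show ?thesis
        by (intro measurable_completion sigma_finite_measure.borel_measurable_nn_integral[OF that(2)])
    qed
    note [measurable] = col_meas[OF a_meas M.sigma_finite_measure_axioms]
      col_meas[OF b_meas M.sigma_finite_measure_axioms]
      col_meas[OF bt_meas N.sigma_finite_measure_axioms]
      col_meas[OF d_meas N.sigma_finite_measure_axioms]
    \<comment> \<open>Weighting the interior by \<open>\<kappa>\<close> makes the block kernel
      symmetric, because \<open>\<kappa> * bt r p = b p r\<close>. The columns therefore obey the
      row bounds: \<open>mass_M\<close> here, \<open>mass_N\<close> in the next estimate.\<close>
    have le3: "AX + ennreal \<kappa> * CX \<le> IX"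
    proof -
      have "AX + ennreal \<kappa> * CX = (\<integral>\<^sup>+r. A.col r * F r \<partial>?M) + ennreal \<kappa> * (\<integral>\<^sup>+r. Bt.col r * F r \<partial>?M)"
        by (simp add: AX_def CX_def nn_integral_completion)
      also have "\<dots> = (\<integral>\<^sup>+r. A.col r * F r + ennreal \<kappa> * (Bt.col r * F r) \<partial>?M)"
        by (simp add: nn_integral_add nn_integral_cmult)
      also have "\<dots> \<le> (\<integral>\<^sup>+r. F r \<partial>?M)"
      proof (rule nn_integral_mono)
        fix r assume "r \<in> space ?M"
        then have r: "r \<in> space M" by simp

        have "ennreal \<kappa> * Bt.col r = (\<integral>\<^sup>+p. ennreal \<kappa> * ennreal (bt p r) \<partial>N)"
          using b_row_measurable[OF r] by (intro nn_integral_cmult[symmetric]) auto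
        also have "\<dots> = B.row r"
          using \<kappa> nonneg by (intro nn_integral_cong) (simp flip: ennreal_mult)
        finally have "A.col r + ennreal \<kappa> * Bt.col r \<le> 1"
          using mass_M[OF r] by (simp add: sym(1)[of _ r])
        then have "(A.col r + ennreal \<kappa> * Bt.col r) * F r \<le> 1 * F r"
          by (rule mult_right_mono) simp
        then show "A.col r * F r + ennreal \<kappa> * (Bt.col r * F r) \<le> F r"
          by (simp add: distrib_right mult.assoc)
      qed
      finally show ?thesis by (simp add: IX_def nn_integral_completion)
    qed
    have le4: "BY + ennreal \<kappa> * DY \<le> ennreal \<kappa> * IY"
    proof -
      have "BY + ennreal \<kappa> * DY = (\<integral>\<^sup>+r. B.col r * H r \<partial>?N) + ennreal \<kappa> * (\<integral>\<^sup>+r. D.col r * H r \<partial>?N)"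
        by (simp add: BY_def DY_def nn_integral_completion)
      also have "\<dots> = (\<integral>\<^sup>+r. B.col r * H r + ennreal \<kappa> * (D.col r * H r) \<partial>?N)"
        by (simp add: nn_integral_add nn_integral_cmult)
      also have "\<dots> \<le> (\<integral>\<^sup>+r. ennreal \<kappa> * H r \<partial>?N)"
      proof (rule nn_integral_mono)
        fix r assume "r \<in> space ?N"
        then have r: "r \<in> space N" by simp
        have "(B.col r + ennreal \<kappa> * D.col r) * H r \<le> ennreal \<kappa> * H r"
          using mass_N[OF r] by (intro mult_right_mono) (simp_all add: sym(2)[of _ r])
        then show "B.col r * H r + ennreal \<kappa> * (D.col r * H r) \<le> ennreal \<kappa> * H r"
          by (simp add: distrib_right mult.assoc)
      qed
      also have "\<dots> = ennreal \<kappa> * (\<integral>\<^sup>+r. H r \<partial>?N)" by (intro nn_integral_cmult) measurable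
      finally show ?thesis by (simp add: IY_def nn_integral_completion)
    qed
    have le5: "DY \<le> ennreal (1 - \<delta>) * IY"
    proof -
      have "DY \<le> (\<integral>\<^sup>+r. ennreal (1 - \<delta>) * H r \<partial>?N)"
        unfolding DY_def nn_integral_completion
        by (intro nn_integral_mono mult_right_mono) (simp_all add: sym(2) mass_d)
      also have "\<dots> = ennreal (1 - \<delta>) * (\<integral>\<^sup>+r. H r \<partial>?N)" by (intro nn_integral_cmult) measurable
      finally show ?thesis by (simp add: IY_def nn_integral_completion)
    qed
    \<comment> \<open>The estimates are transferred to the reals, where terms can be subtracted;
      this requires all six integrals to be finite.\<close>
    have fin: "IX < \<infinity>" "IY < \<infinity>"
      using x y by (simp_all add: Lp_space_iff mod nn_integral_completion IX_def IY_def F_def H_def)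
    then obtain ix iy where i: "0 \<le> ix" "IX = ennreal ix" "0 \<le> iy" "IY = ennreal iy"
      by (cases IX; cases IY) auto
    have "AX \<le> IX" by (rule order_trans[OF _ le3]) simp
    with i obtain ax where ax: "0 \<le> ax" "AX = ennreal ax" by (cases AX) (auto simp: top_unique)
    have "ennreal \<kappa> * CX \<le> IX" by (rule order_trans[OF _ le3]) simp
    with i \<kappa> obtain cx where cx: "0 \<le> cx" "CX = ennreal cx" by (cases CX) (auto simp: ennreal_mult_top top_unique)
    have "DY \<le> ennreal ((1 - \<delta>) * iy)" using le5 i \<delta> by (simp add: ennreal_mult)
    then obtain dy where dy: "0 \<le> dy" "DY = ennreal dy" by (cases DY) (auto simp: top_unique)
    have "BY \<le> ennreal (\<kappa> * iy)" using le4 i \<kappa> by (auto simp: ennreal_mult intro: order_trans[rotated])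
    then obtain "by" where "by": "0 \<le> by" "BY = ennreal by" by (cases BY) (auto simp: top_unique)
    have r1: "ix \<le> \<eta> * ax + by"
      using le1 i ax "by" \<eta> by (simp flip: ennreal_mult ennreal_plus)
    have r3: "ax + \<kappa> * cx \<le> ix"
      using le3 i ax cx \<kappa> by (simp flip: ennreal_mult ennreal_plus)
    have r4: "by + \<kappa> * dy \<le> \<kappa> * iy"
      using le4 i dy "by" \<kappa> by (simp flip: ennreal_mult ennreal_plus)
    have r5: "dy \<le> (1 - \<delta>) * iy"
      using le5 i dy \<delta> by (simp flip: ennreal_mult)
    \<comment> \<open>Balance at the boundary: \<open>ax\<close> cancels between \<open>r1\<close>
      and \<open>r3\<close>, so the boundary sends into the interior no more than it receives from
      there, \<open>\<kappa> * cx \<le> by\<close>. With \<open>r4\<close> this gives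
      \<open>cx + dy \<le> iy\<close>, and the rest is the convexity computation of the case
      \<open>s = \<infinity>\<close>.\<close>
    have "\<eta> * ax \<le> 1 * ax" using \<eta> ax by (intro mult_right_mono) auto
    then have "\<kappa> * cx \<le> by" using r1 r3 by simp
    then have "\<kappa> * (cx + dy) \<le> \<kappa> * iy" using r4 by (simp add: algebra_simps)
    then have "cx + dy \<le> iy" using \<kappa> by simp
    then have "\<eta> * cx \<le> \<eta> * (iy - dy)" using \<eta> by (intro mult_left_mono) auto
    moreover have "(1 - \<eta>) * dy \<le> (1 - \<eta>) * ((1 - \<delta>) * iy)" using \<eta> r5 by (intro mult_left_mono) auto
    ultimately have "\<eta> * cx + dy \<le> (1 - (1 - \<eta>) * \<delta>) * iy" by (simp add: algebra_simps)
    moreover have "ennreal \<eta> * CX + DY = ennreal (\<eta> * cx + dy)"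
      using cx dy \<eta> by (simp flip: ennreal_mult ennreal_plus)
    ultimately have "ennreal \<eta> * CX + DY \<le> ennreal ((1 - (1 - \<eta>) * \<delta>) * iy)"
      by (simp add: ennreal_leI)
    moreover have "(1 - \<eta>) * \<delta> \<le> 1 * 1" using \<eta> \<delta> by (intro mult_mono) auto
    ultimately have A: "Lp_modular s ?N y' \<le> ennreal (1 - (1 - \<eta>) * \<delta>) * Lp_modular s ?N y"
      using le2 i by (simp add: mod nn_integral_completion ennreal_mult IY_def H_def)
    have "\<kappa> * cx \<ge> 0" "\<kappa> * dy \<ge> 0" using \<kappa> cx dy by auto
    \<comment> \<open>Inserting this into \<open>r1\<close> lets \<open>ix\<close> be absorbed on
      the left, which gives the bound on the boundary unknown.\<close>
    then have "ax \<le> ix" using r3 by simp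
    then have "\<eta> * ax \<le> \<eta> * ix" using \<eta>(1) by (rule mult_left_mono)
    then have "(1 - \<eta>) * ix \<le> \<kappa> * iy" using r1 r4 \<open>\<kappa> * dy \<ge> 0\<close> by (simp add: algebra_simps)
    then have "ix \<le> \<kappa> / (1 - \<eta>) * iy" using \<eta> by (simp add: field_simps)
    also have "\<dots> \<le> max 1 (\<kappa> / (1 - \<eta>)) * iy" using i by (intro mult_right_mono) auto
    finally have "ennreal ix \<le> ennreal (max 1 (\<kappa> / (1 - \<eta>)) * iy)" by (rule ennreal_leI)
    then have "Lp_modular s ?M x \<le> ennreal (max 1 (\<kappa> / (1 - \<eta>))) * Lp_modular s ?N y"
      using i by (simp add: mod nn_integral_completion ennreal_mult IY_def H_def IX_def F_def)
    with A show ?thesis ..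
  qed
  then show "Lp_modular s ?N y' \<le> ennreal (1 - (1 - \<eta>) * \<delta>) * Lp_modular s ?N y"
    "Lp_modular s ?M x \<le> ennreal (max 1 (\<kappa> / (1 - \<eta>))) * Lp_modular s ?N y" by auto
qed

text \<open>\<open>\<theta>\<close> rescales the boundary unknown and \<open>\<omega>\<close> is the albedo.\<close>

definition is_run ::
  "ennreal \<Rightarrow> real \<Rightarrow> real \<Rightarrow> real \<Rightarrow> ('a \<Rightarrow> real) \<Rightarrow> ('b \<Rightarrow> real) \<Rightarrow> (nat \<Rightarrow> 'a \<Rightarrow> real) \<Rightarrow> (nat \<Rightarrow> 'b \<Rightarrow> real) \<Rightarrow> bool"
  where "is_run s \<eta> \<omega> \<theta> h1 h2 q G \<longleftrightarrow>
    (\<forall>n. q n \<in> Lp_space s (completion M) \<and> G n \<in> Lp_space s (completion N) \<and>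
      (AE p in completion M. q n p - \<eta> * A.opr (q n) p = \<theta> * \<omega> * B.opr (G n) p + h1 p) \<and>
      (AE r in completion N. G (Suc n) r = \<omega> * D.opr (G n) r + \<eta> / \<theta> * Bt.opr (q n) r + h2 r))"

text \<open>The boundary equation is implicit in \<open>q n\<close>; it is solved by the fixed point
  theorem, since the kernel \<open>a\<close> has row and column mass at most 1 and is damped by
  \<open>\<eta> < 1\<close>.\<close>

lemma ex_is_run:
  assumes s: "1 \<le> s" and \<eta>: "0 \<le> \<eta>" "\<eta> < 1"
    and h1: "h1 \<in> Lp_space s (completion M)" and h2: "h2 \<in> Lp_space s (completion N)"
    and G0: "G0 \<in> Lp_space s (completion N)"
  shows "\<exists>q G. G 0 = G0 \<and> is_run s \<eta> \<omega> \<theta> h1 h2 q G"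
proof -
  have ex: "\<exists>q. q \<in> Lp_space s (completion M) \<and>
      (AE p in completion M. q p - \<eta> * A.opr q p = \<theta> * \<omega> * B.opr H p + h1 p)"
    if H: "H \<in> Lp_space s (completion N)" for H
  proof -
    have h: "(\<lambda>p. \<theta> * \<omega> * B.opr H p + h1 p) \<in> Lp_space s (completion M)"
      by (intro Lp_space_add[OF s] Lp_space_cmult[OF s] B.opr_Lp[OF s] H h1)
    have T: "(\<lambda>p. \<eta> * A.opr f p) \<in> Lp_space s (completion M)" if "f \<in> Lp_space s (completion M)" for f
      by (intro Lp_space_cmult[OF s] A.opr_Lp[OF s] that)
    have "Lp_modular s (completion M) (\<lambda>p. \<eta> * A.opr f p - \<eta> * A.opr g p) \<le>
        ennreal \<eta> * Lp_modular s (completion M) (\<lambda>r. f r - g r)"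
      if f: "f \<in> Lp_space s (completion M)" and g: "g \<in> Lp_space s (completion M)" for f g
    proof -
      have fg: "(\<lambda>r. f r - g r) \<in> Lp_space s (completion M)" by (rule Lp_space_diff[OF s f g])
      then have m: "A.opr (\<lambda>r. f r - g r) \<in> borel_measurable (completion M)"
        by (intro A.opr_measurable Lp_space_measurable)
      have "AE p in completion M. \<bar>\<eta> * A.opr f p - \<eta> * A.opr g p\<bar> \<le> \<bar>\<eta> * A.opr (\<lambda>r. f r - g r) p\<bar>"
        using A.opr_diff[OF s f g] by eventually_elim (simp flip: right_diff_distrib)
      moreover have "A.opr f \<in> borel_measurable (completion M)" "A.opr g \<in> borel_measurable (completion M)"
        using f g by (auto intro: A.opr_measurable Lp_space_measurable)
      ultimately have "Lp_modular s (completion M) (\<lambda>p. \<eta> * A.opr f p - \<eta> * A.opr g p) \<le>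
          Lp_modular s (completion M) (\<lambda>p. \<eta> * A.opr (\<lambda>r. f r - g r) p)"
        by (intro Lp_modular_mono_AE s) auto
      also have "\<dots> \<le> ennreal \<eta> * Lp_modular s (completion M) (A.opr (\<lambda>r. f r - g r))"
        using Lp_modular_cmult_le[OF s m, of \<eta>] \<eta> by simp
      also have "\<dots> \<le> ennreal \<eta> * Lp_modular s (completion M) (\<lambda>r. f r - g r)"
        using A.opr_Lp_modular[OF s Lp_space_measurable[OF fg]] by (intro mult_left_mono) auto
      finally show ?thesis .
    qed
    from Lp_contraction_fixed_point[where T = "\<lambda>q p. \<eta> * A.opr q p", OF s \<eta> T this h]
    show ?thesis by blast
  qed
  \<comment> \<open>As functions, solutions are not unique; the choice fixes one for each
    \<open>H\<close>, so that \<open>G\<close> can be defined by recursion.\<close>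
  define sol where "sol H = (SOME q. q \<in> Lp_space s (completion M) \<and>
      (AE p in completion M. q p - \<eta> * A.opr q p = \<theta> * \<omega> * B.opr H p + h1 p))" for H
  have sol: "sol H \<in> Lp_space s (completion M) \<and>
      (AE p in completion M. sol H p - \<eta> * A.opr (sol H) p = \<theta> * \<omega> * B.opr H p + h1 p)"
    if "H \<in> Lp_space s (completion N)" for H
    using someI_ex[OF ex[OF that]] unfolding sol_def .
  define G where "G = rec_nat G0 (\<lambda>_ H r. \<omega> * D.opr H r + \<eta> / \<theta> * Bt.opr (sol H) r + h2 r)"
  have G_Suc: "G (Suc n) = (\<lambda>r. \<omega> * D.opr (G n) r + \<eta> / \<theta> * Bt.opr (sol (G n)) r + h2 r)" for n
    by (simp add: G_def)
  have G: "G n \<in> Lp_space s (completion N)" for n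
  proof (induction n)
    case 0
    then show ?case using G0 by (simp add: G_def)
  next
    case (Suc n)
    then show ?case unfolding G_Suc
      by (intro Lp_space_add[OF s] Lp_space_cmult[OF s] D.opr_Lp[OF s] Bt.opr_Lp[OF s] h2) (use sol in auto)
  qed
  have "is_run s \<eta> \<omega> \<theta> h1 h2 (\<lambda>n. sol (G n)) G"
    unfolding is_run_def using sol[OF G] G by (auto simp: G_Suc)
  moreover have "G 0 = G0" by (simp add: G_def)
  ultimately show ?thesis by blast
qed

text \<open>The inhomogeneities cancel in differences of consecutive iterates, and division by
  \<open>\<theta>\<close> normalizes the boundary difference; what remains is the situation of
  \<open>contraction\<close>. Interior differences then decay geometrically, and each boundary
  difference is controlled by the interior one of the same index.\<close>

lemma is_run_converges:
  assumes s: "1 \<le> s" and \<eta>: "0 \<le> \<eta>" "\<eta> < 1" and \<omega>: "0 \<le> \<omega>" "\<omega> \<le> 1" and \<theta>: "0 < \<theta>"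
    and run: "is_run s \<eta> \<omega> \<theta> h1 h2 q G"
  shows "\<exists>q' G'. Lp_converges s (completion M) q q' \<and> Lp_converges s (completion N) G G'"
proof -
  let ?M = "completion M" and ?N = "completion N"
  have q: "q n \<in> Lp_space s ?M" and G: "G n \<in> Lp_space s ?N"
    and eq1: "AE p in ?M. q n p - \<eta> * A.opr (q n) p = \<theta> * \<omega> * B.opr (G n) p + h1 p"
    and eq2: "AE r in ?N. G (Suc n) r = \<omega> * D.opr (G n) r + \<eta> / \<theta> * Bt.opr (q n) r + h2 r" for n
    using run unfolding is_run_def by auto
  define \<rho> where "\<rho> = 1 - (1 - \<eta>) * \<delta>"
  have "(1 - \<eta>) * \<delta> \<le> 1 * 1" using \<eta> \<delta> by (intro mult_mono) auto
  then have \<rho>: "0 \<le> \<rho>" "\<rho> < 1" using \<eta> \<delta> by (auto simp: \<rho>_def)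
  define C where "C = max 1 (\<kappa> / (1 - \<eta>))"
  define dq dG where "dq n = (\<lambda>p. q (Suc n) p - q n p)" and "dG n = (\<lambda>r. G (Suc n) r - G n r)" for n
  have dq: "dq n \<in> Lp_space s ?M" and dG: "dG n \<in> Lp_space s ?N" for n
    unfolding dq_def dG_def by (intro Lp_space_diff s q G)+
  have step: "Lp_modular s ?N (dG (Suc n)) \<le> ennreal \<rho> * Lp_modular s ?N (dG n) \<and>
      Lp_modular s ?M (\<lambda>p. dq n p / \<theta>) \<le> ennreal C * Lp_modular s ?N (dG n)" for n
  proof -
    have x: "(\<lambda>p. dq n p / \<theta>) \<in> Lp_space s ?M"
      using Lp_space_cmult[OF s dq, of "1 / \<theta>" n] by simp
    have A_scale: "(\<integral>\<^sup>+r. k p r * ennreal (\<eta> * \<bar>dq n r / \<theta>\<bar>) \<partial>M) =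
        ennreal (\<eta> / \<theta>) * (\<integral>\<^sup>+r. k p r * ennreal \<bar>dq n r\<bar> \<partial>M)"
      if k: "k p \<in> borel_measurable M" for k :: "'c \<Rightarrow> 'a \<Rightarrow> real" and p
    proof -
      have [measurable]: "k p \<in> borel_measurable ?M" "dq n \<in> borel_measurable ?M"
        using k dq[of n] by (auto simp: Lp_space_iff intro: measurable_completion)
      have "(\<integral>\<^sup>+r. k p r * ennreal (\<eta> * \<bar>dq n r / \<theta>\<bar>) \<partial>?M) =
          (\<integral>\<^sup>+r. ennreal (\<eta> / \<theta>) * (k p r * ennreal \<bar>dq n r\<bar>) \<partial>?M)"
      proof (rule nn_integral_cong)
        fix r
        have "ennreal (\<eta> * \<bar>dq n r / \<theta>\<bar>) = ennreal (\<eta> / \<theta>) * ennreal \<bar>dq n r\<bar>"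
          using \<eta> \<theta> by (simp add: abs_divide flip: ennreal_mult)
        then show "k p r * ennreal (\<eta> * \<bar>dq n r / \<theta>\<bar>) = ennreal (\<eta> / \<theta>) * (k p r * ennreal \<bar>dq n r\<bar>)"
          by (simp add: mult_ac)
      qed
      also have "\<dots> = ennreal (\<eta> / \<theta>) * (\<integral>\<^sup>+r. k p r * ennreal \<bar>dq n r\<bar> \<partial>?M)"
        by (intro nn_integral_cmult) measurable
      finally show ?thesis by (simp add: nn_integral_completion)
    qed
    have "AE p in ?M. ennreal \<bar>dq n p / \<theta>\<bar> \<le>
        (\<integral>\<^sup>+r. a p r * ennreal (\<eta> * \<bar>dq n r / \<theta>\<bar>) \<partial>M) + (\<integral>\<^sup>+r. b p r * ennreal \<bar>dG n r\<bar> \<partial>N)"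
      using eq1[of n] eq1[of "Suc n"] A.opr_diff[OF s q q, of "Suc n" n] B.opr_diff[OF s G G, of "Suc n" n] AE_space
    proof eventually_elim
      case (elim p)
      have "dq n p = \<eta> * (A.opr (q (Suc n)) p - A.opr (q n) p) + \<theta> * \<omega> * (B.opr (G (Suc n)) p - B.opr (G n) p)"
        using elim(1,2) by (simp add: dq_def algebra_simps)
      then have "dq n p / \<theta> = \<eta> / \<theta> * A.opr (dq n) p + \<omega> * B.opr (dG n) p"
        using elim(3,4) \<theta> by (simp add: dq_def dG_def add_divide_distrib)
      \<comment> \<open>The albedo is estimated by 1; the decay comes from \<open>\<eta>\<close> and
        \<open>\<delta>\<close>.\<close>
      also have "\<bar>\<dots>\<bar> \<le> \<eta> / \<theta> * \<bar>A.opr (dq n) p\<bar> + 1 * \<bar>B.opr (dG n) p\<bar>"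
        using \<eta> \<theta> \<omega> by (intro order_trans[OF abs_triangle_ineq] add_mono) (auto simp: abs_mult mult_left_le_one_le)
      finally have "ennreal \<bar>dq n p / \<theta>\<bar> \<le> ennreal (\<eta> / \<theta>) * ennreal \<bar>A.opr (dq n) p\<bar> + ennreal \<bar>B.opr (dG n) p\<bar>"
        using \<eta> \<theta> by (simp add: ennreal_leI flip: ennreal_mult ennreal_plus)
      also have "\<dots> \<le> ennreal (\<eta> / \<theta>) * (\<integral>\<^sup>+r. a p r * ennreal \<bar>dq n r\<bar> \<partial>M) + (\<integral>\<^sup>+r. b p r * ennreal \<bar>dG n r\<bar> \<partial>N)"
        by (intro add_mono mult_left_mono A.opr_bound B.opr_bound) auto
      finally show ?case unfolding A_scale[of a p, OF A.row_measurable[OF elim(5)[simplified]]] .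
    qed
    moreover have "AE p in ?N. ennreal \<bar>dG (Suc n) p\<bar> \<le>
        (\<integral>\<^sup>+r. bt p r * ennreal (\<eta> * \<bar>dq n r / \<theta>\<bar>) \<partial>M) + (\<integral>\<^sup>+r. d p r * ennreal \<bar>dG n r\<bar> \<partial>N)"
      using eq2[of n] eq2[of "Suc n"] Bt.opr_diff[OF s q q, of "Suc n" n] D.opr_diff[OF s G G, of "Suc n" n] AE_space
    proof eventually_elim
      case (elim p)
      have "dG (Suc n) p = \<eta> / \<theta> * (Bt.opr (q (Suc n)) p - Bt.opr (q n) p) + \<omega> * (D.opr (G (Suc n)) p - D.opr (G n) p)"
        using elim(1,2) by (simp add: dG_def algebra_simps)
      then have "dG (Suc n) p = \<eta> / \<theta> * Bt.opr (dq n) p + \<omega> * D.opr (dG n) p"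
        using elim(3,4) by (simp add: dq_def dG_def)
      also have "\<bar>\<dots>\<bar> \<le> \<eta> / \<theta> * \<bar>Bt.opr (dq n) p\<bar> + 1 * \<bar>D.opr (dG n) p\<bar>"
        using \<eta> \<theta> \<omega> by (intro order_trans[OF abs_triangle_ineq] add_mono) (auto simp: abs_mult mult_left_le_one_le)
      finally have "ennreal \<bar>dG (Suc n) p\<bar> \<le> ennreal (\<eta> / \<theta>) * ennreal \<bar>Bt.opr (dq n) p\<bar> + ennreal \<bar>D.opr (dG n) p\<bar>"
        using \<eta> \<theta> by (simp add: ennreal_leI flip: ennreal_mult ennreal_plus)
      also have "\<dots> \<le> ennreal (\<eta> / \<theta>) * (\<integral>\<^sup>+r. bt p r * ennreal \<bar>dq n r\<bar> \<partial>M) + (\<integral>\<^sup>+r. d p r * ennreal \<bar>dG n r\<bar> \<partial>N)"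
        by (intro add_mono mult_left_mono Bt.opr_bound D.opr_bound) auto
      finally show ?case unfolding A_scale[of bt p, OF Bt.row_measurable[OF elim(5)[simplified]]] .
    qed
    ultimately show ?thesis
      using contraction[OF s x dG[of n] Lp_space_measurable[OF dG[of "Suc n"]] \<eta>] by (simp add: \<rho>_def C_def)
  qed
  obtain K where K: "0 \<le> K" "Lp_modular s ?N (dG 0) = ennreal K"
    using dG[of 0] by (cases "Lp_modular s ?N (dG 0)") (auto simp: Lp_space_iff)
  have geoG: "Lp_modular s ?N (dG n) \<le> ennreal (K * \<rho> ^ n)" for n
  proof (induction n)
    case (Suc n)
    have "Lp_modular s ?N (dG (Suc n)) \<le> ennreal \<rho> * ennreal (K * \<rho> ^ n)"
      using step[of n] mult_left_mono[OF Suc, of "ennreal \<rho>"] by auto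
    also have "\<dots> = ennreal (K * \<rho> ^ Suc n)" using \<rho> K(1) by (simp add: algebra_simps flip: ennreal_mult)
    finally show ?case .
  qed (use K in simp)
  define L where "L = (if s = \<infinity> then \<bar>\<theta>\<bar> else \<bar>\<theta>\<bar> powr enn2real s)"
  have L: "0 \<le> L" by (simp add: L_def)
  have C: "0 \<le> C" by (simp add: C_def)
  have geoq: "Lp_modular s ?M (dq n) \<le> ennreal (L * C * K * \<rho> ^ n)" for n
  proof -
    have m: "(\<lambda>p. dq n p / \<theta>) \<in> borel_measurable ?M"
      using Lp_space_measurable[OF dq[of n]] by measurable
    have "dq n = (\<lambda>p. \<theta> * (dq n p / \<theta>))" using \<theta> by simp
    then have "Lp_modular s ?M (dq n) \<le> ennreal L * Lp_modular s ?M (\<lambda>p. dq n p / \<theta>)"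
      using Lp_modular_cmult[OF s m, of \<theta>] by (simp add: L_def)
    also have "\<dots> \<le> ennreal L * (ennreal C * ennreal (K * \<rho> ^ n))"
      using order_trans[OF conjunct2[OF step[of n]] mult_left_mono[OF geoG[of n]]] by (intro mult_left_mono) auto
    also have "\<dots> = ennreal (L * C * K * \<rho> ^ n)"
      using L C K \<rho> by (simp add: mult_ac flip: ennreal_mult)
    finally show ?thesis .
  qed
  obtain G' where "G' \<in> Lp_space s ?N" "(\<lambda>n. Lp_modular s ?N (\<lambda>x. G n x - G' x)) \<longlonglongrightarrow> 0"
    by (rule Lp_geometric_converges[OF s G \<rho> K(1)]) (use geoG in \<open>auto simp: dG_def\<close>)
  then have "Lp_converges s ?N G G'" by (intro Lp_convergesI s G)
  moreover obtain q' where "q' \<in> Lp_space s ?M" "(\<lambda>n. Lp_modular s ?M (\<lambda>x. q n x - q' x)) \<longlonglongrightarrow> 0"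
    by (rule Lp_geometric_converges[OF s q \<rho>, of "L * C * K"]) (use geoq L C K in \<open>auto simp: dq_def\<close>)
  then have "Lp_converges s ?M q q'" by (intro Lp_convergesI s q)
  ultimately show ?thesis by blast
qed

end

section \<open>Radial integrals\<close>

lemma prod_Basis_vec: "(\<Prod>b\<in>Basis. f b) = (\<Prod>i\<in>UNIV. f (axis i (1::real) :: real^'n))"
proof -
  have eq: "(Basis :: (real^'n) set) = range (\<lambda>i. axis i 1)" by (auto simp: Basis_vec_def)
  have "inj (\<lambda>i::'n. axis i (1::real))" by (auto simp: inj_on_def axis_eq_axis)
  then show ?thesis unfolding eq by (subst prod.reindex) auto
qed

lemma prod_UNIV_3: "(\<Prod>i\<in>(UNIV :: 3 set). f i) = f 1 * (f 2 * f 3)"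
  unfolding UNIV_3 by (subst prod.insert, simp, simp)+ (simp only: prod.empty mult_1_right)

text \<open>The first coordinate has two uses: it is the height over a plane when the ball is
  sliced, and the ray parameter when a cone is parametrized.\<close>

definition vec3 :: "real \<Rightarrow> real^2 \<Rightarrow> real^3" where
  "vec3 t u = vector [t, u $ 1, u $ 2]"

lemma vec3_nth [simp]: "vec3 t u $ 1 = t" "vec3 t u $ 2 = u $ 1" "vec3 t u $ 3 = u $ 2"
  by (simp_all add: vec3_def vector_3)

lemma norm_vec3: "(norm (vec3 t u))\<^sup>2 = t\<^sup>2 + (norm u)\<^sup>2"
  unfolding power2_norm_eq_inner by (simp add: inner_vec_def sum_3 sum_2 power2_eq_square)

lemma vec3_measurable [measurable]: "(\<lambda>(t, u). vec3 t u) \<in> borel_measurable (borel \<Otimes>\<^sub>M borel)"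
proof -
  have "(\<lambda>(t, u). vec3 t u) = (\<lambda>x. fst x *\<^sub>R axis 1 1 + (snd x $ 1) *\<^sub>R axis 2 1 + (snd x $ 2) *\<^sub>R axis 3 1)"
    by (auto simp: vec_eq_iff forall_3 axis_def)
  also have "\<dots> \<in> borel_measurable (borel \<Otimes>\<^sub>M borel)"
    unfolding borel_prod by (intro borel_measurable_continuous_onI continuous_intros)
  finally show ?thesis .
qed

text \<open>Lebesgue measure is determined by its values on boxes, and the preimage of a box is a
  product of boxes.\<close>

lemma lborel_vec3: "(lborel :: (real^3) measure) = distr (lborel \<Otimes>\<^sub>M lborel) borel (\<lambda>(t, u). vec3 t u)"
proof (rule lborel_eqI)
  have [measurable]: "(\<lambda>(t, u). vec3 t u) \<in> borel_measurable (lborel \<Otimes>\<^sub>M lborel)"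
    using vec3_measurable by (simp cong: measurable_cong_sets)
  fix l u :: "real^3" assume "\<And>b. b \<in> Basis \<Longrightarrow> l \<bullet> b \<le> u \<bullet> b"
  then have lu: "l $ i \<le> u $ i" for i
    by (metis axis_in_Basis_iff inner_axis' inner_commute insertI1 mult.right_neutral real_inner_1_right Basis_real_def)
  let ?l = "vector [l $ 2, l $ 3] :: real^2" and ?u = "vector [u $ 2, u $ 3] :: real^2"
  have "(\<lambda>(t, u). vec3 t u) -` box l u \<inter> space (lborel \<Otimes>\<^sub>M lborel) = box (l $ 1) (u $ 1) \<times> box ?l ?u"
    by (auto simp: mem_box_cart forall_3 forall_2 vector_2 space_pair_measure)
  then have "emeasure (distr (lborel \<Otimes>\<^sub>M lborel) borel (\<lambda>(t, u). vec3 t u)) (box l u) =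
      emeasure (lborel \<Otimes>\<^sub>M lborel) (box (l $ 1) (u $ 1) \<times> box ?l ?u)"
    by (subst emeasure_distr) auto
  also have "\<dots> = emeasure lborel (box (l $ 1) (u $ 1)) * emeasure lborel (box ?l ?u)"
    by (rule lborel.emeasure_pair_measure_Times) auto
  also have "emeasure lborel (box (l $ 1) (u $ 1)) = ennreal (u $ 1 - l $ 1)"
    using lu[of 1] by (simp add: emeasure_lborel_box_eq)
  also have "emeasure lborel (box ?l ?u) = ennreal (\<Prod>b\<in>Basis. (?u - ?l) \<bullet> b)"
  proof (rule emeasure_lborel_box)
    fix b :: "real^2" assume "b \<in> Basis"
    then obtain i where "b = axis i 1" by (auto simp: Basis_vec_def)
    then show "?l \<bullet> b \<le> ?u \<bullet> b"
      using lu[of 2] lu[of 3] exhaust_2[of i] by (auto simp: inner_axis vector_2)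
  qed
  also have "(\<Prod>b\<in>Basis. (?u - ?l) \<bullet> b) = (u $ 2 - l $ 2) * (u $ 3 - l $ 3)"
    unfolding prod_Basis_vec inner_axis by (simp add: UNIV_2 vector_2)
  also have "ennreal (u $ 1 - l $ 1) * ennreal ((u $ 2 - l $ 2) * (u $ 3 - l $ 3)) =
      ennreal (\<Prod>b\<in>Basis. (u - l) \<bullet> b)"
  proof -
    have "(\<Prod>b\<in>Basis. (u - l) \<bullet> b) = (u $ 1 - l $ 1) * ((u $ 2 - l $ 2) * (u $ 3 - l $ 3))"
      unfolding prod_Basis_vec inner_axis prod_UNIV_3 by (simp only: vector_minus_component inner_real_def mult_1_right)
    moreover have "0 \<le> u $ 1 - l $ 1" using lu by simp
    ultimately show ?thesis by (simp only: ennreal_mult')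
  qed
  finally show "emeasure (distr (lborel \<Otimes>\<^sub>M lborel) borel (\<lambda>(t, u). vec3 t u)) (box l u) =
      ennreal (\<Prod>b\<in>Basis. (u - l) \<bullet> b)" .
qed simp

lemma nn_integral_vec3:
  assumes [measurable]: "f \<in> borel_measurable borel"
  shows "(\<integral>\<^sup>+x. f x \<partial>lborel) = (\<integral>\<^sup>+t. (\<integral>\<^sup>+u. f (vec3 t u) \<partial>lborel) \<partial>lborel)"
    and "(\<integral>\<^sup>+x. f x \<partial>lborel) = (\<integral>\<^sup>+u. (\<integral>\<^sup>+t. f (vec3 t u) \<partial>lborel) \<partial>lborel)"
proof -
  have [measurable]: "(\<lambda>(t, u). vec3 t u) \<in> borel_measurable (lborel \<Otimes>\<^sub>M lborel)"
    using vec3_measurable by (simp cong: measurable_cong_sets)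
  have m: "(\<lambda>x. f (case x of (t, u) \<Rightarrow> vec3 t u)) \<in> borel_measurable (lborel \<Otimes>\<^sub>M lborel)" by measurable
  have "(\<integral>\<^sup>+x. f x \<partial>lborel) = (\<integral>\<^sup>+x. f (case x of (t, u) \<Rightarrow> vec3 t u) \<partial>(lborel \<Otimes>\<^sub>M lborel))"
    by (subst lborel_vec3) (simp add: nn_integral_distr)
  with lborel_pair.nn_integral_snd[OF m] lborel.nn_integral_fst[OF m]
  show "(\<integral>\<^sup>+x. f x \<partial>lborel) = (\<integral>\<^sup>+t. (\<integral>\<^sup>+u. f (vec3 t u) \<partial>lborel) \<partial>lborel)"
    "(\<integral>\<^sup>+x. f x \<partial>lborel) = (\<integral>\<^sup>+u. (\<integral>\<^sup>+t. f (vec3 t u) \<partial>lborel) \<partial>lborel)"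
    by simp_all
qed

text \<open>Serves to rotate a unit normal onto the first axis.\<close>

lemma lborel_distr_orthogonal:
  fixes f :: "real^'n::{finite,wellorder} \<Rightarrow> real^'n::_"
  assumes f: "orthogonal_transformation f"
  shows "distr lborel borel f = lborel"
proof (rule lborel_eqI[symmetric])
  have lin: "linear f" using f by (rule orthogonal_transformation_linear)
  then have [measurable]: "f \<in> borel_measurable borel"
    by (intro borel_measurable_continuous_onI linear_continuous_on) (simp add: linear_conv_bounded_linear)
  fix l u :: "real^'n::_" assume lu: "\<And>b. b \<in> Basis \<Longrightarrow> l \<bullet> b \<le> u \<bullet> b"
  have bij: "bij f" using f by (rule orthogonal_transformation_bij)
  have g: "orthogonal_transformation (inv f)" using f by (rule orthogonal_transformation_inv)
  have eq: "f -` box l u = inv f ` box l u" using bij by (simp add: bij_vimage_eq_inv_image)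
  have bx: "box l u \<in> lmeasurable" by simp
  have m: "f -` box l u \<in> lmeasurable" unfolding eq by (rule measurable_orthogonal_image[OF g bx])
  have b: "f -` box l u \<in> sets borel" using measurable_sets[of f borel borel "box l u"] by simp
  have "emeasure (distr lborel borel f) (box l u) = emeasure lborel (f -` box l u)"
    by (subst emeasure_distr) auto
  also have "\<dots> = emeasure lebesgue (f -` box l u)" using b by simp
  also have "\<dots> = ennreal (measure lebesgue (f -` box l u))" by (rule emeasure_eq_measure2[OF m])
  also have "\<dots> = ennreal (measure lebesgue (box l u))"
    unfolding eq by (simp add: measure_orthogonal_image[OF g bx])
  also have "\<dots> = emeasure lborel (box l u)"
    using emeasure_eq_measure2[OF bx] by simp
  also have "\<dots> = ennreal (\<Prod>b\<in>Basis. (u - l) \<bullet> b)" by (rule emeasure_lborel_box[OF lu])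
  finally show "emeasure (distr lborel borel f) (box l u) = ennreal (\<Prod>b\<in>Basis. (u - l) \<bullet> b)" .
qed simp

lemma sets_borel_cball [measurable]: "cball (c :: 'a::metric_space) r \<in> sets borel"
  by simp

text \<open>Both sides are integrals of \<open>\<psi>\<close> with respect to measures on the line that agree on the
  intervals \<open>{..\<tau>}\<close>, by homogeneity of the Lebesgue measure.\<close>

lemma nn_integral_radial:
  fixes h :: "real^3 \<Rightarrow> ennreal" and \<psi> :: "real \<Rightarrow> ennreal"
  assumes [measurable]: "h \<in> borel_measurable borel" "\<psi> \<in> borel_measurable borel"
    and hom: "\<And>c x. 0 < c \<Longrightarrow> h (c *\<^sub>R x) = h x"
    and H: "(\<integral>\<^sup>+x. h x * indicator (cball 0 1) x \<partial>lborel) = ennreal H" "0 \<le> H"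
  shows "(\<integral>\<^sup>+x. \<psi> (norm x) * h x \<partial>lborel) =
    ennreal (3 * H) * (\<integral>\<^sup>+s. \<psi> s * (ennreal (s\<^sup>2) * indicator {0..} s) \<partial>lborel)"
proof -
  let ?A = "distr (density lborel h) borel norm"
  \<comment> \<open>By homogeneity the ball of radius \<open>s\<close> has mass
    \<open>H * s ^ 3\<close>; the density is the derivative of this.\<close>
  let ?B = "density lborel (\<lambda>s. ennreal (3 * H) * (ennreal (s\<^sup>2) * indicator {0..} s))"
  have A: "emeasure ?A {..\<tau>} = (if 0 \<le> \<tau> then ennreal (H * \<tau> ^ 3) else 0)" for \<tau>
  proof -
    have "emeasure ?A {..\<tau>} = (\<integral>\<^sup>+x. h x * indicator (cball 0 \<tau>) x \<partial>lborel)"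
    proof -
      have eq: "norm -` {..\<tau>} = cball (0 :: real^3) \<tau>" by auto
      have "emeasure ?A {..\<tau>} = emeasure (density lborel h) (cball 0 \<tau>)"
        by (subst emeasure_distr) (auto simp: eq)
      then show ?thesis by (simp add: emeasure_density)
    qed
    also have "\<dots> = (if 0 \<le> \<tau> then ennreal (H * \<tau> ^ 3) else 0)"
    proof -
      consider "\<tau> < 0" | "\<tau> = 0" | "0 < \<tau>" by linarith
      then show ?thesis
      proof cases
        case 1
        then show ?thesis by simp
      next
        case 2
        have "(\<integral>\<^sup>+x. h x * indicator (cball 0 \<tau>) x \<partial>lborel) = (\<integral>\<^sup>+x. 0 \<partial>(lborel :: (real^3) measure))"
          by (intro nn_integral_cong_AE AE_I[of _ _ "{0}"]) (auto simp: 2 indicator_def)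
        then show ?thesis using 2 by simp
      next
        case 3
        have "(\<integral>\<^sup>+x. h x * indicator (cball 0 \<tau>) x \<partial>lborel) =
            (\<integral>\<^sup>+x. ennreal (\<bar>\<tau>\<bar> ^ 3) * (h (\<tau> *\<^sub>R x) * indicator (cball 0 \<tau>) (\<tau> *\<^sub>R x)) \<partial>lborel)"
        proof -
          have [measurable]: "(\<lambda>x. h x * indicator (cball 0 \<tau>) x) \<in> borel_measurable borel" by measurable
          have "(\<integral>\<^sup>+x. h x * indicator (cball 0 \<tau>) x \<partial>lborel) =
              (\<integral>\<^sup>+x. h x * indicator (cball 0 \<tau>) x \<partial>density (distr lborel borel (\<lambda>x. 0 + \<tau> *\<^sub>R x)) (\<lambda>_. \<bar>\<tau>\<bar> ^ DIM(real^3)))"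
            using lborel_affine[of \<tau> "0 :: real^3"] 3 by simp
          also have "\<dots> = (\<integral>\<^sup>+x. ennreal (\<bar>\<tau>\<bar> ^ DIM(real^3)) * (h x * indicator (cball 0 \<tau>) x) \<partial>distr lborel borel (\<lambda>x. 0 + \<tau> *\<^sub>R x))"
            by (rule nn_integral_density) measurable
          also have "\<dots> = (\<integral>\<^sup>+x. ennreal (\<bar>\<tau>\<bar> ^ DIM(real^3)) * (h (0 + \<tau> *\<^sub>R x) * indicator (cball 0 \<tau>) (0 + \<tau> *\<^sub>R x)) \<partial>lborel)"
            by (rule nn_integral_distr) measurable
          finally show ?thesis by simp
        qed
        also have "\<dots> = (\<integral>\<^sup>+x. ennreal (\<tau> ^ 3) * (h x * indicator (cball 0 1) x) \<partial>lborel)"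
          using 3 by (intro nn_integral_cong) (auto simp: hom split: split_indicator)
        also have "\<dots> = ennreal (\<tau> ^ 3) * ennreal H"
          using H by (subst nn_integral_cmult) auto
        finally show ?thesis using 3 H(2) by (simp add: mult.commute flip: ennreal_mult)
      qed
    qed
    finally show ?thesis .
  qed
  have B: "emeasure ?B {..\<tau>} = (if 0 \<le> \<tau> then ennreal (H * \<tau> ^ 3) else 0)" for \<tau>
  proof (cases "0 \<le> \<tau>")
    case True
    have "emeasure ?B {..\<tau>} = (\<integral>\<^sup>+s. ennreal (3 * H * s\<^sup>2) * indicator {0..\<tau>} s \<partial>lborel)"
      using H(2) by (auto simp: emeasure_density ennreal_mult mult.assoc intro!: nn_integral_cong split: split_indicator)
    also have "\<dots> = ennreal (H * \<tau> ^ 3 - H * 0 ^ 3)"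
      using True H(2) by (intro nn_integral_FTC_Icc) (auto intro!: derivative_eq_intros)
    finally show ?thesis using True by simp
  next
    case False
    then have z: "ennreal (3 * H) * (ennreal (s\<^sup>2) * indicator {0..} s) * indicator {..\<tau>} s = 0" for s
      by (auto split: split_indicator)
    have "emeasure ?B {..\<tau>} = 0"
      by (subst emeasure_density) (measurable, unfold z, simp)
    then show ?thesis using False by simp
  qed
  have AB: "?A = ?B"
  proof (rule measure_eqI_generator_eq[where E = "range atMost" and \<Omega> = UNIV and A = "\<lambda>i. {..real i}"])
    show "Int_stable (range (atMost :: real \<Rightarrow> _))" by (auto simp: Int_stable_def)
    show "sets ?A = sigma_sets UNIV (range atMost)" "sets ?B = sigma_sets UNIV (range atMost)"
      by (simp_all add: borel_eq_atMost sets_measure_of)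
    show "(\<Union>i. {..real i}) = UNIV" by (auto simp: real_arch_simple)
    show "emeasure ?A X = emeasure ?B X" if "X \<in> range atMost" for X
      using that A B by auto
    show "emeasure ?A {..real i} \<noteq> \<infinity>" for i by (simp add: A)
  qed auto
  have "(\<integral>\<^sup>+x. \<psi> (norm x) * h x \<partial>lborel) = (\<integral>\<^sup>+s. \<psi> s \<partial>?A)"
    by (simp add: nn_integral_distr nn_integral_density mult.commute)
  also have "\<dots> = (\<integral>\<^sup>+s. ennreal (3 * H) * (\<psi> s * (ennreal (s\<^sup>2) * indicator {0..} s)) \<partial>lborel)"
    unfolding AB by (simp add: nn_integral_density mult_ac)
  also have "\<dots> = ennreal (3 * H) * (\<integral>\<^sup>+s. \<psi> s * (ennreal (s\<^sup>2) * indicator {0..} s) \<partial>lborel)"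
    by (intro nn_integral_cmult) measurable
  finally show ?thesis .
qed

section \<open>Total mass of the exponential decay\<close>

lemma nn_integral_cball_1: "(\<integral>\<^sup>+x. 1 * indicator (cball 0 1) x \<partial>(lborel :: (real^3) measure)) = ennreal (4/3 * pi)"
proof -
  have "emeasure lborel (cball (0::real^3) 1) = ennreal (4/3 * pi)"
    by (subst emeasure_cball) (auto simp: unit_ball_vol_3)
  then show ?thesis by simp
qed

lemma borel_measurable_vec_nth [measurable (raw)]:
  fixes f :: "'a \<Rightarrow> real^'n"
  assumes "f \<in> borel_measurable M"
  shows "(\<lambda>x. f x $ i) \<in> borel_measurable M"
proof -
  have "(\<lambda>x::real^'n. x $ i) \<in> borel_measurable borel"
    by (intro borel_measurable_continuous_onI continuous_intros)
  from measurable_compose[OF assms this] show ?thesis .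
qed

text \<open>After a rotation, the unknown value \<open>H\<close> is found by integrating the
  positive part of the first coordinate over the unit ball in two ways. Radially, with the factor
  \<open>norm x\<close> as \<open>\<psi>\<close>, the result is 3/4 of \<open>H\<close>. Slicing
  into discs of area \<open>pi * (1 - t\<^sup>2)\<close> at height \<open>t\<close> gives
  \<open>pi / 4\<close>.\<close>

lemma nn_integral_cball_cos:
  fixes n :: "real^3"
  assumes n: "norm n = 1"
  shows "(\<integral>\<^sup>+x. ennreal (max 0 ((x \<bullet> n) / norm x)) * indicator (cball 0 1) x \<partial>lborel) = ennreal (pi / 3)"
proof -
  let ?h = "\<lambda>x :: real^3. ennreal (max 0 (x $ 1 / norm x))"
  obtain f :: "real^3 \<Rightarrow> real^3" where f: "orthogonal_transformation f" "f n = axis 1 1"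
    by (rule orthogonal_transformation_exists[of n "axis 1 1"]) (auto simp: n)
  have [measurable]: "f \<in> borel_measurable borel"
    using orthogonal_transformation_linear[OF f(1)]
    by (intro borel_measurable_continuous_onI linear_continuous_on) (simp add: linear_conv_bounded_linear)
  have dot: "x \<bullet> n = f x $ 1" for x
  proof -
    have "x \<bullet> n = f x \<bullet> f n" using f(1) by (simp add: orthogonal_transformation_def)
    then show ?thesis by (simp add: f inner_axis)
  qed
  have nf: "norm (f x) = norm x" for x using f(1) by (simp add: orthogonal_transformation_norm)
  have "(\<integral>\<^sup>+x. ennreal (max 0 ((x \<bullet> n) / norm x)) * indicator (cball 0 1) x \<partial>lborel) =
      (\<integral>\<^sup>+x. ?h (f x) * indicator (cball 0 1) (f x) \<partial>lborel)"
    by (intro nn_integral_cong) (simp add: dot nf indicator_def)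
  also have "\<dots> = (\<integral>\<^sup>+x. ?h x * indicator (cball 0 1) x \<partial>distr lborel borel f)"
    by (subst nn_integral_distr) auto
  also have "\<dots> = (\<integral>\<^sup>+x. ?h x * indicator (cball 0 1) x \<partial>lborel)"
    by (simp add: lborel_distr_orthogonal[OF f(1)])
  finally have eq: "(\<integral>\<^sup>+x. ennreal (max 0 ((x \<bullet> n) / norm x)) * indicator (cball 0 1) x \<partial>lborel) =
      (\<integral>\<^sup>+x. ?h x * indicator (cball 0 1) x \<partial>lborel)" .
  \<comment> \<open>Comparison with the volume of the ball shows that the integral is finite, so
    that the final equation can be solved for it.\<close>
  have "x $ 1 / norm x \<le> 1" for x :: "real^3"
    using component_le_norm_cart[of x 1] by (auto simp: divide_le_eq)
  then have "(\<integral>\<^sup>+x. ?h x * indicator (cball 0 1) x \<partial>lborel) \<le> (\<integral>\<^sup>+x. 1 * indicator (cball 0 1) x \<partial>(lborel :: (real^3) measure))"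
    by (intro nn_integral_mono mult_right_mono) (auto simp flip: ennreal_1 intro!: ennreal_leI)
  then obtain H where H: "0 \<le> H" "(\<integral>\<^sup>+x. ?h x * indicator (cball 0 1) x \<partial>lborel) = ennreal H"
    unfolding nn_integral_cball_1
    by (cases "\<integral>\<^sup>+x. ?h x * indicator (cball 0 1) x \<partial>lborel") (auto simp: top_unique)
  let ?\<psi> = "\<lambda>s::real. ennreal s * indicator {0..1} s"
  have "(\<integral>\<^sup>+x. ?\<psi> (norm x) * ?h x \<partial>lborel) =
      ennreal (3 * H) * (\<integral>\<^sup>+s. ?\<psi> s * (ennreal (s\<^sup>2) * indicator {0..} s) \<partial>lborel)"
    by (rule nn_integral_radial[OF _ _ _ H(2,1)]) auto
  also have "(\<integral>\<^sup>+s. ?\<psi> s * (ennreal (s\<^sup>2) * indicator {0..} s) \<partial>lborel) =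
      (\<integral>\<^sup>+s. ennreal (s ^ 3) * indicator {0..1} s \<partial>lborel)"
    by (intro nn_integral_cong) (auto simp: power2_eq_square power3_eq_cube mult.assoc split: split_indicator simp flip: ennreal_mult)
  also have "\<dots> = ennreal (1 ^ 4 / 4 - 0 ^ 4 / 4)"
    by (intro nn_integral_FTC_Icc) (auto intro!: derivative_eq_intros)
  also have "ennreal (3 * H) * \<dots> = ennreal (3 / 4 * H)" using H by (simp flip: ennreal_mult)
  finally have lhs: "(\<integral>\<^sup>+x. ?\<psi> (norm x) * ?h x \<partial>lborel) = ennreal (3 / 4 * H)" .
  have "(\<integral>\<^sup>+x. ?\<psi> (norm x) * ?h x \<partial>lborel) =
      (\<integral>\<^sup>+t. (\<integral>\<^sup>+u. ?\<psi> (norm (vec3 t u)) * ?h (vec3 t u) \<partial>lborel) \<partial>lborel)"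
    by (rule nn_integral_vec3) measurable
  also have "\<dots> = (\<integral>\<^sup>+t. ennreal (t * pi * (1 - t\<^sup>2)) * indicator {0..1} t \<partial>lborel)"
  proof (rule nn_integral_cong)
    fix t :: real
    have pt: "?\<psi> (norm (vec3 t u)) * ?h (vec3 t u) = ennreal (max 0 t) * indicator {u. t\<^sup>2 + (norm u)\<^sup>2 \<le> 1} u" for u
    proof -
      have "norm (vec3 t u) \<le> 1 \<longleftrightarrow> t\<^sup>2 + (norm u)\<^sup>2 \<le> 1"
        unfolding norm_vec3[symmetric] using abs_square_le_1[of "norm (vec3 t u)"] by simp
      moreover have "norm (vec3 t u) * max 0 (t / norm (vec3 t u)) = max 0 t"
      proof (cases "vec3 t u = 0")
        case True
        then show ?thesis using vec3_nth(1)[of t u] by simp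
      qed (simp add: max_def field_simps zero_le_divide_iff)
      moreover have "ennreal (norm (vec3 t u)) * ?h (vec3 t u) =
          ennreal (norm (vec3 t u) * max 0 (t / norm (vec3 t u)))"
        unfolding vec3_nth by (simp only: ennreal_mult' norm_ge_zero)
      ultimately show ?thesis by (simp add: indicator_def)
    qed
    have "(\<integral>\<^sup>+u. ?\<psi> (norm (vec3 t u)) * ?h (vec3 t u) \<partial>lborel) =
        ennreal (max 0 t) * emeasure lborel {u :: real^2. t\<^sup>2 + (norm u)\<^sup>2 \<le> 1}"
      unfolding pt by (subst nn_integral_cmult_indicator) auto
    also have "\<dots> = ennreal (t * pi * (1 - t\<^sup>2)) * indicator {0..1} t"
    proof (cases "0 \<le> t \<and> t \<le> 1")
      case True
      then have t1: "t\<^sup>2 \<le> 1" by (simp add: power_le_one)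
      have "{u :: real^2. t\<^sup>2 + (norm u)\<^sup>2 \<le> 1} = cball 0 (sqrt (1 - t\<^sup>2))"
      proof -
        have "t\<^sup>2 + (norm u)\<^sup>2 \<le> 1 \<longleftrightarrow> u \<in> cball 0 (sqrt (1 - t\<^sup>2))" for u :: "real^2"
        proof -
          have "norm u \<le> sqrt (1 - t\<^sup>2) \<longleftrightarrow> (norm u)\<^sup>2 \<le> 1 - t\<^sup>2"
            using real_sqrt_le_iff[of "(norm u)\<^sup>2" "1 - t\<^sup>2"] by simp
          then show ?thesis unfolding mem_cball dist_0_norm by linarith
        qed
        then show ?thesis by blast
      qed
      then have "emeasure lborel {u :: real^2. t\<^sup>2 + (norm u)\<^sup>2 \<le> 1} = ennreal (pi * (1 - t\<^sup>2))"
        using t1 by (simp add: emeasure_cball unit_ball_vol_2)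
      then show ?thesis using True t1 by (simp add: mult.assoc flip: ennreal_mult)
    next
      case False
      then consider "t < 0" | "1 < t" by linarith
      then show ?thesis
      proof cases
        case 2
        then have "1 < t\<^sup>2" by (simp add: one_less_power)
        then have "{u :: real^2. t\<^sup>2 + (norm u)\<^sup>2 \<le> 1} = {}"
        proof -
          have "1 < t\<^sup>2 + (norm u)\<^sup>2" for u :: "real^2"
            using \<open>1 < t\<^sup>2\<close> zero_le_power2[of "norm u"] by linarith
          then show ?thesis by (auto simp: not_le)
        qed
        then show ?thesis using 2 by simp
      qed simp
    qed
    finally show "(\<integral>\<^sup>+u. ?\<psi> (norm (vec3 t u)) * ?h (vec3 t u) \<partial>lborel) =
        ennreal (t * pi * (1 - t\<^sup>2)) * indicator {0..1} t" .
  qed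
  also have "\<dots> = ennreal (pi * (1\<^sup>2 / 2 - 1 ^ 4 / 4) - pi * (0\<^sup>2 / 2 - 0 ^ 4 / 4))"
  proof (rule nn_integral_FTC_Icc[where F = "\<lambda>t. pi * (t\<^sup>2 / 2 - t ^ 4 / 4)"])
    fix t :: real
    show "((\<lambda>t. pi * (t\<^sup>2 / 2 - t ^ 4 / 4)) has_real_derivative t * pi * (1 - t\<^sup>2)) (at t)"
      by (auto intro!: derivative_eq_intros simp: algebra_simps power2_eq_square power3_eq_cube)
    show "0 \<le> t * pi * (1 - t\<^sup>2)" if "t \<in> {0..1}"
      using that power_le_one[of t 2] by simp
  qed auto
  finally have "3 / 4 * H = pi / 4" using lhs H(1) by simp
  then show ?thesis using eq H by simp
qed

lemma nn_integral_lborel_translate: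
  fixes p :: "'a::euclidean_space"
  assumes [measurable]: "f \<in> borel_measurable borel"
  shows "(\<integral>\<^sup>+x. f (x - p) \<partial>lborel) = (\<integral>\<^sup>+x. f x \<partial>lborel)"
proof -
  have "(\<integral>\<^sup>+x. f x \<partial>lborel) = (\<integral>\<^sup>+x. f x \<partial>distr lborel borel ((+) (- p)))"
    by (simp add: lborel_distr_plus)
  also have "\<dots> = (\<integral>\<^sup>+x. f (- p + x) \<partial>lborel)"
    by (subst nn_integral_distr) auto
  finally show ?thesis by simp
qed

text \<open>Normalized such that \<open>\<integral> decay \<beta> (t z) t\<^sup>2 dt = 1\<close> over \<open>t > 0\<close> for every unit vector \<open>z\<close>.\<close>

definition decay :: "real \<Rightarrow> real^3 \<Rightarrow> real" where
  "decay \<beta> z = \<beta> * exp (- \<beta> * norm z) / (norm z)\<^sup>2"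

lemma decay_nonneg: "0 \<le> \<beta> \<Longrightarrow> 0 \<le> decay \<beta> z"
  by (simp add: decay_def)

lemma decay_measurable [measurable]: "decay \<beta> \<in> borel_measurable borel"
  unfolding decay_def[abs_def] by measurable

text \<open>Radial integration contributes \<open>s\<^sup>2\<close>, which cancels the denominator
  of \<open>decay\<close>. What is left is the exponential density, with mass 1 on the half-line and
  \<open>1 - exp (- \<beta> * D)\<close> up to \<open>D\<close>. The constant \<open>3 * H\<close>
  is the integral of \<open>h\<close> over the unit sphere.\<close>

lemma nn_integral_decay:
  fixes h :: "real^3 \<Rightarrow> ennreal"
  assumes \<beta>: "0 < \<beta>" and [measurable]: "h \<in> borel_measurable borel"
    and hom: "\<And>c x. 0 < c \<Longrightarrow> h (c *\<^sub>R x) = h x"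
    and H: "(\<integral>\<^sup>+x. h x * indicator (cball 0 1) x \<partial>lborel) = ennreal H" "0 \<le> H"
  shows "(\<integral>\<^sup>+x. ennreal (decay \<beta> (x - p)) * h (x - p) \<partial>lborel) = ennreal (3 * H)"
    and "0 \<le> D \<Longrightarrow> (\<integral>\<^sup>+x. ennreal (decay \<beta> (x - p)) * h (x - p) * indicator (cball p D) x \<partial>lborel) =
      ennreal (3 * H * (1 - exp (- \<beta> * D)))"
proof -
  let ?g = "\<lambda>s. \<beta> * exp (- \<beta> * s)"
  let ?\<psi> = "\<lambda>s::real. ennreal (?g s / s\<^sup>2)"
  have radial: "(\<integral>\<^sup>+x. ?\<psi> (norm x) * indicator I (norm x) * h x \<partial>lborel) =
      ennreal (3 * H) * (\<integral>\<^sup>+s. ennreal (?g s) * indicator (I \<inter> {0..}) s \<partial>lborel)"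
    if [measurable]: "I \<in> sets borel" for I
  proof -
    have "(\<integral>\<^sup>+x. (\<lambda>s. ?\<psi> s * indicator I s) (norm x) * h x \<partial>lborel) =
        ennreal (3 * H) * (\<integral>\<^sup>+s. (?\<psi> s * indicator I s) * (ennreal (s\<^sup>2) * indicator {0..} s) \<partial>lborel)"
      by (rule nn_integral_radial[OF _ _ hom H]) auto
    also have "(\<integral>\<^sup>+s. (?\<psi> s * indicator I s) * (ennreal (s\<^sup>2) * indicator {0..} s) \<partial>lborel) =
        (\<integral>\<^sup>+s. ennreal (?g s) * indicator (I \<inter> {0..}) s \<partial>lborel)"
    \<comment> \<open>At \<open>s = 0\<close> division yields 0 and the cancellation fails; a single
      point is negligible.\<close>
    proof (intro nn_integral_cong_AE AE_I[of _ _ "{0}"])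
      have "(?\<psi> s * indicator I s) * (ennreal (s\<^sup>2) * indicator {0..} s) =
          ennreal (?g s) * indicator (I \<inter> {0..}) s" if "s \<noteq> 0" for s
      proof -
        have "?\<psi> s * ennreal (s\<^sup>2) = ennreal (?g s)"
          using that \<beta> by (simp flip: ennreal_mult)
        then show ?thesis by (simp add: indicator_def)
      qed
      then show "{s \<in> space lborel. (?\<psi> s * indicator I s) * (ennreal (s\<^sup>2) * indicator {0..} s) \<noteq>
          ennreal (?g s) * indicator (I \<inter> {0..}) s} \<subseteq> {0}" by auto
    qed auto
    finally show ?thesis .
  qed
  have deriv: "((\<lambda>s. - exp (- \<beta> * s)) has_real_derivative ?g s) (at s)" for s
    by (auto intro!: derivative_eq_intros)
  have "(\<integral>\<^sup>+x. ennreal (decay \<beta> (x - p)) * h (x - p) \<partial>lborel) =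
      (\<integral>\<^sup>+x. ?\<psi> (norm x) * indicator UNIV (norm x) * h x \<partial>lborel)"
    using nn_integral_lborel_translate[of "\<lambda>x. ennreal (decay \<beta> x) * h x" p] by (simp add: decay_def)
  also have "\<dots> = ennreal (3 * H) * (\<integral>\<^sup>+s. ennreal (?g s) * indicator {0..} s \<partial>lborel)"
    by (subst radial) auto
  also have "(\<integral>\<^sup>+s. ennreal (?g s) * indicator {0..} s \<partial>lborel) = ennreal (0 - (- exp (- \<beta> * 0)))"
  proof (rule nn_integral_FTC_atLeast[OF _ deriv])
    show "((\<lambda>s. - exp (- \<beta> * s)) \<longlongrightarrow> 0) at_top" using \<beta> by real_asymp
  qed (use \<beta> in auto)
  finally show "(\<integral>\<^sup>+x. ennreal (decay \<beta> (x - p)) * h (x - p) \<partial>lborel) = ennreal (3 * H)" by simp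
  show "(\<integral>\<^sup>+x. ennreal (decay \<beta> (x - p)) * h (x - p) * indicator (cball p D) x \<partial>lborel) =
      ennreal (3 * H * (1 - exp (- \<beta> * D)))" if D: "0 \<le> D"
  proof -
    have "(\<integral>\<^sup>+x. ennreal (decay \<beta> (x - p)) * h (x - p) * indicator (cball p D) x \<partial>lborel) =
        (\<integral>\<^sup>+x. ennreal (decay \<beta> (x - p)) * h (x - p) * indicator {..D} (norm (x - p)) \<partial>lborel)"
      by (intro nn_integral_cong) (auto simp: indicator_def dist_norm norm_minus_commute)
    also have "\<dots> = (\<integral>\<^sup>+x. ?\<psi> (norm x) * indicator {..D} (norm x) * h x \<partial>lborel)"
      using nn_integral_lborel_translate[of "\<lambda>x. ennreal (decay \<beta> x) * h x * indicator {..D} (norm x)" p]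
      by (simp add: decay_def mult_ac)
    also have "\<dots> = ennreal (3 * H) * (\<integral>\<^sup>+s. ennreal (?g s) * indicator {0..D} s \<partial>lborel)"
      by (subst radial) (auto simp: atLeastAtMost_def Int_commute)
    also have "(\<integral>\<^sup>+s. ennreal (?g s) * indicator {0..D} s \<partial>lborel) = ennreal (- exp (- \<beta> * D) - (- exp (- \<beta> * 0)))"
      using D \<beta> by (intro nn_integral_FTC_Icc deriv) auto
    finally show ?thesis using H by (simp add: ennreal_mult')
  qed
qed

lemma nn_integral_decay_total:
  assumes "0 < \<beta>"
  shows "(\<integral>\<^sup>+x. ennreal (decay \<beta> (x - p)) \<partial>lborel) = ennreal (4 * pi)"
    and "0 \<le> D \<Longrightarrow> (\<integral>\<^sup>+x. ennreal (decay \<beta> (x - p)) * indicator (cball p D) x \<partial>lborel) =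
      ennreal (4 * pi * (1 - exp (- \<beta> * D)))"
  using nn_integral_decay[where h = "\<lambda>_. 1", OF assms _ _ nn_integral_cball_1] by auto

text \<open>Stated as an inequality in order to include the conventional normal 0 at points that are
  not smooth.\<close>

lemma nn_integral_decay_cos_le:
  fixes n :: "real^3"
  assumes "0 < \<beta>" "norm n = 1 \<or> n = 0"
  shows "(\<integral>\<^sup>+x. ennreal (decay \<beta> (x - p) * max 0 (((p - x) \<bullet> n) / norm (p - x))) \<partial>lborel) \<le> ennreal pi"
proof (cases "n = 0")
  case False
  let ?h = "\<lambda>z. ennreal (max 0 ((z \<bullet> (- n)) / norm z))"
  have n: "norm (- n) = 1" using assms False by simp
  have "(\<integral>\<^sup>+x. ennreal (decay \<beta> (x - p)) * ?h (x - p) \<partial>lborel) = ennreal (3 * (pi / 3))"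
    by (rule nn_integral_decay(1)[OF assms(1) _ _ nn_integral_cball_cos[OF n]]) auto
  moreover have "ennreal (decay \<beta> (x - p) * max 0 (((p - x) \<bullet> n) / norm (p - x))) =
      ennreal (decay \<beta> (x - p)) * ?h (x - p)" for x
  proof -
    have "(p - x) \<bullet> n = (x - p) \<bullet> (- n)" by (simp add: algebra_simps)
    then show ?thesis
      using decay_nonneg[of \<beta> "x - p"] assms(1) by (simp add: norm_minus_commute ennreal_mult)
  qed
  ultimately show ?thesis by simp
qed simp

section \<open>Normals and visibility\<close>

lemma GDERIV_along_line:
  assumes "GDERIV g x :> D"
  shows "((\<lambda>t. g (x + t *\<^sub>R v)) has_real_derivative (v \<bullet> D)) (at 0)"
proof -
  have g: "(g has_derivative (\<lambda>h. h \<bullet> D)) (at (x + 0 *\<^sub>R v))" using assms by (simp add: gderiv_def)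
  have "((\<lambda>t. x + t *\<^sub>R v) has_derivative (\<lambda>h. h *\<^sub>R v)) (at 0)"
    by (auto intro!: derivative_eq_intros)
  from diff_chain_at[OF this g] show ?thesis
    by (simp add: o_def has_field_derivative_def mult.commute[of "v \<bullet> D"] cong: if_cong)
       (simp add: mult_commute_abs)
qed

text \<open>The sign of the directional derivative of \<open>g\<close> decides on which side of the
  boundary a ray from \<open>x\<close> starts. Both the uniqueness of the normal and the sign of the
  cosines rest on this.\<close>

lemma local_defining_function_sign:
  assumes ldf: "local_defining_function V x U g g'" and x: "x \<in> frontier V"
  shows "v \<bullet> g' x < 0 \<Longrightarrow> eventually (\<lambda>t. x + t *\<^sub>R v \<in> V) (at_right 0)"
    and "0 < v \<bullet> g' x \<Longrightarrow> eventually (\<lambda>t. x + t *\<^sub>R v \<notin> V) (at_right 0)"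
proof -
  have U: "open U" "x \<in> U" and der: "GDERIV g x :> g' x"
    and V: "V \<inter> U = {y \<in> U. g y < 0}" and F: "frontier V \<inter> U = {y \<in> U. g y = 0}"
    using ldf unfolding local_defining_function_def by auto
  have g0: "g x = 0" using F x U by blast
  have V': "y \<in> V \<longleftrightarrow> g y < 0" if "y \<in> U" for y using V that by blast
  let ?f = "\<lambda>t. g (x + t *\<^sub>R v)"
  have d: "DERIV ?f 0 :> v \<bullet> g' x" by (rule GDERIV_along_line[OF der])
  have "((\<lambda>t. x + t *\<^sub>R v) \<longlongrightarrow> x + 0 *\<^sub>R v) (at_right 0)" by (intro tendsto_intros)
  then have inU: "eventually (\<lambda>t. x + t *\<^sub>R v \<in> U) (at_right 0)"
    using topological_tendstoD[OF _ U(1)] U(2) by auto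
  show "eventually (\<lambda>t. x + t *\<^sub>R v \<in> V) (at_right 0)" if neg: "v \<bullet> g' x < 0"
  proof -
    obtain e where e: "0 < e" "\<And>h. 0 < h \<Longrightarrow> h < e \<Longrightarrow> ?f h < 0"
      using DERIV_neg_dec_right[OF d neg] g0 by auto
    have "eventually (\<lambda>t. ?f t < 0) (at_right 0)"
      using eventually_at_right_real[OF e(1)] by eventually_elim (use e(2) in auto)
    with inU show ?thesis by eventually_elim (use V' in auto)
  qed
  show "eventually (\<lambda>t. x + t *\<^sub>R v \<notin> V) (at_right 0)" if pos: "0 < v \<bullet> g' x"
  proof -
    obtain e where e: "0 < e" "\<And>h. 0 < h \<Longrightarrow> h < e \<Longrightarrow> 0 < ?f h"
      using DERIV_pos_inc_right[OF d pos] g0 by auto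
    have "eventually (\<lambda>t. 0 < ?f t) (at_right 0)"
      using eventually_at_right_real[OF e(1)] by eventually_elim (use e(2) in auto)
    with inU show ?thesis by eventually_elim (use V' in auto)
  qed
qed

text \<open>If the unit gradients \<open>a\<close> and \<open>b\<close> differed, then
  \<open>a \<bullet> b < 1\<close>, and the direction \<open>b - a\<close> would lead into
  \<open>V\<close> according to \<open>g\<close> and out of \<open>V\<close> according to
  \<open>h\<close>.\<close>

lemma local_defining_function_gradient_unique:
  assumes "local_defining_function V x U g g'" "local_defining_function V x W h h'" "x \<in> frontier V"
  shows "g' x /\<^sub>R norm (g' x) = h' x /\<^sub>R norm (h' x)"
proof (rule ccontr)
  define a b where "a = g' x /\<^sub>R norm (g' x)" and "b = h' x /\<^sub>R norm (h' x)"
  assume "g' x /\<^sub>R norm (g' x) \<noteq> h' x /\<^sub>R norm (h' x)"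
  then have ab: "a \<noteq> b" by (simp add: a_def b_def)
  have nz: "g' x \<noteq> 0" "h' x \<noteq> 0" using assms(1,2) by (auto simp: local_defining_function_def)
  then have n: "norm a = 1" "norm b = 1" by (simp_all add: a_def b_def)
  have "a \<bullet> b < 1"
  proof -
    have "0 < (a - b) \<bullet> (a - b)" using ab by simp
    also have "\<dots> = 2 - 2 * (a \<bullet> b)"
      using n by (simp add: inner_diff_left inner_diff_right inner_commute norm_eq_1)
    finally show ?thesis by simp
  qed
  then have "(b - a) \<bullet> a < 0" "0 < (b - a) \<bullet> b"
    using n by (simp_all add: inner_diff_left norm_eq_1 inner_commute[of b a])
  moreover have "(b - a) \<bullet> a = ((b - a) \<bullet> g' x) / norm (g' x)" "(b - a) \<bullet> b = ((b - a) \<bullet> h' x) / norm (h' x)"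
    by (simp_all add: a_def b_def divide_inverse mult.commute)
  ultimately have "(b - a) \<bullet> g' x < 0" "0 < (b - a) \<bullet> h' x"
    using nz by (simp_all add: divide_less_0_iff zero_less_divide_iff)
  then have "eventually (\<lambda>t. x + t *\<^sub>R (b - a) \<in> V) (at_right 0)"
    "eventually (\<lambda>t. x + t *\<^sub>R (b - a) \<notin> V) (at_right 0)"
    using local_defining_function_sign assms by blast+
  then have "eventually (\<lambda>t::real. False) (at_right 0)" by eventually_elim simp
  then show False by simp
qed

lemma outward_normal_eq:
  assumes "local_defining_function V x U g g'" "x \<in> frontier V"
  shows "outward_normal V x = g' x /\<^sub>R norm (g' x)"
proof -
  have "smooth_boundary_point V x" using assms by (auto simp: smooth_boundary_point_def)
  moreover have "(THE n. \<exists>U g g'. local_defining_function V x U g g' \<and> n = g' x /\<^sub>R norm (g' x)) = g' x /\<^sub>R norm (g' x)"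
    using assms(1) local_defining_function_gradient_unique[OF _ _ assms(2)] by (intro the_equality) blast+
  ultimately show ?thesis by (simp add: outward_normal_def)
qed

lemma norm_outward_normal: "norm (outward_normal V x) = 1 \<or> outward_normal V x = 0"
proof (cases "smooth_boundary_point V x")
  case True
  then obtain U g g' where "local_defining_function V x U g g'" "x \<in> frontier V"
    by (auto simp: smooth_boundary_point_def)
  with outward_normal_eq[OF this] show ?thesis by (auto simp: local_defining_function_def)
qed (simp add: outward_normal_def)

text \<open>The segment stays in \<open>V\<close> near \<open>p\<close>, so \<open>r - p\<close>
  cannot point outwards there. This is why the kernels are nonnegative although a cosine alone can
  have either sign.\<close>

lemma incidence_cos_nonneg:
  assumes vis: "open_segment p r \<subseteq> V"
  shows "0 \<le> incidence_cos V p r"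
proof (cases "p \<noteq> r \<and> smooth_boundary_point V p")
  case False
  then show ?thesis by (auto simp: incidence_cos_def outward_normal_def)
next
  case True
  then obtain U g g' where ldf: "local_defining_function V p U g g'" "p \<in> frontier V"
    by (auto simp: smooth_boundary_point_def)
  have "\<not> 0 < (r - p) \<bullet> g' p"
  proof
    assume "0 < (r - p) \<bullet> g' p"
    then have "eventually (\<lambda>t. p + t *\<^sub>R (r - p) \<notin> V) (at_right 0)"
      by (rule local_defining_function_sign(2)[OF ldf])
    moreover have "eventually (\<lambda>t::real. t \<in> {0<..<1}) (at_right 0)"
      by (rule eventually_at_right_real) simp
    ultimately have "eventually (\<lambda>t::real. False) (at_right 0)"
    proof eventually_elim
      case (elim t)
      have "p + t *\<^sub>R (r - p) = (1 - t) *\<^sub>R p + t *\<^sub>R r" by (simp add: algebra_simps)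
      then have "p + t *\<^sub>R (r - p) \<in> open_segment p r"
        using elim(2) True by (auto simp: in_segment)
      with vis elim(1) show ?case by blast
    qed
    then show False by simp
  qed
  then have "0 \<le> (p - r) \<bullet> g' p" by (simp add: inner_diff_left)
  then show ?thesis by (simp add: incidence_cos_def outward_normal_eq[OF ldf])
qed

text \<open>A defining function at one point serves at every frontier point of its domain. So the
  smooth points are relatively open in the closed frontier, and on them the normal is locally a
  normalized continuous gradient.\<close>

lemma outward_normal_measurable [measurable]: "outward_normal V \<in> borel_measurable borel"
proof -
  let ?n = "outward_normal V" and ?S = "{x. smooth_boundary_point V x}"
  define Q where "Q = {U. \<exists>x g g'. local_defining_function V x U g g'}"
  have loc: "local_defining_function V y U g g'" if "local_defining_function V x U g g'" "y \<in> U" for x y U g g'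
    using that unfolding local_defining_function_def by auto
  have S: "?S = frontier V \<inter> \<Union>Q"
  proof (intro equalityI subsetI)
    fix y assume "y \<in> frontier V \<inter> \<Union>Q"
    then obtain x U g g' where "y \<in> frontier V" "y \<in> U" "local_defining_function V x U g g'"
      by (auto simp: Q_def)
    then have "local_defining_function V y U g g'" by (auto intro: loc)
    then show "y \<in> ?S" using \<open>y \<in> frontier V\<close> unfolding smooth_boundary_point_def by blast
  qed (auto simp: smooth_boundary_point_def Q_def local_defining_function_def)
  have "open (\<Union>Q)" by (auto simp: Q_def local_defining_function_def)
  then have meas: "?S \<in> sets borel" unfolding S by auto
  have "continuous_on ?S ?n"
    unfolding continuous_on_def
  proof
    fix x assume "x \<in> ?S"
    then obtain U g g' where ldf: "local_defining_function V x U g g'" and x: "x \<in> frontier V"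
      by (auto simp: smooth_boundary_point_def)
    have U: "open U" "x \<in> U" "continuous_on U g'" "g' x \<noteq> 0"
      using ldf by (auto simp: local_defining_function_def)
    have "(g' \<longlongrightarrow> g' x) (at x within ?S)"
      using continuous_on_interior[OF U(3)] U(1,2) interior_open[OF U(1)]
      by (simp add: continuous_within isCont_def tendsto_within_subset[of _ _ _ UNIV])
    then have "((\<lambda>y. g' y /\<^sub>R norm (g' y)) \<longlongrightarrow> g' x /\<^sub>R norm (g' x)) (at x within ?S)"
      using U(4) by (intro tendsto_intros) auto
    moreover have "eventually (\<lambda>y. g' y /\<^sub>R norm (g' y) = ?n y) (at x within ?S)"
    proof -
      have "eventually (\<lambda>y. y \<in> U) (at x within ?S)"
        using U(1,2) by (auto simp: eventually_at_topological)
      moreover have "eventually (\<lambda>y. y \<in> ?S) (at x within ?S)"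
        by (simp add: eventually_at_filter)
      ultimately show ?thesis
      proof eventually_elim
        case (elim y)
        then have "y \<in> frontier V" by (simp add: smooth_boundary_point_def)
        then show ?case using outward_normal_eq[OF loc[OF ldf elim(1)]] by simp
      qed
    qed
    ultimately show "(?n \<longlongrightarrow> ?n x) (at x within ?S)"
      unfolding outward_normal_eq[OF ldf x] by (rule Lim_transform_eventually)
  qed
  from borel_measurable_continuous_on_indicator[OF meas this]
  show ?thesis
  proof (rule back_subst[of "\<lambda>f. f \<in> borel_measurable borel"])
    show "(\<lambda>x. indicator ?S x *\<^sub>R ?n x) = ?n"
      by (auto simp: fun_eq_iff indicator_def outward_normal_def)
  qed
qed

section \<open>Visibility and its relation to the parametrized surface\<close>

lemma open_segment_sub_iff:
  "open_segment p r \<subseteq> V \<longleftrightarrow> p = r \<or> (\<forall>t\<in>{0<..<1}. p + t *\<^sub>R (r - p) \<in> V)"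
proof -
  have eq: "(1 - t) *\<^sub>R p + t *\<^sub>R r = p + t *\<^sub>R (r - p)" for t by (simp add: algebra_simps)
  show ?thesis by (auto simp: subset_iff in_segment eq)
qed

text \<open>The parameter interval (0,1) is exhausted by the compact intervals \<open>I m\<close>.
  The pairs blocked at some parameter in \<open>I m\<close> form a closed set, being the projection
  of a closed set along a compact one. The diagonal is added separately because its open segments
  are empty.\<close>

lemma visible_pairs_borel:
  fixes V :: "(real^3) set"
  assumes V: "open V"
  shows "{(p, r). open_segment p r \<subseteq> V} \<in> sets (borel \<Otimes>\<^sub>M borel)"
proof -
  define I where "I m = {1 / real (m + 2) .. 1 - 1 / real (m + 2)}" for m
  define C where "C m = {z. \<exists>t. t \<in> I m \<and> (t, z) \<in> (\<lambda>(t, p, r). p + t *\<^sub>R (r - p)) -` (- V)}" for m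
  have cont: "continuous_on UNIV (\<lambda>(t::real, p::real^3, r). p + t *\<^sub>R (r - p))"
    by (auto simp: split_beta intro!: continuous_intros)
  have cl: "closed (C m)" for m
    unfolding C_def
    by (intro closed_compact_projection closed_vimage cont) (use V in \<open>auto simp: I_def\<close>)
  have "(\<forall>t\<in>{0<..<1}. p + t *\<^sub>R (r - p) \<in> V) \<longleftrightarrow> (\<forall>m. (p, r) \<notin> C m)" for p r
  proof -
    have memI: "(\<exists>m. t \<in> I m) \<longleftrightarrow> t \<in> {0<..<1}" for t
    proof
      assume "\<exists>m. t \<in> I m"
      then obtain m where m: "1 / real (m + 2) \<le> t" "t \<le> 1 - 1 / real (m + 2)" by (auto simp: I_def)
      have "0 < 1 / real (m + 2)" by simp
      with m show "t \<in> {0<..<1}" by (simp only: greaterThanLessThan_iff) linarith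
    next
      assume t: "t \<in> {0<..<1}"
      then obtain m where "inverse (real (Suc m)) < min t (1 - t)"
        using reals_Archimedean[of "min t (1 - t)"] by auto
      moreover have "1 / real (m + 2) \<le> inverse (real (Suc m))" by (simp add: field_simps)
      ultimately show "\<exists>m. t \<in> I m" by (intro exI[of _ m]) (auto simp: I_def)
    qed
    have memC: "(p, r) \<in> C m \<longleftrightarrow> (\<exists>t\<in>I m. p + t *\<^sub>R (r - p) \<notin> V)" for m
      by (simp add: C_def Bex_def)
    show ?thesis unfolding memC using memI by blast
  qed
  then have eq: "{(p, r). open_segment p r \<subseteq> V} = {(p, r). p = r} \<union> (\<Inter>m. - C m)"
    by (auto simp: open_segment_sub_iff)
  have "closed {(p, r). p = (r :: real^3)}"
    unfolding case_prod_unfold by (intro closed_Collect_eq continuous_intros)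
  then have "{(p, r). p = (r :: real^3)} \<in> sets borel" by (rule borel_closed)
  moreover have "(\<Inter>m. - C m) \<in> sets borel"
    using borel_comp[OF borel_closed[OF cl]] by (intro sets.countable_INT) auto
  ultimately show ?thesis
    unfolding eq borel_prod by (rule sets.Un)
qed

text \<open>\<open>g \<circ> \<phi>\<close> vanishes near \<open>u\<close>, so both tangent vectors
  are orthogonal to the gradient and their cross product is parallel to the outward normal. A
  parametrization may have either orientation, hence the absolute values. The identity links the
  cosine to the Jacobian of \<open>cone_map\<close>.\<close>

lemma surface_normal_parallel:
  assumes P: "piecewise_smooth_boundary V P" and KP: "(K, \<phi>) \<in> P" and u: "u \<in> interior K"
  shows "norm (surface_normal \<phi> u) * \<bar>incidence_cos V (\<phi> u) p\<bar> =
    \<bar>(\<phi> u - p) \<bullet> surface_normal \<phi> u\<bar> / norm (\<phi> u - p)"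
proof -
  let ?r = "\<phi> u" and ?N = "surface_normal \<phi> u" and ?n = "outward_normal V (\<phi> u)"
  have "smooth_boundary_point V ?r" using P KP u by (fastforce simp: piecewise_smooth_boundary_def)
  then obtain U g g' where ldf: "local_defining_function V ?r U g g'" and r: "?r \<in> frontier V"
    by (auto simp: smooth_boundary_point_def)
  have U: "open U" "?r \<in> U" "g' ?r \<noteq> 0" and der: "GDERIV g ?r :> g' ?r"
    and F: "frontier V \<inter> U = {y \<in> U. g y = 0}"
    using ldf unfolding local_defining_function_def by auto
  have n: "?n = g' ?r /\<^sub>R norm (g' ?r)" by (rule outward_normal_eq[OF ldf r])
  then have "norm ?n = 1" using U(3) by simp
  then have n1: "?n \<bullet> ?n = 1" by (simp only: norm_eq_1)
  obtain W where W: "open W" "K \<subseteq> W" "C1_on \<phi> W"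
    using P KP by (fastforce simp: piecewise_smooth_boundary_def smooth_patch_def)
  have uW: "u \<in> W" using u W interior_subset by blast
  then have "\<phi> differentiable (at u)"
    using W(3) by (auto simp: C1_on_def differentiable_def)
  then have d\<phi>: "(\<phi> has_derivative frechet_derivative \<phi> (at u)) (at u)" by (simp add: frechet_derivative_works)
  have comp: "((g \<circ> \<phi>) has_derivative (\<lambda>h. h \<bullet> g' ?r) \<circ> frechet_derivative \<phi> (at u)) (at u)"
    using der by (intro diff_chain_at d\<phi>) (simp add: gderiv_def)
  have fr: "frontier V = (\<Union>(K, \<phi>)\<in>P. \<phi> ` K)" using P by (simp add: piecewise_smooth_boundary_def)
  have "continuous (at u) \<phi>" by (rule has_derivative_continuous[OF d\<phi>])
  then have "eventually (\<lambda>w. \<phi> w \<in> U) (nhds u)"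
    using topological_tendstoD[OF _ U(1,2)] by (simp add: isCont_def tendsto_at_iff_tendsto_nhds)
  moreover have "eventually (\<lambda>w. w \<in> interior K) (nhds u)"
    using u by (intro eventually_nhds_in_open) auto
  ultimately have "eventually (\<lambda>w. (g \<circ> \<phi>) w = 0) (nhds u)"
  proof eventually_elim
    case (elim w)
    then have "\<phi> w \<in> frontier V" unfolding fr using KP interior_subset by blast
    then show ?case using F elim by auto
  qed
  then have "((\<lambda>w. 0) has_derivative (\<lambda>h. h \<bullet> g' ?r) \<circ> frechet_derivative \<phi> (at u)) (at u)"
    using eventually_nhds_x_imp_x comp
    by (intro has_derivative_transform_eventually[OF comp]) (auto simp: eventually_at_filter elim: eventually_mono)
  then have "(\<lambda>h. h \<bullet> g' ?r) \<circ> frechet_derivative \<phi> (at u) = (\<lambda>h. 0)"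
    using has_derivative_unique has_derivative_const by blast
  then have perp: "frechet_derivative \<phi> (at u) h \<bullet> ?n = 0" for h
    by (simp add: fun_eq_iff n)
  have "cross3 ?n ?N = 0"
  proof -
    let ?a = "frechet_derivative \<phi> (at u) (axis 1 1)" and ?b = "frechet_derivative \<phi> (at u) (axis 2 1)"
    \<comment> \<open>The triple product expansion leaves only inner products of the normal with
      tangent vectors, and these vanish.\<close>
    have "cross3 x (cross3 y z) = (x \<bullet> z) *\<^sub>R y - (x \<bullet> y) *\<^sub>R z" for x y z
      by (simp add: cross3_simps forall_3)
    then show ?thesis using perp by (simp add: surface_normal_def inner_commute)
  qed
  then have "(?n \<bullet> ?N)\<^sup>2 = (norm ?N)\<^sup>2"
    using norm_cross_dot[of ?n ?N] n1 by (simp add: power_mult_distrib norm_eq_1[symmetric])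
  then have "sqrt ((?n \<bullet> ?N)\<^sup>2) = sqrt ((norm ?N)\<^sup>2)" by (simp only:)
  then have absN: "norm ?N = \<bar>?n \<bullet> ?N\<bar>" by simp
  have "(?N - (?n \<bullet> ?N) *\<^sub>R ?n) \<bullet> (?N - (?n \<bullet> ?N) *\<^sub>R ?n) = (norm ?N)\<^sup>2 - (?n \<bullet> ?N)\<^sup>2"
    using n1 unfolding power2_norm_eq_inner
    by (simp add: inner_diff_left inner_diff_right inner_commute power2_eq_square)
  then have "?N = (?n \<bullet> ?N) *\<^sub>R ?n" using \<open>(?n \<bullet> ?N)\<^sup>2 = (norm ?N)\<^sup>2\<close> by simp
  then have "(?r - p) \<bullet> ?N = (?n \<bullet> ?N) * ((?r - p) \<bullet> ?n)" by (metis inner_scaleR_right)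
  then show ?thesis by (simp add: incidence_cos_def absN abs_mult)
qed

section \<open>Surface integrals and shadows\<close>

lemma nn_integral_absolutely_integrable:
  fixes h :: "'a::euclidean_space \<Rightarrow> real"
  assumes h: "h absolutely_integrable_on S" and nonneg: "\<And>x. x \<in> S \<Longrightarrow> 0 \<le> h x"
  shows "(\<integral>\<^sup>+x. ennreal (h x) * indicator S x \<partial>lebesgue) = ennreal (integral S h)"
proof -
  have int: "integrable lebesgue (\<lambda>x. indicator S x *\<^sub>R h x)"
    using h by (simp add: set_integrable_def)
  have "(\<integral>\<^sup>+x. ennreal (h x) * indicator S x \<partial>lebesgue) = (\<integral>\<^sup>+x. ennreal (indicator S x *\<^sub>R h x) \<partial>lebesgue)"
    by (intro nn_integral_cong) (auto simp: indicator_def)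
  also have "\<dots> = ennreal (LINT x|lebesgue. indicator S x *\<^sub>R h x)"
    by (rule nn_integral_eq_integral[OF int]) (auto simp: indicator_def nonneg)
  also have "(LINT x|lebesgue. indicator S x *\<^sub>R h x) = integral S h"
    using set_lebesgue_integral_eq_integral(2)[OF h] by (simp add: set_lebesgue_integral_def)
  finally show ?thesis .
qed

text \<open>Carries the theorem for absolutely integrable functions over to nonnegative integrals;
  the finite integral of \<open>f\<close> supplies integrability on the image, from which it passes
  to the domain.\<close>

lemma nn_integral_change_of_variables:
  fixes f :: "real^'n::{finite,wellorder} \<Rightarrow> real" and g :: "real^'n::_ \<Rightarrow> real^'n::_"
  assumes S: "S \<in> sets lebesgue" and der: "\<And>x. x \<in> S \<Longrightarrow> (g has_derivative g' x) (at x within S)"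
    and inj: "inj_on g S" and f: "f \<in> borel_measurable borel" "\<And>x. 0 \<le> f x"
    and fin: "(\<integral>\<^sup>+x. ennreal (f x) \<partial>lborel) < \<infinity>"
  shows "(\<integral>\<^sup>+x. ennreal (\<bar>det (matrix (g' x))\<bar> * f (g x)) * indicator S x \<partial>lebesgue) =
      (\<integral>\<^sup>+x. ennreal (f x) * indicator (g ` S) x \<partial>lebesgue)"
    and "g ` S \<in> sets lebesgue"
proof -
  have "g differentiable_on S"
    using der by (auto simp: differentiable_on_def differentiable_def)
  then show gS: "g ` S \<in> sets lebesgue"
    by (intro differentiable_image_in_sets_lebesgue S) auto
  have "integrable lborel f"
    using f fin by (intro integrableI_bounded) auto
  then have "integrable lebesgue f" using f(1) by (subst integrable_completion) auto
  then have "f absolutely_integrable_on UNIV" by (simp add: set_integrable_def)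
  then have fI: "f absolutely_integrable_on g ` S"
    by (rule set_integrable_subset[OF _ gS]) simp
  \<comment> \<open>The underlying theorem is about vector-valued functions, so \<open>f\<close> is
    viewed with values in a one-dimensional space.\<close>
  let ?F = "\<lambda>x. vec (f x) :: real^1"
  have "?F absolutely_integrable_on g ` S \<and> integral (g ` S) ?F = integral (g ` S) ?F"
    using fI by (simp add: absolutely_integrable_on_1_iff)
  then have "(\<lambda>x. \<bar>det (matrix (g' x))\<bar> *\<^sub>R ?F (g x)) absolutely_integrable_on S \<and>
      integral S (\<lambda>x. \<bar>det (matrix (g' x))\<bar> *\<^sub>R ?F (g x)) = integral (g ` S) ?F"
    by (subst has_absolute_integral_change_of_variables[OF S der inj]) auto
  then have "(\<lambda>x. \<bar>det (matrix (g' x))\<bar> * f (g x)) absolutely_integrable_on S \<and>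
      integral S (\<lambda>x. \<bar>det (matrix (g' x))\<bar> * f (g x)) = integral (g ` S) f"
    by (simp add: absolutely_integrable_on_1_iff integral_on_1_eq vec_eq_iff)
  then show "(\<integral>\<^sup>+x. ennreal (\<bar>det (matrix (g' x))\<bar> * f (g x)) * indicator S x \<partial>lebesgue) =
      (\<integral>\<^sup>+x. ennreal (f x) * indicator (g ` S) x \<partial>lebesgue)"
    using f(2) fI by (simp add: nn_integral_absolutely_integrable)
qed

definition tail3 :: "real^3 \<Rightarrow> real^2" where
  "tail3 w = vector [w $ 2, w $ 3]"

lemma tail3_vec3 [simp]: "tail3 (vec3 t u) = u"
  by (simp add: tail3_def vec_eq_iff forall_2 vector_2)

lemma vec3_tail3 [simp]: "vec3 (w $ 1) (tail3 w) = w"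
  by (simp add: tail3_def vec_eq_iff forall_3 vector_2)

lemma tail3_axis: "tail3 (axis 1 1) = 0" "tail3 (axis 2 1) = axis 1 1" "tail3 (axis 3 1) = axis 2 1"
  by (simp_all add: tail3_def vec_eq_iff forall_2 vector_2 axis_def)

lemma bounded_linear_tail3: "bounded_linear tail3"
  unfolding linear_conv_bounded_linear[symmetric]
  by (rule linearI) (simp_all add: tail3_def vec_eq_iff forall_2 vector_2)

lemma tail3_measurable [measurable]: "tail3 \<in> borel_measurable borel"
  by (intro borel_measurable_continuous_onI linear_continuous_on bounded_linear_tail3)

text \<open>The part of the cone with apex \<open>p\<close> behind the surface piece \<open>\<phi>\<close>; the first coordinate is
  the distance from \<open>p\<close> relative to that of the surface.\<close>

definition cone_map :: "(real^2 \<Rightarrow> real^3) \<Rightarrow> real^3 \<Rightarrow> real^3 \<Rightarrow> real^3" where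
  "cone_map \<phi> p w = p + w $ 1 *\<^sub>R (\<phi> (tail3 w) - p)"

text \<open>The columns of the Jacobian matrix are the vector from \<open>p\<close> to the surface
  point and the two tangent vectors scaled by \<open>w $ 1\<close>; the determinant is their triple
  product.\<close>

lemma cone_map_has_derivative:
  assumes "\<phi> differentiable (at (tail3 w))"
  defines "D \<equiv> frechet_derivative \<phi> (at (tail3 w))"
  shows "(cone_map \<phi> p has_derivative (\<lambda>h. h $ 1 *\<^sub>R (\<phi> (tail3 w) - p) + w $ 1 *\<^sub>R D (tail3 h))) (at w)"
    and "\<bar>det (matrix (\<lambda>h. h $ 1 *\<^sub>R (\<phi> (tail3 w) - p) + w $ 1 *\<^sub>R D (tail3 h)))\<bar> =
      (w $ 1)\<^sup>2 * \<bar>(\<phi> (tail3 w) - p) \<bullet> surface_normal \<phi> (tail3 w)\<bar>"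
proof -
  have D: "(\<phi> has_derivative D) (at (tail3 w))"
    unfolding D_def using assms(1) frechet_derivative_works by blast
  have t: "(tail3 has_derivative tail3) (at w)"
    by (rule bounded_linear_imp_has_derivative[OF bounded_linear_tail3])
  have "((\<lambda>w. \<phi> (tail3 w)) has_derivative (\<lambda>h. D (tail3 h))) (at w)"
    using diff_chain_at[OF t D] by (simp add: o_def)
  moreover have "((\<lambda>w::real^3. w $ 1) has_derivative (\<lambda>h. h $ 1)) (at w)"
    by (rule bounded_linear_imp_has_derivative[OF bounded_linear_vec_nth])
  ultimately have "((\<lambda>w. p + w $ 1 *\<^sub>R (\<phi> (tail3 w) - p)) has_derivative
      (\<lambda>h. w $ 1 *\<^sub>R D (tail3 h) + h $ 1 *\<^sub>R (\<phi> (tail3 w) - p))) (at w)"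
    by (auto intro!: derivative_eq_intros)
  then show "(cone_map \<phi> p has_derivative (\<lambda>h. h $ 1 *\<^sub>R (\<phi> (tail3 w) - p) + w $ 1 *\<^sub>R D (tail3 h))) (at w)"
    by (simp add: cone_map_def[abs_def] add.commute)
  let ?T = "\<lambda>h. h $ 1 *\<^sub>R (\<phi> (tail3 w) - p) + w $ 1 *\<^sub>R D (tail3 h)"
  let ?z = "\<phi> (tail3 w) - p"
  have D0: "D 0 = 0" using D has_derivative_bounded_linear linear_simps(3) by blast
  have T: "?T (axis 1 1) = ?z" "?T (axis 2 1) = w $ 1 *\<^sub>R D (axis 1 1)" "?T (axis 3 1) = w $ 1 *\<^sub>R D (axis 2 1)"
    by (simp_all add: tail3_axis D0) (simp_all add: axis_def)
  \<comment> \<open>The triple product formula takes the vectors as rows, whereas the Jacobian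
    matrix has them as columns.\<close>
  have "transpose (matrix ?T) = vector [?T (axis 1 1), ?T (axis 2 1), ?T (axis 3 1)]"
    by (simp only: vec_eq_iff forall_3 transpose_def matrix_def vec_lambda_beta vector_3)
  then have "det (matrix ?T) = det (vector [?T (axis 1 1), ?T (axis 2 1), ?T (axis 3 1)])"
    using det_transpose[of "matrix ?T"] by (simp only:)
  also have "\<dots> = ?z \<bullet> cross3 (w $ 1 *\<^sub>R D (axis 1 1)) (w $ 1 *\<^sub>R D (axis 2 1))"
    unfolding T by (simp only: dot_cross_det)
  also have "\<dots> = (w $ 1)\<^sup>2 * (?z \<bullet> surface_normal \<phi> (tail3 w))"
    by (simp add: cross_mult_left cross_mult_right surface_normal_def D_def power2_eq_square)
  finally show "\<bar>det (matrix ?T)\<bar> = (w $ 1)\<^sup>2 * \<bar>?z \<bullet> surface_normal \<phi> (tail3 w)\<bar>"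
    by (simp add: abs_mult)
qed

text \<open>The nearer of two boundary points on a ray would lie in the open segment and hence in \<open>V\<close>.\<close>

lemma visible_boundary_point_unique:
  assumes V: "open V" and r: "r \<in> frontier V" "open_segment p r \<subseteq> V" "r \<noteq> p"
    and r': "r' \<in> frontier V" "open_segment p r' \<subseteq> V" "r' \<noteq> p"
    and t: "0 < t" "0 < t'" and eq: "p + t *\<^sub>R (r - p) = p + t' *\<^sub>R (r' - p)"
  shows "t = t'" "r = r'"
proof -
  have F: "frontier V \<inter> V = {}" using V by (auto simp: frontier_def interior_open)
  have *: "\<not> b < c" if "open_segment p x \<subseteq> V" "y \<in> frontier V" "0 < b" "0 < c" "x \<noteq> p"
    "b *\<^sub>R (x - p) = c *\<^sub>R (y - p)" for x y b c
  proof
    assume "b < c"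
    then have "b / c \<in> {0<..<1}" using that by simp
    moreover have "y = p + (b / c) *\<^sub>R (x - p)"
    proof -
      have "(b / c) *\<^sub>R (x - p) = inverse c *\<^sub>R (b *\<^sub>R (x - p))"
        by (simp add: divide_inverse mult.commute)
      also have "\<dots> = y - p" unfolding that(6) using that(4) by simp
      finally show ?thesis by simp
    qed
    ultimately have "y \<in> V" using that(1,5) unfolding open_segment_sub_iff by blast
    then show False using F that(2) by blast
  qed
  have eq': "t *\<^sub>R (r - p) = t' *\<^sub>R (r' - p)" using eq by simp
  show "t = t'"
    using *[OF r(2) r'(1) t r(3) eq'] *[OF r'(2) r(1) t(2,1) r'(3) eq'[symmetric]] by linarith
  with eq' t show "r = r'" by simp
qed

section \<open>Surface integrals over patches\<close>

lemma patch_facts: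
  assumes P: "piecewise_smooth_boundary V P" and KP: "(K, \<phi>) \<in> P"
  shows "continuous_on (interior K) \<phi>" "continuous_on (interior K) (surface_normal \<phi>)"
    "\<And>u. u \<in> interior K \<Longrightarrow> \<phi> differentiable (at u)" "inj_on \<phi> (interior K)"
    "\<And>u. u \<in> interior K \<Longrightarrow> \<phi> u \<in> frontier V"
    "(\<integral>\<^sup>+u. ennreal (norm (surface_normal \<phi> u)) * indicator (interior K) u \<partial>lborel) < \<infinity>"
proof -
  have K: "compact K" "inj_on \<phi> (interior K)"
    using P KP by (fastforce simp: piecewise_smooth_boundary_def smooth_patch_def)+
  obtain W where W: "open W" "K \<subseteq> W" "C1_on \<phi> W"
    using P KP by (fastforce simp: piecewise_smooth_boundary_def smooth_patch_def)
  then have sub: "interior K \<subseteq> W" using interior_subset by blast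
  note c = C1_on_surface_normal[OF W(1,3)]
  show "continuous_on (interior K) \<phi>" "continuous_on (interior K) (surface_normal \<phi>)"
    using c continuous_on_subset sub by blast+
  show "\<phi> differentiable (at u)" if "u \<in> interior K" for u
    using that sub W(3) by (auto simp: C1_on_def differentiable_def)
  show "inj_on \<phi> (interior K)" by (rule K)
  show "\<phi> u \<in> frontier V" if "u \<in> interior K" for u
    using P KP that interior_subset[of K] unfolding piecewise_smooth_boundary_def by blast
  have "compact (surface_normal \<phi> ` K)"
    by (rule compact_continuous_image[OF continuous_on_subset[OF c(2) W(2)] K(1)])
  then obtain B where B: "\<And>u. u \<in> K \<Longrightarrow> norm (surface_normal \<phi> u) \<le> B"
    using compact_imp_bounded bounded_iff by (metis imageI)
  have "(\<integral>\<^sup>+u. ennreal (norm (surface_normal \<phi> u)) * indicator (interior K) u \<partial>lborel) \<le>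
      (\<integral>\<^sup>+u. ennreal B * indicator K u \<partial>lborel)"
    using B interior_subset[of K] by (intro nn_integral_mono) (auto simp: indicator_def intro!: ennreal_leI)
  also have "\<dots> = ennreal B * emeasure lborel K"
    using K(1) by (intro nn_integral_cmult_indicator) (auto dest: compact_imp_closed)
  also have "\<dots> < \<infinity>"
    using emeasure_compact_finite[OF K(1)] by (simp add: ennreal_mult_less_top)
  finally show "(\<integral>\<^sup>+u. ennreal (norm (surface_normal \<phi> u)) * indicator (interior K) u \<partial>lborel) < \<infinity>" .
qed

text \<open>Extension by zero, since patches are only continuous near \<open>K\<close>.\<close>

definition ext :: "(real^2) set \<Rightarrow> (real^2 \<Rightarrow> real^3) \<Rightarrow> real^2 \<Rightarrow> real^3" where
  "ext K f u = indicator (interior K) u *\<^sub>R f u"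

lemma ext_eq: "u \<in> interior K \<Longrightarrow> ext K f u = f u"
  by (simp add: ext_def)

lemma ext_measurable:
  assumes "continuous_on (interior K) f"
  shows "ext K f \<in> borel_measurable borel"
  unfolding ext_def[abs_def] by (rule borel_measurable_continuous_on_indicator[OF _ assms]) simp

text \<open>Agreement on Borel sets is the formula for the measure itself; both sides are additive,
  homogeneous and continuous along increasing sequences, so it extends to all nonnegative Borel
  functions.\<close>

lemma nn_integral_borel_surface_measure:
  assumes P: "piecewise_smooth_boundary V P" and F: "F \<in> borel_measurable borel"
  shows "(\<integral>\<^sup>+r. F r \<partial>borel_surface_measure P) =
    (\<Sum>(K, \<phi>)\<in>P. \<integral>\<^sup>+u. ennreal (norm (surface_normal \<phi> u)) * indicator (interior K) u * F (\<phi> u) \<partial>lborel)"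
proof -
  \<comment> \<open>Borel functions on the whole plane that represent the patch: outside the
    interior of \<open>K\<close> the map \<open>e\<close> takes the value 0, but the weight
    \<open>w\<close> vanishes there.\<close>
  define w where "w z u = ennreal (norm (ext (fst z) (surface_normal (snd z)) u))"
    for z :: "(real^2) set \<times> (real^2 \<Rightarrow> real^3)" and u
  define e where "e z = ext (fst z) (snd z)" for z :: "(real^2) set \<times> (real^2 \<Rightarrow> real^3)"
  have [measurable]: "w z \<in> borel_measurable borel" "e z \<in> borel_measurable borel" if "z \<in> P" for z
    using patch_facts(1,2)[OF P, of "fst z" "snd z"] that
    unfolding w_def[abs_def] e_def by (auto intro!: ext_measurable measurable_compose[OF _ borel_measurable_norm]
      measurable_compose[OF _ measurable_ennreal])
  have we: "w z u * G (e z u) = ennreal (norm (surface_normal (snd z) u)) * indicator (interior (fst z)) u * G (snd z u)"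
    for z u and G :: "real^3 \<Rightarrow> ennreal"
    by (auto simp: w_def e_def ext_def indicator_def)
  have "(\<integral>\<^sup>+r. F r \<partial>borel_surface_measure P) = (\<Sum>z\<in>P. \<integral>\<^sup>+u. w z u * F (e z u) \<partial>lborel)"
    using F
  proof (induction rule: borel_measurable_induct)
    case (cong f g)
    then have "f = g" by auto
    with cong show ?case by simp
  next
    case (set A)
    have "(\<integral>\<^sup>+u. w z u * indicator A (e z u) \<partial>lborel) =
        (\<integral>\<^sup>+u. ennreal (norm (surface_normal (snd z) u)) * indicator {u \<in> interior (fst z). snd z u \<in> A} u \<partial>lborel)" for z
      unfolding we by (intro nn_integral_cong) (auto simp: indicator_def)
    then show ?case
      using set emeasure_borel_surface_measure[OF P set] by (simp add: case_prod_unfold)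
  next
    case (mult u c)
    then show ?case
      by (simp add: nn_integral_cmult sum_distrib_left mult.left_commute[of _ c])
  next
    case (add u v)
    then show ?case
      by (simp add: nn_integral_add distrib_left sum.distrib)
  next
    case (seq U)
    note [measurable] = seq(1)
    have "(\<integral>\<^sup>+r. (SUP i. U i) r \<partial>borel_surface_measure P) = (SUP i. \<integral>\<^sup>+r. U i r \<partial>borel_surface_measure P)"
      unfolding SUP_apply using seq by (intro nn_integral_monotone_convergence_SUP) auto
    also have "\<dots> = (SUP i. \<Sum>z\<in>P. \<integral>\<^sup>+u. w z u * U i (e z u) \<partial>lborel)"
      using seq by simp
    also have "\<dots> = (\<Sum>z\<in>P. SUP i. \<integral>\<^sup>+u. w z u * U i (e z u) \<partial>lborel)"
    proof (rule ennreal_SUP_sum)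
      show "incseq (\<lambda>i. \<integral>\<^sup>+u. w z u * U i (e z u) \<partial>lborel)" for z
        using \<open>incseq U\<close> by (auto simp: incseq_def le_fun_def intro!: nn_integral_mono mult_left_mono)
    qed
    also have "\<dots> = (\<Sum>z\<in>P. \<integral>\<^sup>+u. w z u * (SUP i. U i) (e z u) \<partial>lborel)"
    proof (intro sum.cong refl)
      fix z assume z: "z \<in> P"
      have "(SUP i. \<integral>\<^sup>+u. w z u * U i (e z u) \<partial>lborel) = (\<integral>\<^sup>+u. (SUP i. w z u * U i (e z u)) \<partial>lborel)"
        using \<open>incseq U\<close> z by (intro nn_integral_monotone_convergence_SUP[symmetric])
          (auto simp: incseq_def le_fun_def intro!: mult_left_mono)
      then show "(SUP i. \<integral>\<^sup>+u. w z u * U i (e z u) \<partial>lborel) = (\<integral>\<^sup>+u. w z u * (SUP i. U i) (e z u) \<partial>lborel)"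
        by (simp only: SUP_apply SUP_mult_left_ennreal)
    qed
    finally show ?case .
  qed
  then show ?thesis unfolding we by (simp add: case_prod_unfold)
qed

lemma finite_borel_surface_measure:
  assumes P: "piecewise_smooth_boundary V P"
  shows "finite_measure (borel_surface_measure P)"
proof
  have "emeasure (borel_surface_measure P) UNIV = (\<integral>\<^sup>+r. 1 \<partial>borel_surface_measure P)" by simp
  also have "\<dots> = (\<Sum>(K, \<phi>)\<in>P. \<integral>\<^sup>+u. ennreal (norm (surface_normal \<phi> u)) * indicator (interior K) u * 1 \<partial>lborel)"
    by (rule nn_integral_borel_surface_measure[OF P]) simp
  also have "\<dots> < \<infinity>"
  proof -
    have "\<forall>z\<in>P. (case z of (K, \<phi>) \<Rightarrow>
        \<integral>\<^sup>+u. ennreal (norm (surface_normal \<phi> u)) * indicator (interior K) u * 1 \<partial>lborel) < top"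
      using patch_facts(6)[OF P] by auto
    moreover have "finite P" using P by (simp add: piecewise_smooth_boundary_def)
    ultimately show ?thesis by simp
  qed
  finally show "emeasure (borel_surface_measure P) (space (borel_surface_measure P)) \<noteq> \<infinity>" by simp
qed

text \<open>The case \<open>\<phi> u = p\<close> must be excluded explicitly: its open segment is
  empty and would count as visible, although it determines no ray. The kernels are 0 there.\<close>

definition seen :: "(real^3) set \<Rightarrow> real^3 \<Rightarrow> (real^2) set \<Rightarrow> (real^2 \<Rightarrow> real^3) \<Rightarrow> (real^2) set" where
  "seen V p K \<phi> = {u \<in> interior K. open_segment p (\<phi> u) \<subseteq> V \<and> \<phi> u \<noteq> p}"

definition shadow :: "(real^3) set \<Rightarrow> real^3 \<Rightarrow> (real^2) set \<times> (real^2 \<Rightarrow> real^3) \<Rightarrow> (real^3) set" where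
  "shadow V p = (\<lambda>(K, \<phi>). cone_map \<phi> p ` {w. 1 \<le> w $ 1 \<and> tail3 w \<in> seen V p K \<phi>})"

lemma visible_borel:
  assumes "open V"
  shows "{r :: real^3. open_segment p r \<subseteq> V} \<in> sets borel"
proof -
  have "(\<lambda>r. (p, r)) -` {(p, r). open_segment p r \<subseteq> V} \<inter> space borel \<in> sets borel"
    by (rule measurable_sets[OF _ visible_pairs_borel[OF assms]]) measurable
  then show ?thesis by (simp add: vimage_def)
qed

lemma visibility_measurable:
  assumes "open V"
  shows "visibility V p \<in> borel_measurable borel"
proof -
  have "visibility V p = indicator {r. open_segment p r \<subseteq> V}"
    by (auto simp: visibility_def fun_eq_iff indicator_def)
  then show ?thesis using visible_borel[OF assms, of p] by simp
qed

text \<open>The symmetric factor common to all four kernels, which differ only in cosines and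
  constants.\<close>

definition transmission :: "(real^3) set \<Rightarrow> real \<Rightarrow> real^3 \<Rightarrow> real^3 \<Rightarrow> real" where
  "transmission V \<beta> p r = exp (- \<beta> * norm (p - r)) / (norm (p - r))\<^sup>2 * visibility V p r"

lemma transmission_measurable:
  assumes "open V"
  shows "transmission V \<beta> p \<in> borel_measurable borel"
proof -
  note [measurable] = visibility_measurable[OF assms]
  show ?thesis unfolding transmission_def[abs_def] by measurable
qed

lemma transmission_nonneg: "0 \<le> transmission V \<beta> p r"
  by (simp add: transmission_def visibility_def)

lemma transmission_commute: "transmission V \<beta> p r = transmission V \<beta> r p"
  by (simp add: transmission_def visibility_def open_segment_commute norm_minus_commute)

lemma seen_borel:
  assumes V: "open V" and P: "piecewise_smooth_boundary V P" and KP: "(K, \<phi>) \<in> P"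
  shows "seen V p K \<phi> \<in> sets borel"
proof -
  have e: "ext K \<phi> \<in> borel_measurable borel" by (rule ext_measurable[OF patch_facts(1)[OF P KP]])
  have "seen V p K \<phi> = interior K \<inter> (ext K \<phi> -` ({r. open_segment p r \<subseteq> V} - {p}) \<inter> space borel)"
    by (auto simp: seen_def ext_eq)
  also have "\<dots> \<in> sets borel"
    using visible_borel[OF V, of p] by (intro sets.Int measurable_sets[OF e]) auto
  finally show ?thesis .
qed

text \<open>Change of variables along \<open>cone_map\<close>, followed by separating the ray
  parameter from the surface parameter. The map is injective because a ray meets the visible
  boundary only once and \<open>\<phi>\<close> is injective. As a differentiable image the shadow is
  known to be Lebesgue measurable only.\<close>

lemma shadow_integral:
  assumes V: "open V" and P: "piecewise_smooth_boundary V P" and KP: "(K, \<phi>) \<in> P"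
    and f [measurable]: "f \<in> borel_measurable borel" and f0: "\<And>x. 0 \<le> f x"
    and fin: "(\<integral>\<^sup>+x. ennreal (f x) \<partial>lborel) < \<infinity>"
  shows "(\<integral>\<^sup>+x. ennreal (f x) * indicator (shadow V p (K, \<phi>)) x \<partial>lebesgue) =
      (\<integral>\<^sup>+u. indicator (seen V p K \<phi>) u * (\<integral>\<^sup>+t. ennreal (t\<^sup>2 * \<bar>(\<phi> u - p) \<bullet> surface_normal \<phi> u\<bar> *
        f (p + t *\<^sub>R (\<phi> u - p))) * indicator {1..} t \<partial>lborel) \<partial>lborel)"
    and "shadow V p (K, \<phi>) \<in> sets lebesgue"
proof -
  let ?D = "seen V p K \<phi>"
  define S where "S = {w. 1 \<le> w $ 1 \<and> tail3 w \<in> ?D}"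
  have [measurable]: "?D \<in> sets borel" by (rule seen_borel[OF V P KP])
  have [measurable]: "ext K \<phi> \<in> borel_measurable borel" "ext K (surface_normal \<phi>) \<in> borel_measurable borel"
    using patch_facts(1,2)[OF P KP] by (auto intro: ext_measurable)
  have Sb [measurable]: "S \<in> sets borel" unfolding S_def by measurable
  then have SL: "S \<in> sets lebesgue" by simp
  have DK: "u \<in> interior K" if "u \<in> ?D" for u using that by (simp add: seen_def)
  let ?g' = "\<lambda>w h. h $ 1 *\<^sub>R (\<phi> (tail3 w) - p) + w $ 1 *\<^sub>R frechet_derivative \<phi> (at (tail3 w)) (tail3 h)"
  have diff: "\<phi> differentiable (at (tail3 w))" if "w \<in> S" for w
    using that patch_facts(3)[OF P KP] by (auto simp: S_def DK)
  have der: "(cone_map \<phi> p has_derivative ?g' w) (at w within S)" if "w \<in> S" for w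
    by (rule has_derivative_at_withinI[OF cone_map_has_derivative(1)[OF diff[OF that]]])
  have inj: "inj_on (cone_map \<phi> p) S"
  proof (rule inj_onI)
    fix w w' assume w: "w \<in> S" "w' \<in> S" and eq: "cone_map \<phi> p w = cone_map \<phi> p w'"
    have u: "tail3 w \<in> ?D" "tail3 w' \<in> ?D" "1 \<le> w $ 1" "1 \<le> w' $ 1" using w by (auto simp: S_def)
    then have "w $ 1 = w' $ 1 \<and> \<phi> (tail3 w) = \<phi> (tail3 w')"
      using visible_boundary_point_unique[OF V, of "\<phi> (tail3 w)" p "\<phi> (tail3 w')" "w $ 1" "w' $ 1"]
        patch_facts(5)[OF P KP] eq by (auto simp: seen_def cone_map_def)
    moreover have "tail3 w = tail3 w'"
      using inj_onD[OF patch_facts(4)[OF P KP]] calculation u DK by blast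
    ultimately show "w = w'" by (metis vec3_tail3)
  qed
  have sh: "shadow V p (K, \<phi>) = cone_map \<phi> p ` S" by (simp add: shadow_def S_def)
  note cv = nn_integral_change_of_variables[OF SL der inj f f0 fin]
  show "shadow V p (K, \<phi>) \<in> sets lebesgue" unfolding sh by (rule cv(2))
  \<comment> \<open>Replacing \<open>\<phi>\<close> and its normal by their extensions by zero gives
    a Borel integrand, as required for iterated integration.\<close>
  let ?I = "\<lambda>w. ennreal ((w $ 1)\<^sup>2 * \<bar>(ext K \<phi> (tail3 w) - p) \<bullet> ext K (surface_normal \<phi>) (tail3 w)\<bar> *
      f (p + w $ 1 *\<^sub>R (ext K \<phi> (tail3 w) - p))) * indicator S w"
  have "(\<integral>\<^sup>+x. ennreal (f x) * indicator (shadow V p (K, \<phi>)) x \<partial>lebesgue) =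
      (\<integral>\<^sup>+w. ennreal (\<bar>det (matrix (?g' w))\<bar> * f (cone_map \<phi> p w)) * indicator S w \<partial>lebesgue)"
    unfolding sh by (rule cv(1)[symmetric])
  also have "\<dots> = (\<integral>\<^sup>+w. ?I w \<partial>lebesgue)"
  proof (rule nn_integral_cong)
    fix w :: "real^3"
    show "ennreal (\<bar>det (matrix (?g' w))\<bar> * f (cone_map \<phi> p w)) * indicator S w = ?I w"
    proof (cases "w \<in> S")
      case True
      then have "tail3 w \<in> interior K" by (auto simp: S_def DK)
      then show ?thesis
        by (simp only: cone_map_has_derivative(2)[OF diff[OF True]] ext_eq cone_map_def)
    qed simp
  qed
  also have "\<dots> = (\<integral>\<^sup>+w. ?I w \<partial>lborel)" by (rule nn_integral_completion)
  also have "\<dots> = (\<integral>\<^sup>+u. (\<integral>\<^sup>+t. ?I (vec3 t u) \<partial>lborel) \<partial>lborel)"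
    by (rule nn_integral_vec3(2)) measurable
  also have "\<dots> = (\<integral>\<^sup>+u. indicator ?D u * (\<integral>\<^sup>+t. ennreal (t\<^sup>2 * \<bar>(\<phi> u - p) \<bullet> surface_normal \<phi> u\<bar> *
        f (p + t *\<^sub>R (\<phi> u - p))) * indicator {1..} t \<partial>lborel) \<partial>lborel)"
  proof (rule nn_integral_cong)
    fix u
    show "(\<integral>\<^sup>+t. ?I (vec3 t u) \<partial>lborel) = indicator ?D u * (\<integral>\<^sup>+t. ennreal (t\<^sup>2 *
        \<bar>(\<phi> u - p) \<bullet> surface_normal \<phi> u\<bar> * f (p + t *\<^sub>R (\<phi> u - p))) * indicator {1..} t \<partial>lborel)"
    proof (cases "u \<in> ?D")
      case True
      then have "indicator S (vec3 t u) = (indicator {1..} t :: ennreal)" for t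
        by (simp add: S_def indicator_def)
      then show ?thesis using True DK[OF True] by (simp add: ext_eq)
    next
      case False
      then have "indicator S (vec3 t u) = (0 :: ennreal)" for t by (simp add: S_def)
      then show ?thesis using False by simp
    qed
  qed
  finally show "(\<integral>\<^sup>+x. ennreal (f x) * indicator (shadow V p (K, \<phi>)) x \<partial>lebesgue) = \<dots>" .
qed

text \<open>The Jacobian factor \<open>t\<^sup>2\<close> cancels against \<open>decay\<close>,
  leaving a pure exponential whose integral beyond \<open>t = 1\<close> is the attenuation at the
  surface. Of the three powers of \<open>norm z\<close>, two belong to the kernel and one to the
  cosine.\<close>

lemma ray_integral:
  assumes \<beta>: "0 < \<beta>" and z: "z \<noteq> 0" and J: "0 \<le> J"
  shows "(\<integral>\<^sup>+t. ennreal (t\<^sup>2 * (J * decay \<beta> (t *\<^sub>R z))) * indicator {1..} t \<partial>lborel) =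
    ennreal (J * exp (- \<beta> * norm z) / norm z ^ 3)"
proof -
  let ?R = "norm z" and ?F = "\<lambda>t. - (J * exp (- \<beta> * t * norm z) / norm z ^ 3)"
  let ?f = "\<lambda>t. J * \<beta> * exp (- \<beta> * t * ?R) / ?R\<^sup>2"
  have R: "0 < ?R" using z by simp
  have "(\<integral>\<^sup>+t. ennreal (t\<^sup>2 * (J * decay \<beta> (t *\<^sub>R z))) * indicator {1..} t \<partial>lborel) =
      (\<integral>\<^sup>+t. ennreal (?f t) * indicator {1..} t \<partial>lborel)"
  proof (intro nn_integral_cong)
    fix t :: real
    have "t\<^sup>2 * (J * decay \<beta> (t *\<^sub>R z)) = ?f t" if "1 \<le> t"
      using that by (simp add: decay_def power_mult_distrib mult_ac)
    then show "ennreal (t\<^sup>2 * (J * decay \<beta> (t *\<^sub>R z))) * indicator {1..} t = ennreal (?f t) * indicator {1..} t"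
      by (auto simp: indicator_def)
  qed
  also have "\<dots> = ennreal (0 - ?F 1)"
  proof (rule nn_integral_FTC_atLeast)
    show "(?F has_real_derivative ?f t) (at t)" for t
      using R by (auto intro!: derivative_eq_intros simp: field_simps power2_eq_square power3_eq_cube)
    have "\<beta> * ?R > 0" using \<beta> R by simp
    moreover have "((\<lambda>t. exp (- c * t)) \<longlongrightarrow> 0) at_top" if "0 < c" for c :: real
      using that by real_asymp
    ultimately have "((\<lambda>t. exp (- (\<beta> * ?R) * t)) \<longlongrightarrow> 0) at_top" by blast
    then have "((\<lambda>t. - (J * exp (- (\<beta> * ?R) * t) / ?R ^ 3)) \<longlongrightarrow> - (J * 0 / ?R ^ 3)) at_top"
      using R by (intro tendsto_intros) auto
    then show "(?F \<longlongrightarrow> 0) at_top" by (simp add: mult_ac)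
    show "0 \<le> ?f t" for t using J \<beta> by simp
  qed measurable
  finally show ?thesis by simp
qed

text \<open>The shadows of the visible surface pieces and the visible part of \<open>V\<close> are pairwise disjoint,
  and the surface integral equals the integral of \<open>decay\<close> over the shadows.\<close>

lemma visible_flux_le:
  assumes V: "open V" and P: "piecewise_smooth_boundary V P" and \<beta>: "0 < \<beta>"
    and h [measurable]: "h \<in> borel_measurable borel" and h0: "\<And>z. 0 \<le> h z"
    and hom: "\<And>c z. 0 < c \<Longrightarrow> h (c *\<^sub>R z) = h z"
    and total: "(\<integral>\<^sup>+x. ennreal (decay \<beta> (x - p) * h (x - p)) \<partial>lborel) \<le> ennreal T"
  shows "(\<integral>\<^sup>+r. ennreal (\<bar>incidence_cos V r p\<bar> * h (r - p) * transmission V \<beta> p r) \<partial>borel_surface_measure P) +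
      (\<integral>\<^sup>+x. ennreal (\<beta> * (h (x - p) * transmission V \<beta> p x)) * indicator V x \<partial>lborel) \<le> ennreal T"
proof -
  define f where "f x = decay \<beta> (x - p) * h (x - p)" for x
  have [measurable]: "f \<in> borel_measurable borel" unfolding f_def[abs_def] by measurable
  have f0: "0 \<le> f x" for x using decay_nonneg[of \<beta>] h0 \<beta> by (simp add: f_def)
  have fin: "(\<integral>\<^sup>+x. ennreal (f x) \<partial>lborel) < \<infinity>"
    using total unfolding f_def by (rule order_le_less_trans) simp
  define Vis where "Vis = {x \<in> V. open_segment p x \<subseteq> V}"
  have vis_eq: "Vis = V \<inter> {x. open_segment p x \<subseteq> V}" by (auto simp: Vis_def)
  have [measurable]: "Vis \<in> sets borel" unfolding vis_eq using V visible_borel[OF V] by auto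
  have finP: "finite P" using P by (simp add: piecewise_smooth_boundary_def)
  note [measurable] = transmission_measurable[OF V]
  let ?F = "\<lambda>r. ennreal (\<bar>incidence_cos V r p\<bar> * h (r - p) * transmission V \<beta> p r)"
  have F: "?F \<in> borel_measurable borel" unfolding incidence_cos_def by measurable
  \<comment> \<open>The area element times the cosine at the surface is the Jacobian of
    \<open>cone_map\<close> up to the distance and the ray parameter, and
    \<open>ray_integral\<close> turns the attenuation at the surface into an integral behind
    it.\<close>
  have patch: "(\<integral>\<^sup>+u. ennreal (norm (surface_normal \<phi> u)) * indicator (interior K) u * ?F (\<phi> u) \<partial>lborel) =
      (\<integral>\<^sup>+x. ennreal (f x) * indicator (shadow V p (K, \<phi>)) x \<partial>lebesgue)" if KP: "(K, \<phi>) \<in> P" for K \<phi>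
    unfolding shadow_integral(1)[OF V P KP \<open>f \<in> borel_measurable borel\<close> f0 fin]
  proof (rule nn_integral_cong)
    fix u
    let ?z = "\<phi> u - p" and ?N = "surface_normal \<phi> u"
    show "ennreal (norm ?N) * indicator (interior K) u * ?F (\<phi> u) =
        indicator (seen V p K \<phi>) u * (\<integral>\<^sup>+t. ennreal (t\<^sup>2 * \<bar>?z \<bullet> ?N\<bar> * f (p + t *\<^sub>R ?z)) * indicator {1..} t \<partial>lborel)"
    proof (cases "u \<in> seen V p K \<phi>")
      case True
      then have u: "u \<in> interior K" "open_segment p (\<phi> u) \<subseteq> V" "?z \<noteq> 0" by (auto simp: seen_def)
      have "norm ?N * (\<bar>incidence_cos V (\<phi> u) p\<bar> * h ?z * transmission V \<beta> p (\<phi> u)) =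
          (norm ?N * \<bar>incidence_cos V (\<phi> u) p\<bar>) * (exp (- \<beta> * norm ?z) / (norm ?z)\<^sup>2 * h ?z)"
        using u(2) by (simp add: transmission_def visibility_def norm_minus_commute)
      also have "\<dots> = \<bar>?z \<bullet> ?N\<bar> * h ?z * exp (- \<beta> * norm ?z) / norm ?z ^ 3"
        unfolding surface_normal_parallel[OF P KP u(1)] by (simp add: power2_eq_square power3_eq_cube mult_ac)
      finally have "ennreal (norm ?N) * ?F (\<phi> u) = ennreal (\<bar>?z \<bullet> ?N\<bar> * h ?z * exp (- \<beta> * norm ?z) / norm ?z ^ 3)"
        by (simp flip: ennreal_mult')
      also have "\<dots> = (\<integral>\<^sup>+t. ennreal (t\<^sup>2 * (\<bar>?z \<bullet> ?N\<bar> * h ?z * decay \<beta> (t *\<^sub>R ?z))) * indicator {1..} t \<partial>lborel)"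
        using h0[of ?z] by (intro ray_integral[symmetric] \<beta> u(3)) simp
      also have "\<dots> = (\<integral>\<^sup>+t. ennreal (t\<^sup>2 * \<bar>?z \<bullet> ?N\<bar> * f (p + t *\<^sub>R ?z)) * indicator {1..} t \<partial>lborel)"
      proof (rule nn_integral_cong)
        fix t :: real
        have eq: "t\<^sup>2 * (\<bar>?z \<bullet> ?N\<bar> * h ?z * decay \<beta> (t *\<^sub>R ?z)) = t\<^sup>2 * \<bar>?z \<bullet> ?N\<bar> * f (p + t *\<^sub>R ?z)" if "1 \<le> t"
          using that hom[of t ?z] by (simp add: f_def mult_ac)
        show "ennreal (t\<^sup>2 * (\<bar>?z \<bullet> ?N\<bar> * h ?z * decay \<beta> (t *\<^sub>R ?z))) * indicator {1..} t =
            ennreal (t\<^sup>2 * \<bar>?z \<bullet> ?N\<bar> * f (p + t *\<^sub>R ?z)) * indicator {1..} t"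
          by (cases "1 \<le> t") (simp_all only: eq indicator_simps atLeast_iff mult_zero_right not_le not_less)
      qed
      finally show ?thesis using True u(1) by simp
    next
      case False
      \<comment> \<open>If \<open>\<phi> u = p\<close>, the transmission is 0 by division by zero,
        so this case agrees with the invisible one.\<close>
      then have "u \<notin> interior K \<or> ?F (\<phi> u) = 0" by (auto simp: seen_def transmission_def visibility_def)
      then show ?thesis using False by auto
    qed
  qed
  have frontier: "frontier V \<inter> V = {}" using V by (auto simp: frontier_def interior_open)
  have shadowD: "\<exists>u t. u \<in> interior K \<and> 1 \<le> t \<and> x = p + t *\<^sub>R (\<phi> u - p) \<and> \<phi> u \<in> frontier V \<and>
      open_segment p (\<phi> u) \<subseteq> V \<and> \<phi> u \<noteq> p" if x: "x \<in> shadow V p (K, \<phi>)" and KP: "(K, \<phi>) \<in> P" for x K \<phi>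
  proof -
    obtain w where w: "1 \<le> w $ 1" "tail3 w \<in> seen V p K \<phi>" "x = cone_map \<phi> p w"
      using x by (auto simp: shadow_def)
    with patch_facts(5)[OF P KP] show ?thesis
      by (intro exI[of _ "tail3 w"] exI[of _ "w $ 1"]) (auto simp: seen_def cone_map_def)
  qed
  have disj: "disjoint_family_on (shadow V p) P"
  \<comment> \<open>A common point of two shadows lies behind the same visible boundary point, but
    distinct patches have disjoint images of their interiors.\<close>
  proof (unfold disjoint_family_on_def, intro ballI impI)
    fix z z' assume z: "z \<in> P" "z' \<in> P" "z \<noteq> z'"
    obtain K \<phi> K' \<phi>' where e: "z = (K, \<phi>)" "z' = (K', \<phi>')" by fastforce
    show "shadow V p z \<inter> shadow V p z' = {}"
    proof (rule ccontr)
      assume "shadow V p z \<inter> shadow V p z' \<noteq> {}"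
      then obtain x where x: "x \<in> shadow V p (K, \<phi>)" "x \<in> shadow V p (K', \<phi>')" by (auto simp: e)
      obtain u t where u: "u \<in> interior K" "1 \<le> t" "x = p + t *\<^sub>R (\<phi> u - p)" "\<phi> u \<in> frontier V"
        "open_segment p (\<phi> u) \<subseteq> V" "\<phi> u \<noteq> p"
        using shadowD[OF x(1)] z e by blast
      obtain u' t' where u': "u' \<in> interior K'" "1 \<le> t'" "x = p + t' *\<^sub>R (\<phi>' u' - p)" "\<phi>' u' \<in> frontier V"
        "open_segment p (\<phi>' u') \<subseteq> V" "\<phi>' u' \<noteq> p"
        using shadowD[OF x(2)] z e by blast
      have "\<phi> u = \<phi>' u'"
        using visible_boundary_point_unique(2)[OF V u(4-6) u'(4-6), of t t'] u u' by simp
      moreover have "disjoint_family_on (\<lambda>(K, \<phi>). \<phi> ` interior K) P"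
        using P by (simp add: piecewise_smooth_boundary_def)
      then have "\<phi> ` interior K \<inter> \<phi>' ` interior K' = {}"
        using z unfolding e disjoint_family_on_def by fastforce
      ultimately show False using u(1) u'(1) by blast
    qed
  qed
  \<comment> \<open>If a visible \<open>x\<close> in \<open>V\<close> lay behind a boundary point,
    that point would be \<open>x\<close> itself or lie on the open segment from \<open>p\<close> to
    \<open>x\<close>, and in both cases belong to \<open>V\<close>.\<close>
  have disjV: "shadow V p z \<inter> Vis = {}" if z: "z \<in> P" for z
  proof (rule ccontr)
    assume "shadow V p z \<inter> Vis \<noteq> {}"
    moreover obtain K \<phi> where e: "z = (K, \<phi>)" by fastforce
    ultimately obtain x where x: "x \<in> shadow V p (K, \<phi>)" "x \<in> V" "open_segment p x \<subseteq> V"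
      by (auto simp: Vis_def)
    obtain u t where u: "1 \<le> t" "x = p + t *\<^sub>R (\<phi> u - p)" "\<phi> u \<in> frontier V" "\<phi> u \<noteq> p"
      using shadowD[OF x(1)] z e by blast
    have "\<phi> u \<in> V"
    proof (cases "t = 1")
      case True
      then show ?thesis using u(2) x(2) by simp
    next
      case False
      then have "1 / t \<in> {0<..<1}" "\<phi> u = p + (1 / t) *\<^sub>R (x - p)" using u by auto
      moreover have "p \<noteq> x" using u by auto
      ultimately show ?thesis using x(3) unfolding open_segment_sub_iff by metis
    qed
    then show False using u(3) frontier by blast
  qed
  have [measurable]: "shadow V p z \<in> sets lebesgue" if "z \<in> P" for z
    using shadow_integral(2)[OF V P _ \<open>f \<in> borel_measurable borel\<close> f0 fin, of "fst z" "snd z"] that by simp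
  have [measurable]: "f \<in> borel_measurable lebesgue" "Vis \<in> sets lebesgue"
    by (auto intro: measurable_completion)
  have "(\<integral>\<^sup>+r. ?F r \<partial>borel_surface_measure P) = (\<Sum>z\<in>P. \<integral>\<^sup>+x. ennreal (f x) * indicator (shadow V p z) x \<partial>lebesgue)"
    unfolding nn_integral_borel_surface_measure[OF P F]
  proof (intro sum.cong refl)
    fix z assume "z \<in> P"
    then show "(case z of (K, \<phi>) \<Rightarrow>
        \<integral>\<^sup>+u. ennreal (norm (surface_normal \<phi> u)) * indicator (interior K) u * ?F (\<phi> u) \<partial>lborel) =
        (\<integral>\<^sup>+x. ennreal (f x) * indicator (shadow V p z) x \<partial>lebesgue)"
      by (cases z) (simp only: prod.case patch)
  qed
  also have "\<dots> = (\<integral>\<^sup>+x. (\<Sum>z\<in>P. ennreal (f x) * indicator (shadow V p z) x) \<partial>lebesgue)"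
    by (rule nn_integral_sum[symmetric]) measurable
  also have "\<dots> = (\<integral>\<^sup>+x. ennreal (f x) * indicator (\<Union>z\<in>P. shadow V p z) x \<partial>lebesgue)"
    by (simp add: indicator_UN_disjoint[OF finP disj] sum_distrib_left)
  finally have surf: "(\<integral>\<^sup>+r. ?F r \<partial>borel_surface_measure P) = \<dots>" .
  have "(\<integral>\<^sup>+x. ennreal (\<beta> * (h (x - p) * transmission V \<beta> p x)) * indicator V x \<partial>lborel) =
      (\<integral>\<^sup>+x. ennreal (f x) * indicator Vis x \<partial>lebesgue)"
    unfolding nn_integral_completion
  proof (rule nn_integral_cong)
    fix x
    have "\<beta> * (h (x - p) * transmission V \<beta> p x) = f x * visibility V p x"
      by (simp add: f_def decay_def transmission_def norm_minus_commute mult_ac)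
    then show "ennreal (\<beta> * (h (x - p) * transmission V \<beta> p x)) * indicator V x = ennreal (f x) * indicator Vis x"
      by (simp add: visibility_def Vis_def indicator_def)
  qed
  with surf have "(\<integral>\<^sup>+r. ?F r \<partial>borel_surface_measure P) +
      (\<integral>\<^sup>+x. ennreal (\<beta> * (h (x - p) * transmission V \<beta> p x)) * indicator V x \<partial>lborel) =
      (\<integral>\<^sup>+x. ennreal (f x) * indicator (\<Union>z\<in>P. shadow V p z) x \<partial>lebesgue) + (\<integral>\<^sup>+x. ennreal (f x) * indicator Vis x \<partial>lebesgue)"
    by simp
  also have "\<dots> = (\<integral>\<^sup>+x. ennreal (f x) * indicator (\<Union>z\<in>P. shadow V p z) x + ennreal (f x) * indicator Vis x \<partial>lebesgue)"
  proof (rule nn_integral_add[symmetric])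
    have [measurable]: "(\<Union>z\<in>P. shadow V p z) \<in> sets lebesgue" using finP by (intro sets.finite_UN) auto
    show "(\<lambda>x. ennreal (f x) * indicator (\<Union>z\<in>P. shadow V p z) x) \<in> borel_measurable lebesgue" by measurable
  qed measurable
  also have "\<dots> \<le> (\<integral>\<^sup>+x. ennreal (f x) \<partial>lebesgue)"
    using disjV by (intro nn_integral_mono) (auto simp: indicator_def)
  also have "\<dots> = (\<integral>\<^sup>+x. ennreal (f x) \<partial>lborel)" by (rule nn_integral_completion)
  also have "\<dots> \<le> ennreal T" using total by (simp add: f_def)
  finally show ?thesis .
qed

section \<open>The radiative transfer kernels\<close>

text \<open>Brings the interior into the same form as the surface, the completion of a measure on
  Borel sets, so that one operator theory covers both. Each measurable set lies between a Borel set
  and its union with a Borel null set, on which both measures agree.\<close>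

lemma lebesgue_on_eq_completion:
  fixes V :: "'a::euclidean_space set"
  assumes V: "V \<in> sets borel"
  shows "lebesgue_on V = completion (restrict_space lborel V)"
proof (rule measure_eqI)
  let ?L = "lebesgue_on V" and ?R = "restrict_space lborel V"
  have VL: "V \<inter> space lebesgue \<in> sets lebesgue" "V \<inter> space lborel \<in> sets lborel" using V by auto
  have null: "N \<in> null_sets ?R \<longleftrightarrow> N \<subseteq> V \<and> N \<in> null_sets lborel" for N
    using V by (auto simp: null_sets_restrict_space)
  have setsR: "A \<in> sets ?R \<longleftrightarrow> A \<subseteq> V \<and> A \<in> sets borel" for A
    using V by (auto simp: sets_restrict_space_iff)
  have decomp: "\<exists>S N. A \<subseteq> V \<and> S \<in> sets ?R \<and> N \<in> null_sets ?R \<and> S \<subseteq> A \<and> A \<subseteq> S \<union> N"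
    if A: "A \<in> sets ?L" for A
  proof -
    have AV: "A \<subseteq> V" "A \<in> sets lebesgue" using A V by (auto simp: sets_restrict_space_iff)
    then obtain S N N' where S: "A = S \<union> N" "N \<subseteq> N'" "N' \<in> null_sets lborel" "S \<in> sets lborel"
      by (auto elim: sets_completionE)
    have "N' \<inter> V \<in> null_sets lborel" using S(3) V by (intro null_set_Int2) auto
    with S AV show ?thesis by (intro exI[of _ S] exI[of _ "N' \<inter> V"]) (auto simp: null setsR)
  qed
  show sets_eq: "sets ?L = sets (completion ?R)"
  proof (intro equalityI subsetI)
    fix A assume A: "A \<in> sets ?L"
    obtain S N where "S \<in> sets ?R" "N \<in> null_sets ?R" "S \<subseteq> A" "A \<subseteq> S \<union> N" using decomp[OF A] by blast
    then show "A \<in> sets (completion ?R)"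
      by (intro sets_completionI[of _ S "A - S" N]) auto
  next
    fix A assume "A \<in> sets (completion ?R)"
    then obtain S N N' where "A = S \<union> N" "N \<subseteq> N'" "N' \<in> null_sets ?R" "S \<in> sets ?R"
      by (auto elim: sets_completionE)
    then show "A \<in> sets ?L"
      using V by (auto simp: null setsR sets_restrict_space_iff intro!: sets_completionI[of _ S N N'])
  qed
  fix A assume A: "A \<in> sets ?L"
  obtain S N where S: "S \<in> sets ?R" "N \<in> null_sets ?R" "S \<subseteq> A" "A \<subseteq> S \<union> N" using decomp[OF A] by blast
  have L: "emeasure ?L B = emeasure lborel B" "emeasure (completion ?R) B = emeasure lborel B" if "B \<in> sets ?R" for B
    using that V by (auto simp: setsR emeasure_restrict_space)
  have SN: "S \<union> N \<in> sets ?R" using S by auto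
  have null_eq: "emeasure lborel (S \<union> N) = emeasure lborel S"
    using S(1,2) by (intro emeasure_Un_null_set) (auto simp: null setsR)
  have *: "emeasure \<mu> A = emeasure lborel S"
    if sets: "sets \<mu> = sets ?L" and eq: "\<And>B. B \<in> sets ?R \<Longrightarrow> emeasure \<mu> B = emeasure lborel B" for \<mu>
  proof (rule antisym)
    have R: "B \<in> sets \<mu>" if "B \<in> sets ?R" for B using that unfolding sets sets_eq by (rule sets_completionI_sets)
    have "emeasure \<mu> A \<le> emeasure \<mu> (S \<union> N)" by (rule emeasure_mono[OF S(4) R[OF SN]])
    then show "emeasure \<mu> A \<le> emeasure lborel S" using eq[OF SN] null_eq by simp
    have "emeasure \<mu> S \<le> emeasure \<mu> A" by (rule emeasure_mono[OF S(3)]) (use A sets in simp)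
    then show "emeasure lborel S \<le> emeasure \<mu> A" using eq[OF S(1)] by simp
  qed
  show "emeasure ?L A = emeasure (completion ?R) A"
    using *[OF refl L(1)] *[OF sets_eq[symmetric] L(2)] by simp
qed

section \<open>Kernels and their masses\<close>

text \<open>The constants of the three kernels are reciprocals of the totals: \<open>pi\<close> for
  mass weighted with the cosine at \<open>p\<close>, \<open>4 * pi\<close> for unweighted mass. The
  factor \<open>\<beta>\<close> in the volume kernels is the normalization of
  \<open>decay\<close>.\<close>

definition ker_a :: "(real^3) set \<Rightarrow> real \<Rightarrow> real^3 \<Rightarrow> real^3 \<Rightarrow> real" where
  "ker_a V \<beta> p r = 1 / pi * (incidence_cos V p r * incidence_cos V r p * transmission V \<beta> p r)"

definition ker_b :: "(real^3) set \<Rightarrow> real \<Rightarrow> real^3 \<Rightarrow> real^3 \<Rightarrow> real" where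
  "ker_b V \<beta> p r = \<beta> / pi * (incidence_cos V p r * transmission V \<beta> p r)"

definition ker_d :: "(real^3) set \<Rightarrow> real \<Rightarrow> real^3 \<Rightarrow> real^3 \<Rightarrow> real" where
  "ker_d V \<beta> p r = \<beta> / (4 * pi) * transmission V \<beta> p r"

text \<open>Where the transmission is nonzero the points see each other and both cosines are
  nonnegative; elsewhere all terms vanish. Absolute values and positive parts, which the flux
  estimate requires, can therefore be dropped.\<close>

lemma incidence_cos_transmission:
  "max 0 (incidence_cos V p r) * transmission V \<beta> p r = incidence_cos V p r * transmission V \<beta> p r"
  "\<bar>incidence_cos V r p\<bar> * transmission V \<beta> p r = incidence_cos V r p * transmission V \<beta> p r"
  "0 \<le> incidence_cos V p r * transmission V \<beta> p r"
  using incidence_cos_nonneg[of p r V] incidence_cos_nonneg[of r p V]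
  by (auto simp: transmission_def visibility_def open_segment_commute)

lemma ker_nonneg:
  assumes "0 \<le> \<beta>"
  shows "0 \<le> ker_a V \<beta> p r" "0 \<le> ker_b V \<beta> p r" "0 \<le> ker_d V \<beta> p r"
proof -
  have "0 \<le> incidence_cos V p r * incidence_cos V r p * transmission V \<beta> p r"
    using incidence_cos_nonneg[of p r V] incidence_cos_nonneg[of r p V]
    by (auto simp: transmission_def visibility_def open_segment_commute)
  then show "0 \<le> ker_a V \<beta> p r" unfolding ker_a_def by (rule mult_nonneg_nonneg[rotated]) simp
  show "0 \<le> ker_b V \<beta> p r" "0 \<le> ker_d V \<beta> p r"
    using assms transmission_nonneg[of V \<beta> p r] incidence_cos_transmission(3)[of V p r \<beta>]
    unfolding ker_b_def ker_d_def by (auto intro!: mult_nonneg_nonneg simp del: times_divide_eq_left)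
qed

lemma ker_sym: "ker_a V \<beta> p r = ker_a V \<beta> r p" "ker_d V \<beta> p r = ker_d V \<beta> r p"
  by (simp_all add: ker_a_def ker_d_def transmission_commute[of V \<beta> p r] mult.commute)

lemma ker_measurable:
  assumes V: "open V"
  shows "(\<lambda>(p, r). ker_a V \<beta> p r) \<in> borel_measurable (borel \<Otimes>\<^sub>M borel)"
    "(\<lambda>(p, r). ker_b V \<beta> p r) \<in> borel_measurable (borel \<Otimes>\<^sub>M borel)"
    "(\<lambda>(p, r). ker_d V \<beta> p r) \<in> borel_measurable (borel \<Otimes>\<^sub>M borel)"
proof -
  have "(\<lambda>z. visibility V (fst z) (snd z)) = indicator {(p, r). open_segment p r \<subseteq> V}"
    by (auto simp: visibility_def fun_eq_iff indicator_def)
  then have [measurable]: "(\<lambda>z. visibility V (fst z) (snd z)) \<in> borel_measurable (borel \<Otimes>\<^sub>M borel)"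
    using visible_pairs_borel[OF V] by simp
  show "(\<lambda>(p, r). ker_a V \<beta> p r) \<in> borel_measurable (borel \<Otimes>\<^sub>M borel)"
    "(\<lambda>(p, r). ker_b V \<beta> p r) \<in> borel_measurable (borel \<Otimes>\<^sub>M borel)"
    "(\<lambda>(p, r). ker_d V \<beta> p r) \<in> borel_measurable (borel \<Otimes>\<^sub>M borel)"
    unfolding ker_a_def ker_b_def ker_d_def transmission_def incidence_cos_def case_prod_unfold by measurable
qed

lemma nn_integral_interior_cmult:
  assumes V: "open V" and [measurable]: "f \<in> borel_measurable borel" and c: "0 \<le> c"
  shows "(\<integral>\<^sup>+x. ennreal (c * f x) \<partial>restrict_space lborel V) =
    ennreal c * (\<integral>\<^sup>+x. ennreal (f x) * indicator V x \<partial>lborel)"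
proof -
  have [measurable]: "V \<in> sets borel" using V by simp
  have "(\<integral>\<^sup>+x. ennreal (c * f x) \<partial>restrict_space lborel V) = (\<integral>\<^sup>+x. ennreal (c * f x) * indicator V x \<partial>lborel)"
    by (intro nn_integral_restrict_space) auto
  also have "\<dots> = ennreal c * (\<integral>\<^sup>+x. ennreal (f x) * indicator V x \<partial>lborel)"
    unfolding ennreal_mult'[OF c] mult.assoc by (intro nn_integral_cmult) measurable
  finally show ?thesis .
qed

text \<open>The flux estimate with the positive part of the cosine at \<open>p\<close> as weight,
  whose total is \<open>pi\<close>.\<close>

lemma mass_boundary:
  assumes V: "open V" and P: "piecewise_smooth_boundary V P" and \<beta>: "0 < \<beta>"
  shows "(\<integral>\<^sup>+r. ennreal (ker_a V \<beta> p r) \<partial>borel_surface_measure P) +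
    (\<integral>\<^sup>+r. ennreal (ker_b V \<beta> p r) \<partial>restrict_space lborel V) \<le> 1"
proof -
  \<comment> \<open>The minus sign compensates that \<open>h\<close> is evaluated at
    \<open>r - p\<close>, while the cosine is taken with \<open>p - r\<close>.\<close>
  define h where "h z = max 0 ((- z \<bullet> outward_normal V p) / norm z)" for z :: "real^3"
  have h: "h \<in> borel_measurable borel" unfolding h_def[abs_def] by measurable
  have hom: "h (c *\<^sub>R z) = h z" if "0 < c" for c z using that by (simp add: h_def)
  have hc: "h (r - p) = max 0 (incidence_cos V p r)" for r
    by (simp add: h_def incidence_cos_def norm_minus_commute)
  note [measurable] = transmission_measurable[OF V] h
  let ?A = "\<lambda>r. \<bar>incidence_cos V r p\<bar> * h (r - p) * transmission V \<beta> p r"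
  let ?B = "\<lambda>x. \<beta> * (h (x - p) * transmission V \<beta> p x)"
  have "(\<integral>\<^sup>+x. ennreal (decay \<beta> (x - p) * h (x - p)) \<partial>lborel) \<le> ennreal pi"
    using nn_integral_decay_cos_le[OF \<beta> norm_outward_normal, of p V p] by (simp add: hc incidence_cos_def)
  from visible_flux_le[OF V P \<beta> h _ hom this]
  have flux: "(\<integral>\<^sup>+r. ennreal (?A r) \<partial>borel_surface_measure P) + (\<integral>\<^sup>+x. ennreal (?B x) * indicator V x \<partial>lborel) \<le> ennreal pi"
    by (simp add: h_def)
  have a: "ker_a V \<beta> p r = 1 / pi * ?A r" and b: "ker_b V \<beta> p r = 1 / pi * ?B r" for r
  proof -
    have "?A r = \<bar>incidence_cos V r p\<bar> * (max 0 (incidence_cos V p r) * transmission V \<beta> p r)"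
      by (simp add: hc)
    also have "\<dots> = incidence_cos V p r * (\<bar>incidence_cos V r p\<bar> * transmission V \<beta> p r)"
      unfolding incidence_cos_transmission(1) by simp
    finally show "ker_a V \<beta> p r = 1 / pi * ?A r"
      unfolding incidence_cos_transmission(2) by (simp only: ker_a_def mult.assoc)
    show "ker_b V \<beta> p r = 1 / pi * ?B r"
      unfolding hc incidence_cos_transmission(1) by (simp add: ker_b_def)
  qed
  have A: "(\<integral>\<^sup>+r. ennreal (ker_a V \<beta> p r) \<partial>borel_surface_measure P) =
      ennreal (1 / pi) * (\<integral>\<^sup>+r. ennreal (?A r) \<partial>borel_surface_measure P)"
    unfolding a by (subst ennreal_mult') (auto simp: incidence_cos_def intro!: nn_integral_cmult)
  have B: "(\<integral>\<^sup>+r. ennreal (ker_b V \<beta> p r) \<partial>restrict_space lborel V) =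
      ennreal (1 / pi) * (\<integral>\<^sup>+x. ennreal (?B x) * indicator V x \<partial>lborel)"
    unfolding b by (intro nn_integral_interior_cmult V) auto
  have "ennreal (1 / pi) * ennreal pi = 1" by (simp flip: ennreal_mult')
  then show ?thesis
    unfolding A B distrib_left[symmetric] using mult_left_mono[OF flux, of "ennreal (1 / pi)"] by simp
qed

text \<open>The flux estimate seen from the interior point \<open>r\<close> with weight 1 and total
  \<open>4 * pi\<close>. Rescaling by \<open>\<beta> / pi\<close> to match \<open>ker_b\<close>
  gives \<open>4 * \<beta>\<close>, the origin of the weight \<open>\<kappa>\<close>.\<close>

lemma mass_interior:
  assumes V: "open V" and P: "piecewise_smooth_boundary V P" and \<beta>: "0 < \<beta>"
  shows "(\<integral>\<^sup>+p. ennreal (ker_b V \<beta> p r) \<partial>borel_surface_measure P) +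
    ennreal (4 * \<beta>) * (\<integral>\<^sup>+p. ennreal (ker_d V \<beta> r p) \<partial>restrict_space lborel V) \<le> ennreal (4 * \<beta>)"
proof -
  note [measurable] = transmission_measurable[OF V]
  let ?A = "\<lambda>p. \<bar>incidence_cos V p r\<bar> * transmission V \<beta> r p" and ?B = "\<lambda>x. \<beta> * transmission V \<beta> r x"
  have "(\<integral>\<^sup>+x. ennreal (decay \<beta> (x - r) * 1) \<partial>lborel) \<le> ennreal (4 * pi)"
    using nn_integral_decay_total(1)[OF \<beta>, of r] by simp
  from visible_flux_le[where h = "\<lambda>_. 1", OF V P \<beta> _ _ _ this]
  have flux: "(\<integral>\<^sup>+p. ennreal (?A p) \<partial>borel_surface_measure P) + (\<integral>\<^sup>+x. ennreal (?B x) * indicator V x \<partial>lborel) \<le> ennreal (4 * pi)"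
    by simp
  have b: "ker_b V \<beta> p r = \<beta> / pi * ?A p" for p
    unfolding incidence_cos_transmission(2) by (simp add: ker_b_def transmission_commute)
  have d: "ker_d V \<beta> r x = 1 / (4 * pi) * ?B x" for x by (simp add: ker_d_def)
  have B: "(\<integral>\<^sup>+p. ennreal (ker_b V \<beta> p r) \<partial>borel_surface_measure P) =
      ennreal (\<beta> / pi) * (\<integral>\<^sup>+p. ennreal (?A p) \<partial>borel_surface_measure P)"
    unfolding b using \<beta> by (subst ennreal_mult') (auto simp: incidence_cos_def intro!: nn_integral_cmult)
  have "ennreal (4 * \<beta>) * ennreal (1 / (4 * pi)) = ennreal (\<beta> / pi)"
    using \<beta> by (simp flip: ennreal_mult')
  moreover have "(\<integral>\<^sup>+p. ennreal (ker_d V \<beta> r p) \<partial>restrict_space lborel V) =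
      ennreal (1 / (4 * pi)) * (\<integral>\<^sup>+x. ennreal (?B x) * indicator V x \<partial>lborel)"
    unfolding d by (intro nn_integral_interior_cmult V) auto
  ultimately have D: "ennreal (4 * \<beta>) * (\<integral>\<^sup>+p. ennreal (ker_d V \<beta> r p) \<partial>restrict_space lborel V) =
      ennreal (\<beta> / pi) * (\<integral>\<^sup>+x. ennreal (?B x) * indicator V x \<partial>lborel)"
    by (simp add: mult.assoc[symmetric])
  have "ennreal (\<beta> / pi) * ennreal (4 * pi) = ennreal (4 * \<beta>)" using \<beta> by (simp flip: ennreal_mult')
  then show ?thesis
    unfolding B D distrib_left[symmetric] using mult_left_mono[OF flux, of "ennreal (\<beta> / pi)"] by simp
qed

text \<open>All of \<open>V\<close> lies within distance \<open>D\<close> of \<open>r\<close>, so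
  the share \<open>exp (- \<beta> * D)\<close> of the decay mass, which lies farther away, is
  missed. This is the gap \<open>\<delta>\<close>.\<close>

lemma mass_interior_interior:
  assumes V: "open V" and \<beta>: "0 < \<beta>" and D: "0 \<le> D" "V \<subseteq> cball r D"
  shows "(\<integral>\<^sup>+p. ennreal (ker_d V \<beta> r p) \<partial>restrict_space lborel V) \<le> ennreal (1 - exp (- \<beta> * D))"
proof -
  let ?B = "\<lambda>x. \<beta> * transmission V \<beta> r x"
  have d: "ker_d V \<beta> r x = 1 / (4 * pi) * ?B x" for x by (simp add: ker_d_def)
  have le: "?B x \<le> decay \<beta> (x - r)" for x
    using \<beta> by (simp add: transmission_def visibility_def decay_def norm_minus_commute)
  have "(\<integral>\<^sup>+p. ennreal (ker_d V \<beta> r p) \<partial>restrict_space lborel V) =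
      ennreal (1 / (4 * pi)) * (\<integral>\<^sup>+x. ennreal (?B x) * indicator V x \<partial>lborel)"
    unfolding d using transmission_measurable[OF V] by (intro nn_integral_interior_cmult V) auto
  also have "\<dots> \<le> ennreal (1 / (4 * pi)) * (\<integral>\<^sup>+x. ennreal (decay \<beta> (x - r)) * indicator (cball r D) x \<partial>lborel)"
    using D(2) le by (intro mult_left_mono nn_integral_mono) (auto simp: indicator_def intro!: ennreal_leI)
  also have "\<dots> = ennreal (1 - exp (- \<beta> * D))"
    unfolding nn_integral_decay_total(2)[OF \<beta> D(1)] by (simp flip: ennreal_mult')
  finally show ?thesis .
qed

lemma coupled_kernels_radiative:
  assumes V: "open V" "bounded V" and P: "piecewise_smooth_boundary V P" and \<beta>: "0 < \<beta>"
  obtains \<delta> where "coupled_kernels (borel_surface_measure P) (restrict_space lborel V)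
    (ker_a V \<beta>) (ker_b V \<beta>) (ker_d V \<beta>) (4 * \<beta>) \<delta>"
proof -
  let ?M = "borel_surface_measure P" and ?N = "restrict_space lborel V"
  obtain D where D: "\<And>x y. x \<in> V \<Longrightarrow> y \<in> V \<Longrightarrow> dist x y \<le> D" "0 \<le> D"
    using V(2) diameter_bounded_bound[of V] diameter_ge_0[of V] by metis
  have VD: "V \<subseteq> cball r D" if "r \<in> V" for r using D(1)[OF that] by auto
  have id: "(\<lambda>x. x) \<in> ?M \<rightarrow>\<^sub>M borel" "(\<lambda>x. x) \<in> ?N \<rightarrow>\<^sub>M borel"
    by (simp_all cong: measurable_cong_sets) (simp add: measurable_restrict_space1)
  have meas: "(\<lambda>(p, r). k p r) \<in> borel_measurable (A \<Otimes>\<^sub>M B)"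
    if "(\<lambda>(p, r). k p r) \<in> borel_measurable (borel \<Otimes>\<^sub>M borel)" "(\<lambda>x. x) \<in> A \<rightarrow>\<^sub>M borel" "(\<lambda>x. x) \<in> B \<rightarrow>\<^sub>M borel"
    for k :: "real^3 \<Rightarrow> real^3 \<Rightarrow> real" and A B
  proof -
    have "(\<lambda>z. (fst z, snd z)) \<in> A \<Otimes>\<^sub>M B \<rightarrow>\<^sub>M borel \<Otimes>\<^sub>M borel"
      using measurable_compose[OF measurable_fst that(2)] measurable_compose[OF measurable_snd that(3)]
      by (rule measurable_Pair)
    from measurable_compose[OF this that(1)] show ?thesis by simp
  qed
  \<comment> \<open>\<open>D\<close> bounds the diameter of \<open>V\<close>, so the gap is uniform
    in the interior point.\<close>
  have "coupled_kernels ?M ?N (ker_a V \<beta>) (ker_b V \<beta>) (ker_d V \<beta>) (4 * \<beta>) (exp (- \<beta> * D))"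
  proof (intro coupled_kernels.intro coupled_kernels_axioms.intro)
    show "sigma_finite_measure ?M"
      using finite_borel_surface_measure[OF P] by (rule finite_measure.axioms(1))
    show "sigma_finite_measure ?N"
      using V(1) by (intro sigma_finite_measure_restrict_space lborel.sigma_finite_measure_axioms) auto
    show "(\<integral>\<^sup>+p. ennreal (ker_d V \<beta> r p) \<partial>?N) \<le> ennreal (1 - exp (- \<beta> * D))" if "r \<in> space ?N" for r
      using that by (intro mass_interior_interior V \<beta> D VD) (simp add: space_restrict_space)
  qed (use \<beta> D(2) in \<open>auto intro!: meas ker_measurable V id ker_nonneg ker_sym mass_boundary mass_interior P\<close>)
  then show ?thesis by (rule that)
qed

text \<open>The boundary equation only determines \<open>q n\<close> implicitly and almost
  everywhere. Convergence is therefore claimed for every run, and existence of a run is claimed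
  alongside it, so that the statement is not vacuous.\<close>

theorem corollary2:
  fixes V :: "(real^3) set"
    and P :: surface_patches
    and \<sigma>\<^sub>a \<sigma>\<^sub>s \<beta> \<epsilon> \<epsilon>\<^sub>0 \<sigma> :: real
    and T :: "real^3 \<Rightarrow> real"
    and s :: ennreal
  assumes "open V" "connected V" "V \<noteq> {}" "bounded V"
    and "piecewise_smooth_boundary V P"
    and "\<sigma>\<^sub>a \<ge> 0" "\<sigma>\<^sub>s \<ge> 0" "\<beta> = \<sigma>\<^sub>a + \<sigma>\<^sub>s" "\<beta> > 0"
    and "\<sigma> > 0"
    and "1 \<le> s"
    and "f1 V P \<beta> \<epsilon> \<sigma>\<^sub>a \<sigma> T \<in> Lp_space s (surface_measure P)"
    and "f2 V P \<beta> \<sigma>\<^sub>a \<sigma> T \<in> Lp_space s (lebesgue_on V)"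
    and "0 < \<epsilon>\<^sub>0" "\<epsilon>\<^sub>0 < 1" "\<epsilon>\<^sub>0 \<le> \<epsilon>" "\<epsilon> \<le> 1"
    and "\<sigma>\<^sub>s / (\<beta> + \<sigma>\<^sub>s) < \<epsilon>\<^sub>0"
  shows "\<forall>G0 \<in> Lp_space s (lebesgue_on V).
    (\<exists>q G. G 0 = G0 \<and> iterative_scheme s V P \<beta> \<epsilon> \<sigma>\<^sub>a \<sigma>\<^sub>s \<sigma> T q G) \<and>
    (\<forall>q G. G 0 = G0 \<and> iterative_scheme s V P \<beta> \<epsilon> \<sigma>\<^sub>a \<sigma>\<^sub>s \<sigma> T q G \<longrightarrow>
       (\<exists>q' G'. Lp_converges s (surface_measure P) q q' \<and> Lp_converges s (lebesgue_on V) G G'))"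
proof
  fix G0 assume "G0 \<in> Lp_space s (lebesgue_on V)"
  let ?M = "borel_surface_measure P" and ?N = "restrict_space lborel V"
  have LV: "lebesgue_on V = completion ?N"
    using assms(1) by (intro lebesgue_on_eq_completion) simp
  obtain \<delta> where "coupled_kernels ?M ?N (ker_a V \<beta>) (ker_b V \<beta>) (ker_d V \<beta>) (4 * \<beta>) \<delta>"
    by (rule coupled_kernels_radiative[OF assms(1,4,5,9)])
  then interpret R: coupled_kernels ?M ?N "ker_a V \<beta>" "ker_b V \<beta>" "ker_d V \<beta>" "4 * \<beta>" \<delta> .
  have \<epsilon>: "0 < \<epsilon>" using assms(14,16) by simp
  have \<beta>: "0 < \<beta>" by (rule assms(9))
  have K1: "K1 V P \<beta> \<epsilon> q p = (1 - \<epsilon>) * R.A.opr q p" for q p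
  proof -
    have "R.A.opr q p = 1 / pi * (LINT r|surface_measure P. exp (- \<beta> * norm (p - r)) *
        (incidence_cos V p r * incidence_cos V r p / (norm (p - r))\<^sup>2) * visibility V p r * q r)"
      unfolding R.A.opr_def surface_measure_def integral_mult_right_zero[symmetric]
      by (intro Bochner_Integration.integral_cong refl) (simp add: ker_a_def transmission_def)
    then show ?thesis by (simp add: K1_def)
  qed
  have K2: "K2 V \<beta> \<epsilon> \<sigma>\<^sub>s H p = \<epsilon> / 4 * (\<sigma>\<^sub>s / \<beta>) * R.B.opr H p" for H p
  proof -
    have "R.B.opr H p = \<beta> / pi * (LINT r|lebesgue_on V. exp (- \<beta> * norm (p - r)) *
        (incidence_cos V p r / (norm (p - r))\<^sup>2) * visibility V p r * H r)"
      unfolding R.B.opr_def LV integral_mult_right_zero[symmetric]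
      by (intro Bochner_Integration.integral_cong refl) (simp add: ker_b_def transmission_def)
    then show ?thesis using \<beta> by (simp add: K2_def)
  qed
  have K3: "K3 V \<beta> \<sigma>\<^sub>s H p = \<sigma>\<^sub>s / \<beta> * R.D.opr H p" for H p
  proof -
    have "R.D.opr H p = \<beta> / (4 * pi) * (LINT r|lebesgue_on V. exp (- \<beta> * norm (p - r)) *
        (1 / (norm (p - r))\<^sup>2) * visibility V p r * H r)"
      unfolding R.D.opr_def LV integral_mult_right_zero[symmetric]
      by (intro Bochner_Integration.integral_cong refl) (simp add: ker_d_def transmission_def)
    then show ?thesis using \<beta> by (simp add: K3_def)
  qed
  \<comment> \<open>Up to its prefactor, \<open>K4\<close> is the transpose of the kernel of
    \<open>K2\<close>: dividing \<open>ker_b\<close> by \<open>4 * \<beta>\<close> leaves the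
    constant \<open>1 / (4 * pi)\<close>.\<close>
  have K4: "K4 V P \<beta> \<epsilon> q p = (1 - \<epsilon>) / (\<epsilon> / 4) * R.Bt.opr q p" for q p
  proof -
    have "R.Bt.opr q p = 1 / (4 * pi) * (LINT r|surface_measure P. exp (- \<beta> * norm (p - r)) *
        (incidence_cos V r p / (norm (p - r))\<^sup>2) * visibility V p r * q r)"
      unfolding R.Bt.opr_def surface_measure_def integral_mult_right_zero[symmetric] using \<beta>
      by (intro Bochner_Integration.integral_cong refl)
        (simp add: ker_b_def transmission_commute[of V \<beta> _ p], simp add: transmission_def mult_ac)
    moreover have "(1 - \<epsilon>) / (\<epsilon> / 4) * (1 / (4 * pi) * L) = (1 - \<epsilon>) / (\<epsilon> * pi) * L" for L
      using \<epsilon> by (simp add: field_simps)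
    ultimately show ?thesis by (simp only: K4_def)
  qed
  \<comment> \<open>The dictionary: reflection factor \<open>1 - \<epsilon>\<close>, albedo
    \<open>\<sigma>\<^sub>s / \<beta>\<close>, and boundary scale \<open>\<epsilon> / 4\<close>,
    which is what \<open>K2\<close> carries besides the albedo and what \<open>K4\<close> divides
    by.\<close>
  have scheme: "iterative_scheme s V P \<beta> \<epsilon> \<sigma>\<^sub>a \<sigma>\<^sub>s \<sigma> T q G \<longleftrightarrow>
      R.is_run s (1 - \<epsilon>) (\<sigma>\<^sub>s / \<beta>) (\<epsilon> / 4) (f1 V P \<beta> \<epsilon> \<sigma>\<^sub>a \<sigma> T) (f2 V P \<beta> \<sigma>\<^sub>a \<sigma> T) q G" for q G
    unfolding iterative_scheme_def R.is_run_def K1 K2 K3 K4 LV surface_measure_def ..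
  have \<eta>: "0 \<le> 1 - \<epsilon>" "1 - \<epsilon> < 1" using \<epsilon> assms(17) by auto
  have \<omega>: "0 \<le> \<sigma>\<^sub>s / \<beta>" "\<sigma>\<^sub>s / \<beta> \<le> 1" using assms(6-8) \<beta> by auto
  have "\<exists>q G. G 0 = G0 \<and> iterative_scheme s V P \<beta> \<epsilon> \<sigma>\<^sub>a \<sigma>\<^sub>s \<sigma> T q G"
    unfolding scheme
    using assms(11-13) \<open>G0 \<in> _\<close> \<eta> by (intro R.ex_is_run) (simp_all add: LV surface_measure_def)
  moreover have "\<exists>q' G'. Lp_converges s (surface_measure P) q q' \<and> Lp_converges s (lebesgue_on V) G G'"
    if "iterative_scheme s V P \<beta> \<epsilon> \<sigma>\<^sub>a \<sigma>\<^sub>s \<sigma> T q G" for q G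
    unfolding LV surface_measure_def
    using that[unfolded scheme] \<epsilon> by (intro R.is_run_converges[OF assms(11) \<eta> \<omega>, of "\<epsilon> / 4"]) auto
  ultimately show "(\<exists>q G. G 0 = G0 \<and> iterative_scheme s V P \<beta> \<epsilon> \<sigma>\<^sub>a \<sigma>\<^sub>s \<sigma> T q G) \<and>
    (\<forall>q G. G 0 = G0 \<and> iterative_scheme s V P \<beta> \<epsilon> \<sigma>\<^sub>a \<sigma>\<^sub>s \<sigma> T q G \<longrightarrow>
       (\<exists>q' G'. Lp_converges s (surface_measure P) q q' \<and> Lp_converges s (lebesgue_on V) G G'))"
    by blast
qed

end
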